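(* The sure reachability problem and the sure repeated reachability problem are decidable for deadlock-free P-VASS-MDPs.
   Context: A VASS-MDP of dimension $d\ge 0$ is a tuple $S=\langle Q,Q_1,Q_P,T,\tau\rangle$ where $Q$ is a finite set of control states partitioned into $Q_1$ (Player 1) and $Q_P$ (probabilistic), $T\subseteq Q\times\mathbb{Z}^d\times Q$ is finite, and $\tau:T\to\mathbb{N}_{>0}$. Configurations are $\langle q,\mathbf{v}\rangle\in Q\times\mathbb{N}^d$; $t=\langle q,\mathbf{z},q'\rangle$ is enabled in $\langle q,\mathbf{v}\rangle$ if $\mathbf{v}+\mathbf{z}\in\mathbb{N}^d$ and leads to $\langle q',\mathbf{v}+\mathbf{z}\rangle$. The induced MDP $M_S=\langle C,C_1,C_P,\rightarrow,p\rangle$ has $C=Q\times\mathbb{N}^d$, $C_1=Q_1\times\mathbb{N}^d$, $C_P=Q_P\times\mathbb{N}^d$, $c\rightarrow c'$ iff $c'$ is obtained from $c$ by an enabled transition, and for $c\in C_P$, $p(c)(c')$ is the total weight of enabled transitions from $c$ leading to $c'$ divided by the total weight of transitions enabled in $c$. A configuration without successor is a deadlock; $S$ is deadlock-free if $M_S$ has no deadlock configuration. A P-VASS-MDP is a VASS-MDP in which every transition $\langle q,\mathbf{z},q'\rangle$ with $q\in Q_1$ has $\mathbf{z}=\mathbf{0}$. A strategy $\sigma$ of Player 1 maps each finite play (sequence $c_0\cdots c_n$ with $c_i\rightarrow c_{i+1}$) ending in $c\in C_1$ to a successor of $c$; $\mathrm{Outcome}(M_S,c,\sigma)$ is the set of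 maximal plays from $c$ consistent with $\sigma$. For $q_F\in Q$, $[\![\Diamond q_F]\!]$ (resp. $[\![\Box\Diamond q_F]\!]$) is the set of plays visiting a configuration with control state $q_F$ at least once (resp. infinitely often). The sure reachability (resp. sure repeated reachability) problem asks, given $S$, an initial configuration $c_0$ and $q_F\in Q$, whether there exists $\sigma$ with $\mathrm{Outcome}(M_S,c_0,\sigma)\subseteq[\![\Diamond q_F]\!]$ (resp. $\subseteq[\![\Box\Diamond q_F]\!]$). *)

theory Defs
  imports Complex_Main "HOL-Library.Nat_Bijection"
begin

section \<open>Partial recursive functions and decidability\<close>

datatype recf =
    Zero
  | Succ
  | Proj nat
  | Comp recf "recf list"
  | PrimRec recf recf
  | Mu recf

text \<open>
  \<open>eval f xs y\<close>: the partial recursive function described by \<open>f\<close> is defined on the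
  arguments \<open>xs\<close>, with value \<open>y\<close>. Arities are not part of the syntax; an arity mismatch
  makes the function undefined. Recursion and minimisation act on the first argument.
\<close>

inductive eval :: "recf \<Rightarrow> nat list \<Rightarrow> nat \<Rightarrow> bool" where
  eval_Zero: "eval Zero xs 0"
| eval_Succ: "eval Succ [x] (Suc x)"
| eval_Proj: "i < length xs \<Longrightarrow> eval (Proj i) xs (xs ! i)"
| eval_Comp: "length ys = length gs \<Longrightarrow> (\<And>i. i < length gs \<Longrightarrow> eval (gs ! i) xs (ys ! i)) \<Longrightarrow>
    eval f ys y \<Longrightarrow> eval (Comp f gs) xs y"
| eval_PrimRec_0: "eval f xs y \<Longrightarrow> eval (PrimRec f g) (0 # xs) y"
| eval_PrimRec_Suc: "eval (PrimRec f g) (n # xs) r \<Longrightarrow> eval g (n # r # xs) y \<Longrightarrow>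
    eval (PrimRec f g) (Suc n # xs) y"
| eval_Mu: "eval f (n # xs) 0 \<Longrightarrow> (\<And>m. m < n \<Longrightarrow> \<exists>y. eval f (m # xs) (Suc y)) \<Longrightarrow>
    eval (Mu f) xs n"

lemma eval_deterministic: "eval f xs y \<Longrightarrow> eval f xs y' \<Longrightarrow> y = y'"
proof (induction arbitrary: y' rule: eval.induct)
  case (eval_Zero xs)
  from eval_Zero.prems show ?case by cases simp
next
  case (eval_Succ x)
  from eval_Succ.prems show ?case by cases simp
next
  case (eval_Proj i xs)
  from eval_Proj.prems show ?case by cases simp
next
  case (eval_Comp ys gs xs f y)
  from eval_Comp.prems show ?case
  proof cases
    case prems': (eval_Comp ys')
    have "ys = ys'"
      using prems'(1,2) eval_Comp.hyps(1) eval_Comp.IH(1) by (simp add: list_eq_iff_nth_eq)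
    with prems'(3) eval_Comp.IH(2) show ?thesis by simp
  qed
next
  case (eval_PrimRec_0 f xs y g)
  from eval_PrimRec_0.prems show ?case by cases (rule eval_PrimRec_0.IH)
next
  case (eval_PrimRec_Suc f g n xs r y)
  from eval_PrimRec_Suc.prems show ?case
    by cases (use eval_PrimRec_Suc.IH in blast)
next
  case (eval_Mu f n xs)
  from eval_Mu.prems show ?case
  proof cases
    case prems': eval_Mu
    have "\<not> n < y'"
    proof
      assume "n < y'"
      then obtain y where "eval f (n # xs) (Suc y)" using prems'(2) by blast
      with eval_Mu.IH(1) show False by blast
    qed
    moreover have "\<not> y' < n"
    proof
      assume "y' < n"
      with eval_Mu.IH(2) prems'(1) show False by blast
    qed
    ultimately show ?thesis by simp
  qed
qed

text \<open>
  A decision problem is given by its set \<open>I\<close> of instances and its set \<open>Y\<close> of positive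
  instances, an instance \<open>x\<close> being presented to the algorithm through the number \<open>code x\<close>.
\<close>

definition decidable_problem :: "('a \<Rightarrow> nat) \<Rightarrow> 'a set \<Rightarrow> 'a set \<Rightarrow> bool" where
  "decidable_problem code I Y \<longleftrightarrow>
     (\<exists>f. \<forall>x\<in>I. eval f [code x] (if x \<in> Y then 1 else 0))"


section \<open>Markov decision processes, plays and strategies\<close>

record 'c mdp =
  confs :: "'c set"
  confs1 :: "'c set"
  confsP :: "'c set"
  step :: "'c \<Rightarrow> 'c \<Rightarrow> bool"
  prob :: "'c \<Rightarrow> 'c \<Rightarrow> real"

definition deadlock :: "'c mdp \<Rightarrow> 'c \<Rightarrow> bool" where
  "deadlock M c \<longleftrightarrow> c \<in> confs M \<and> \<not> (\<exists>c'. step M c c')"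

datatype 'c play = Fin "'c list" | Inf "nat \<Rightarrow> 'c"

definition finite_play :: "'c mdp \<Rightarrow> 'c list \<Rightarrow> bool" where
  "finite_play M cs \<longleftrightarrow> cs \<noteq> [] \<and> set cs \<subseteq> confs M \<and>
     (\<forall>i. Suc i < length cs \<longrightarrow> step M (cs ! i) (cs ! Suc i))"

fun maximal_play :: "'c mdp \<Rightarrow> 'c play \<Rightarrow> bool" where
  "maximal_play M (Fin cs) \<longleftrightarrow> finite_play M cs \<and> deadlock M (last cs)"
| "maximal_play M (Inf \<pi>) \<longleftrightarrow> (\<forall>i. \<pi> i \<in> confs M \<and> step M (\<pi> i) (\<pi> (Suc i)))"

text \<open>
  No choice is required of a strategy at a deadlock; the values of \<open>\<sigma>\<close> on lists that are
  not finite plays ending in a Player 1 configuration are irrelevant.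
\<close>

definition strategy :: "'c mdp \<Rightarrow> ('c list \<Rightarrow> 'c) \<Rightarrow> bool" where
  "strategy M \<sigma> \<longleftrightarrow> (\<forall>cs. finite_play M cs \<and> last cs \<in> confs1 M \<and> \<not> deadlock M (last cs)
     \<longrightarrow> step M (last cs) (\<sigma> cs))"

fun starts_in :: "'c \<Rightarrow> 'c play \<Rightarrow> bool" where
  "starts_in c (Fin cs) \<longleftrightarrow> cs \<noteq> [] \<and> hd cs = c"
| "starts_in c (Inf \<pi>) \<longleftrightarrow> \<pi> 0 = c"

fun consistent :: "'c mdp \<Rightarrow> ('c list \<Rightarrow> 'c) \<Rightarrow> 'c play \<Rightarrow> bool" where
  "consistent M \<sigma> (Fin cs) \<longleftrightarrow>
     (\<forall>i. Suc i < length cs \<and> cs ! i \<in> confs1 M \<longrightarrow> cs ! Suc i = \<sigma> (take (Suc i) cs))"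
| "consistent M \<sigma> (Inf \<pi>) \<longleftrightarrow>
     (\<forall>i. \<pi> i \<in> confs1 M \<longrightarrow> \<pi> (Suc i) = \<sigma> (map \<pi> [0..<Suc i]))"

definition Outcome :: "'c mdp \<Rightarrow> 'c \<Rightarrow> ('c list \<Rightarrow> 'c) \<Rightarrow> 'c play set" where
  "Outcome M c \<sigma> = {\<pi>. maximal_play M \<pi> \<and> starts_in c \<pi> \<and> consistent M \<sigma> \<pi>}"


section \<open>VASS-MDPs\<close>

type_synonym 'q transition = "'q \<times> int list \<times> 'q"
type_synonym 'q config = "'q \<times> nat list"

record 'q vass =
  vdim :: nat
  states :: "'q set"
  states1 :: "'q set"
  statesP :: "'q set"
  transitions :: "'q transition set"
  weight :: "'q transition \<Rightarrow> nat"

definition vass_mdp :: "'q vass \<Rightarrow> bool" where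
  "vass_mdp S \<longleftrightarrow>
     finite (states S) \<and> states S = states1 S \<union> statesP S \<and> states1 S \<inter> statesP S = {} \<and>
     finite (transitions S) \<and>
     transitions S \<subseteq> {(q, z, q'). q \<in> states S \<and> length z = vdim S \<and> q' \<in> states S} \<and>
     (\<forall>t\<in>transitions S. weight S t > 0)"

lemma vass_mdp_finite:
  assumes "vass_mdp S"
  shows "finite (states S)" "finite (states1 S)" "finite (statesP S)" "finite (transitions S)"
proof -
  show f: "finite (states S)" and "finite (transitions S)"
    using assms unfolding vass_mdp_def by blast+
  have "states1 S \<subseteq> states S" "statesP S \<subseteq> states S"
    using assms unfolding vass_mdp_def by blast+
  with f show "finite (states1 S)" "finite (statesP S)" by (auto intro: finite_subset)
qed

definition P_vass_mdp :: "'q vass \<Rightarrow> bool" where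
  "P_vass_mdp S \<longleftrightarrow> vass_mdp S \<and>
     (\<forall>(q, z, q') \<in> transitions S. q \<in> states1 S \<longrightarrow> z = replicate (vdim S) 0)"

fun enabled :: "'q transition \<Rightarrow> 'q config \<Rightarrow> bool" where
  "enabled (q, z, q') (p, v) \<longleftrightarrow> p = q \<and> list_all2 (\<lambda>a x. int a + x \<ge> 0) v z"

fun fire :: "'q transition \<Rightarrow> 'q config \<Rightarrow> 'q config" where
  "fire (q, z, q') (p, v) = (q', map2 (\<lambda>a x. nat (int a + x)) v z)"

definition vectors :: "nat \<Rightarrow> nat list set" where
  "vectors d = {v. length v = d}"

definition induced_mdp :: "'q vass \<Rightarrow> 'q config mdp" where
  "induced_mdp S = \<lparr>
     confs = states S \<times> vectors (vdim S),
     confs1 = states1 S \<times> vectors (vdim S),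
     confsP = statesP S \<times> vectors (vdim S),
     step = (\<lambda>c c'. c \<in> states S \<times> vectors (vdim S) \<and>
       (\<exists>t\<in>transitions S. enabled t c \<and> c' = fire t c)),
     prob = (\<lambda>c c'. real (\<Sum>t | t \<in> transitions S \<and> enabled t c \<and> c' = fire t c. weight S t) /
                     real (\<Sum>t | t \<in> transitions S \<and> enabled t c. weight S t))\<rparr>"

definition deadlock_free :: "'q vass \<Rightarrow> bool" where
  "deadlock_free S \<longleftrightarrow> \<not> (\<exists>c. deadlock (induced_mdp S) c)"


section \<open>Sure reachability and sure repeated reachability\<close>

fun visits :: "'q \<Rightarrow> 'q config play \<Rightarrow> bool" where
  "visits q (Fin cs) \<longleftrightarrow> (\<exists>c\<in>set cs. fst c = q)"
| "visits q (Inf \<pi>) \<longleftrightarrow> (\<exists>i. fst (\<pi> i) = q)"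

fun visits_inf :: "'q \<Rightarrow> 'q config play \<Rightarrow> bool" where
  "visits_inf q (Fin cs) \<longleftrightarrow> False"
| "visits_inf q (Inf \<pi>) \<longleftrightarrow> infinite {i. fst (\<pi> i) = q}"

definition sure_reach :: "'q vass \<Rightarrow> 'q config \<Rightarrow> 'q \<Rightarrow> bool" where
  "sure_reach S c0 qF \<longleftrightarrow>
     (\<exists>\<sigma>. strategy (induced_mdp S) \<sigma> \<and> Outcome (induced_mdp S) c0 \<sigma> \<subseteq> {\<pi>. visits qF \<pi>})"

definition sure_repeated_reach :: "'q vass \<Rightarrow> 'q config \<Rightarrow> 'q \<Rightarrow> bool" where
  "sure_repeated_reach S c0 qF \<longleftrightarrow>
     (\<exists>\<sigma>. strategy (induced_mdp S) \<sigma> \<and> Outcome (induced_mdp S) c0 \<sigma> \<subseteq> {\<pi>. visits_inf qF \<pi>})"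


section \<open>Coding of problem instances\<close>

text \<open>
  Control states of the inputs are named by natural numbers. An instance consists of a
  VASS-MDP, an initial configuration and a target control state.
\<close>

type_synonym instance_data = "nat vass \<times> nat config \<times> nat"

definition deadlock_free_P_instances :: "instance_data set" where
  "deadlock_free_P_instances = {(S, c0, qF).
     P_vass_mdp S \<and> deadlock_free S \<and> c0 \<in> confs (induced_mdp S) \<and> qF \<in> states S}"

fun transition_code :: "nat vass \<Rightarrow> nat transition \<Rightarrow> nat" where
  "transition_code S (q, z, q') =
     list_encode [q, list_encode (map int_encode z), q', weight S (q, z, q')]"

definition vass_code :: "nat vass \<Rightarrow> nat" where
  "vass_code S = list_encode [vdim S, set_encode (states S), set_encode (states1 S),
     set_encode (statesP S), set_encode (transition_code S ` transitions S)]"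

fun instance_code :: "instance_data \<Rightarrow> nat" where
  "instance_code (S, (q, v), qF) = list_encode [vass_code S, q, list_encode v, qF]"

text \<open>
  The code determines the instance, up to values of the weight function outside the set of
  transitions.
\<close>

lemma transition_code_eqD:
  "transition_code S t = transition_code S' t' \<Longrightarrow> t = t' \<and> weight S t = weight S' t'"
  by (cases t; cases t') (simp add: list_encode_eq inj_eq[OF inj_mapI[OF inj_int_encode[of UNIV]]]
      del: list_encode.simps)

lemma instance_code_eqD:
  assumes "vass_mdp S" "vass_mdp S'"
    and "instance_code (S, c0, qF) = instance_code (S', c0', qF')"
  shows "c0 = c0' \<and> qF = qF' \<and> vdim S = vdim S' \<and> states S = states S' \<and>
    states1 S = states1 S' \<and> statesP S = statesP S' \<and> transitions S = transitions S' \<and>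
    (\<forall>t\<in>transitions S. weight S t = weight S' t)"
proof -
  have fin: "finite (states S)" "finite (states1 S)" "finite (statesP S)" "finite (transitions S)"
    using vass_mdp_finite[OF assms(1)] by simp_all
  have fin': "finite (states S')" "finite (states1 S')" "finite (statesP S')"
    "finite (transitions S')"
    using vass_mdp_finite[OF assms(2)] by simp_all
  obtain q v q' v' where c: "c0 = (q, v)" "c0' = (q', v')" by fastforce
  have code: "vass_code S = vass_code S'" and eq: "c0 = c0'" "qF = qF'"
    using assms(3) by (simp_all add: c list_encode_eq del: list_encode.simps)
  have comps: "vdim S = vdim S'" "set_encode (states S) = set_encode (states S')"
    "set_encode (states1 S) = set_encode (states1 S')"
    "set_encode (statesP S) = set_encode (statesP S')"
    "set_encode (transition_code S ` transitions S) =
     set_encode (transition_code S' ` transitions S')"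
    using code by (simp_all add: vass_code_def list_encode_eq del: list_encode.simps)
  have img: "transition_code S ` transitions S = transition_code S' ` transitions S'"
    using comps(5) fin(4) fin'(4) by (simp add: set_encode_eq)
  have sets: "states S = states S'" "states1 S = states1 S'" "statesP S = statesP S'"
    using comps(2-4) fin(1-3) fin'(1-3) by (simp_all add: set_encode_eq)
  have fwd: "t \<in> transitions S' \<and> weight S t = weight S' t" if "t \<in> transitions S" for t
  proof -
    from that have "transition_code S t \<in> transition_code S' ` transitions S'"
      unfolding img[symmetric] by (rule imageI)
    then obtain t' where "transition_code S t = transition_code S' t'" "t' \<in> transitions S'"
      by (rule imageE)
    with transition_code_eqD[of S t S' t'] show ?thesis by metis
  qed
  have "t \<in> transitions S" if "t \<in> transitions S'" for t
  proof -
    from that have "transition_code S' t \<in> transition_code S ` transitions S"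
      unfolding img by (rule imageI)
    then obtain t' where "transition_code S' t = transition_code S t'" "t' \<in> transitions S"
      by (rule imageE)
    with transition_code_eqD[of S' t S t'] show ?thesis by metis
  qed
  with fwd have "transitions S = transitions S'" by blast
  with fwd sets comps(1) eq show ?thesis by blast
qed

end

theory Submission
  imports Defs "HOL-Library.Infinite_Set"
begin

text \<open>
  Player 1 does not change the counters, so larger counter values only help the opponent, and the
  opponent's winning region is upward closed. Both answers have certificates that can be checked by
  an algorithm, and an unbounded search for a certificate of either kind decides the problem.

  If Player 1 cannot win, the opponent can bound the number of visits to the target by some \<open>k\<close>
  (\<open>k = 0\<close> for reachability). The set of \<open>(q, v, k)\<close> for which she can do so is upward closed, and
  by Dickson's lemma a finite basis of it is a certificate.

  If Player 1 wins, truncate the counters of her winning region at a bound \<open>\<beta>\<close> of the basis of its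
  complement, reading \<open>\<beta>\<close> as \<open>\<omega>\<close>. This leaves a finite graph, on which she has a memoryless strategy
  such that no cycle that avoids the target has a nonnegative effect; otherwise the opponent would
  survive with a large enough credit in the \<open>\<omega>\<close>-counters. By Farkas' lemma the absence of such cycles
  is witnessed by linear ranking functions. Conversely, by Dickson's lemma an infinite play avoiding
  the target would contain such a cycle.
\<close>

section \<open>Computable functions and semidecidable predicates\<close>

text \<open>A lost position of repeated reachability carries a number \<open>k\<close> and not an
  ordinal rank, because Player 1 has finitely many moves and finitely many bounds have a common one
  (\<open>Lose_uniform\<close>). The number then behaves like a further counter, and Dickson's lemma
  treats both problems at once.

  The obstacle lies on the winning side. In the truncated graph the opponent spends
  \<open>\<omega>\<close>-entries freely, so an infinite path that avoids the target need not be a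
  real play. Survival is therefore judged in an energy game with unknown initial credit, in which
  the opponent of Player 1 is the energy player. Any credit can be granted: an entry
  \<open>\<beta>\<close> stands for every larger value as well, and by the choice of
  \<open>\<beta>\<close> a position lost with the credit is still lost after truncation, that is, at
  the node itself.

  A ranking is demanded for every nonempty set of edges, not once for the whole graph: different
  cycles may be limited by different counters, and the set of edges used by a suspicious segment of
  a play must itself contain an edge on which the ranking strictly drops.\<close>

definition computable :: "(nat \<Rightarrow> nat) \<Rightarrow> bool" where
  "computable f \<longleftrightarrow> (\<exists>r. \<forall>x. eval r [x] (f x))"

definition computable2 :: "(nat \<Rightarrow> nat \<Rightarrow> nat) \<Rightarrow> bool" where
  "computable2 f \<longleftrightarrow> (\<exists>r. \<forall>x y. eval r [x, y] (f x y))"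

definition computable3 :: "(nat \<Rightarrow> nat \<Rightarrow> nat \<Rightarrow> nat) \<Rightarrow> bool" where
  "computable3 f \<longleftrightarrow> (\<exists>r. \<forall>x y z. eval r [x, y, z] (f x y z))"

lemma eval_Comp1: "eval g xs a \<Longrightarrow> eval f [a] y \<Longrightarrow> eval (Comp f [g]) xs y"
  by (rule eval_Comp[where ys = "[a]"]) auto

lemma eval_Comp2:
  "eval g xs a \<Longrightarrow> eval h xs b \<Longrightarrow> eval f [a, b] y \<Longrightarrow> eval (Comp f [g, h]) xs y"
  by (rule eval_Comp[where ys = "[a, b]"]) (auto simp: less_Suc_eq)

lemma eval_Proj0: "eval (Proj 0) (x # xs) x"
  using eval_Proj[of 0 "x # xs"] by simp

lemma eval_Proj1: "eval (Proj 1) (x # y # xs) y"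
  using eval_Proj[of 1 "x # y # xs"] by simp

lemma eval_Proj2: "eval (Proj 2) (x # y # z # xs) z"
  using eval_Proj[of 2 "x # y # z # xs"] by simp

lemmas eval_Projs = eval_Proj0 eval_Proj1 eval_Proj2

lemma computable_compose1: "computable f \<Longrightarrow> computable g \<Longrightarrow> computable (\<lambda>x. f (g x))"
  unfolding computable_def using eval_Comp1 by meson

lemma computable_compose2: "computable2 f \<Longrightarrow> computable g \<Longrightarrow> computable h \<Longrightarrow> computable (\<lambda>x. f (g x) (h x))"
  unfolding computable_def computable2_def using eval_Comp2 by meson

lemma computable2_compose1: "computable f \<Longrightarrow> computable2 g \<Longrightarrow> computable2 (\<lambda>x y. f (g x y))"
  unfolding computable_def computable2_def using eval_Comp1 by meson

lemma computable2_compose2: "computable2 f \<Longrightarrow> computable2 g \<Longrightarrow> computable2 h \<Longrightarrow> computable2 (\<lambda>x y. f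
    (g x y) (h x y))"
  unfolding computable2_def using eval_Comp2 by meson

lemma computable3_compose1: "computable f \<Longrightarrow> computable3 g \<Longrightarrow> computable3 (\<lambda>x y z. f (g x y z))"
  unfolding computable_def computable3_def using eval_Comp1 by meson

lemma computable3_compose2: "computable2 f \<Longrightarrow> computable3 g \<Longrightarrow> computable3 h \<Longrightarrow> computable3 (\<lambda>x y z.
    f (g x y z) (h x y z))"
  unfolding computable2_def computable3_def using eval_Comp2 by meson

lemma computable_id: "computable (\<lambda>x. x)"
  unfolding computable_def using eval_Proj0 by blast

lemma computable2_proj: "computable2 (\<lambda>x y. x)" "computable2 (\<lambda>x y. y)"
  unfolding computable2_def using eval_Projs by blast+

lemma computable3_proj: "computable3 (\<lambda>x y z. x)" "computable3 (\<lambda>x y z. y)" "computable3 (\<lambda>x y z. z)"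
  unfolding computable3_def using eval_Projs by blast+

lemma computable_Suc: "computable Suc"
  unfolding computable_def using eval_Succ by blast

lemma computable_0: "computable (\<lambda>x. 0)"
  unfolding computable_def using eval_Zero by blast

lemma computable_const: "computable (\<lambda>x. c)"
  by (induction c) (auto intro: computable_0 computable_compose1[OF computable_Suc])

lemma computable_rec1:
  assumes "computable2 g"
  shows "computable (rec_nat c g)"
proof -
  obtain r where r: "\<And>x y. eval r [x, y] (g x y)" using assms unfolding computable2_def by blast
  \<comment> \<open>\<open>PrimRec s r\<close> with one argument evaluates \<open>s\<close> on the
    empty list, so a constant that accepts any argument list is needed.\<close>
  obtain s where s: "\<And>xs. eval s xs c"
  proof -
    have "\<exists>s. \<forall>xs. eval s xs c"
    proof (induction c)
      case 0 show ?case using eval_Zero by blast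
    next
      case (Suc c)
      then obtain s where "\<And>xs. eval s xs c" by blast
      then have "eval (Comp Succ [s]) xs (Suc c)" for xs
        by (rule eval_Comp1) (rule eval_Succ)
      then show ?case by blast
    qed
    then show ?thesis using that by blast
  qed
  have "eval (PrimRec s r) [x] (rec_nat c g x)" for x
    by (induction x) (auto intro: eval_PrimRec_0 s eval_PrimRec_Suc r)
  then show ?thesis unfolding computable_def by blast
qed

lemma computable2_rec:
  assumes "computable f" "computable3 g"
  shows "computable2 (\<lambda>n x. rec_nat (f x) (\<lambda>i r. g i r x) n)"
proof -
  obtain r0 where r0: "\<And>x. eval r0 [x] (f x)" using assms unfolding computable_def by blast
  obtain r where r: "\<And>x y z. eval r [x, y, z] (g x y z)" using assms unfolding computable3_def by blast
  have "eval (PrimRec r0 r) [n, x] (rec_nat (f x) (\<lambda>i r. g i r x) n)" for n x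
    by (induction n) (auto intro: eval_PrimRec_0 r0 eval_PrimRec_Suc r)
  then show ?thesis unfolding computable2_def by blast
qed

lemma computable2_add: "computable2 (+)"
proof -
  have "rec_nat x (\<lambda>i r. Suc r) n = n + x" for n x :: nat by (induction n) auto
  then show ?thesis
    using computable2_rec[OF computable_id computable3_compose1[OF computable_Suc
        computable3_proj(2)]] by simp
qed

lemma computable2_mult: "computable2 (*)"
proof -
  have "rec_nat 0 (\<lambda>i r. r + x) n = n * x" for n x :: nat by (induction n) auto
  then show ?thesis
    using computable2_rec[OF computable_0 computable3_compose2[OF computable2_add
        computable3_proj(2,3)]] by simp
qed

lemma computable_pred: "computable (\<lambda>x. x - 1)"
proof -
  have "rec_nat 0 (\<lambda>i r. i) = (\<lambda>n. n - 1)"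
  proof
    show "rec_nat 0 (\<lambda>i r. i) n = n - 1" for n by (cases n) auto
  qed
  with computable_rec1[OF computable2_proj(1), of 0] show ?thesis by (simp only:)
qed

lemma computable2_diff: "computable2 (-)"
proof -
  have "rec_nat x (\<lambda>i r. r - 1) n = x - n" for n x :: nat by (induction n) auto
  then have "computable2 (\<lambda>n x. x - n)"
    using computable2_rec[OF computable_id computable3_compose1[OF computable_pred
        computable3_proj(2)]] by simp
  from computable2_compose2[OF this computable2_proj(2,1)] show ?thesis by simp
qed

lemma computable_triangle: "computable triangle"
proof -
  have "rec_nat 0 (\<lambda>i r. r + Suc i) = triangle"
  proof
    show "rec_nat 0 (\<lambda>i r. r + Suc i) n = triangle n" for n by (induction n) auto
  qed
  with computable_rec1[OF computable2_compose2[OF computable2_add computable2_proj(2)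
      computable2_compose1[OF computable_Suc computable2_proj(1)]], of 0]
  show ?thesis by (simp only:)
qed

section \<open>Pairing and its projections\<close>

abbreviation pair :: "nat \<Rightarrow> nat \<Rightarrow> nat" where "pair a b \<equiv> prod_encode (a, b)"
definition pfst :: "nat \<Rightarrow> nat" where "pfst p = fst (prod_decode p)"
definition psnd :: "nat \<Rightarrow> nat" where "psnd p = snd (prod_decode p)"

lemma pfst_pair [simp]: "pfst (pair a b) = a" by (simp add: pfst_def)
lemma psnd_pair [simp]: "psnd (pair a b) = b" by (simp add: psnd_def)

lemma computable2_pair: "computable2 pair"
proof -
  have "pair = (\<lambda>a b. triangle (a + b) + a)" by (intro ext) (simp add: prod_encode_def)
  with computable2_compose2[OF computable2_add computable2_compose1[OF computable_triangle
      computable2_add] computable2_proj(1)]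
  show ?thesis by (simp only:)
qed

text \<open>The largest \<open>s\<close> with \<open>triangle s \<le> p\<close> is the diagonal on which \<open>prod_decode p\<close> lies.\<close>

definition diag :: "nat \<Rightarrow> nat" where
  "diag = rec_nat 0 (\<lambda>p s. s + (1 - (triangle (Suc s) - Suc p)))"

lemma diag_bounds: "triangle (diag p) \<le> p \<and> p < triangle (Suc (diag p))"
proof (induction p)
  case (Suc p)
  \<comment> \<open>The truncated differences act as a test: the summand is 1 exactly if
    \<open>Suc p\<close> has reached \<open>triangle (Suc (diag p))\<close>.\<close>
  have "diag (Suc p) = diag p + (1 - (triangle (Suc (diag p)) - Suc p))" by (simp add: diag_def)
  with Suc show ?case by (cases "triangle (Suc (diag p)) = Suc p") auto
qed (simp add: diag_def)

lemma triangle_mono: "a \<le> b \<Longrightarrow> triangle a \<le> triangle b"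
  by (induction b) (auto simp: le_Suc_eq)

lemma diag_pair: "diag (pair a b) = a + b"
proof -
  have "triangle (a + b) \<le> pair a b" "pair a b < triangle (Suc (a + b))"
    by (auto simp: prod_encode_def)
  moreover note diag_bounds[of "pair a b"]
  ultimately show ?thesis
    using triangle_mono[of "Suc (a + b)" "diag (pair a b)"]
      triangle_mono[of "Suc (diag (pair a b))" "a + b"] by linarith
qed

lemma computable_diag: "computable diag"
  unfolding diag_def
  by (intro computable_rec1 computable2_compose2[OF computable2_add] computable2_compose2[OF
      computable2_diff] computable2_proj
     computable2_compose1[OF computable_triangle] computable2_compose1[OF computable_Suc]
         computable2_compose1[OF computable_const computable2_proj(1)])

lemma pfst_eq: "pfst p = p - triangle (diag p)" and psnd_eq: "psnd p = diag p - pfst p"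
proof -
  obtain a b where "p = pair a b" by (metis prod_decode_inverse surj_pair)
  then show "pfst p = p - triangle (diag p)" "psnd p = diag p - pfst p"
    by (simp_all add: diag_pair) (simp add: prod_encode_def)
qed

lemma computable_pfst: "computable pfst"
  unfolding pfst_eq[abs_def]
  by (intro computable_compose2[OF computable2_diff] computable_id computable_compose1[OF
      computable_triangle] computable_diag)

lemma computable_psnd: "computable psnd"
  unfolding psnd_eq[abs_def]
  by (intro computable_compose2[OF computable2_diff] computable_id computable_pfst computable_diag)

text \<open>Index, previous value and environment are packed into one nested pair, so that
  expressions with any number of bound variables can be handled by introduction rules for
  one-argument functions.\<close>

lemma computable_rec:
  assumes "computable f" "computable (\<lambda>p. g (pfst p) (pfst (psnd p)) (psnd (psnd p)))" "computable h"
  shows "computable (\<lambda>x. rec_nat (f x) (\<lambda>i r. g i r x) (h x))"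
proof -
  have "computable3 (\<lambda>x y z. pair x (pair y z))"
    by (intro computable3_compose2[OF computable2_pair] computable3_proj)
  from computable3_compose1[OF assms(2) this] have "computable3 g" by simp
  from computable2_rec[OF assms(1) this] show ?thesis
    using computable_compose2[OF _ assms(3) computable_id] by blast
qed

text \<open>Under a binder the environment \<open>x\<close> becomes \<open>psnd p\<close> and the bound variable \<open>pfst p\<close>.\<close>

named_theorems computable_intros

lemmas [computable_intros] =
  computable_id computable_const computable_compose1[OF computable_Suc] computable_compose1[OF
      computable_pfst] computable_compose1[OF computable_psnd]
  computable_compose2[OF computable2_add] computable_compose2[OF computable2_mult]
      computable_compose2[OF computable2_diff]
  computable_compose2[OF computable2_pair]

lemma computable_sum [computable_intros]:
  assumes "computable (\<lambda>p. f (pfst p) (psnd p))" "computable b"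
  shows "computable (\<lambda>x. \<Sum>i<b x. f i x)"
proof -
  have "(\<Sum>i<n. f i x) = rec_nat 0 (\<lambda>i r. r + f i x) n" for n x by (induction n) auto
  moreover have "computable (\<lambda>x. rec_nat 0 (\<lambda>i r. r + f i x) (b x))"
  proof (rule computable_rec)
    have "computable (\<lambda>p. pair (pfst p) (psnd (psnd p)))" by (intro computable_intros)
    from computable_compose1[OF assms(1) this] have "computable (\<lambda>p. f (pfst p) (psnd (psnd p)))" by simp
    then show "computable (\<lambda>p. pfst (psnd p) + f (pfst p) (psnd (psnd p)))" by (intro computable_intros)
  qed (intro computable_intros assms(2))+
  ultimately show ?thesis by simp
qed

section \<open>Decidable predicates\<close>

definition decidable :: "(nat \<Rightarrow> bool) \<Rightarrow> bool" where
  "decidable P \<longleftrightarrow> computable (\<lambda>x. of_bool (P x))"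

named_theorems decidable_intros

lemma decidable_not [decidable_intros]: "decidable P \<Longrightarrow> decidable (\<lambda>x. \<not> P x)"
proof -
  assume "decidable P"
  then have "computable (\<lambda>x. 1 - of_bool (P x))" unfolding decidable_def by (intro computable_intros)
  moreover have "(\<lambda>x. 1 - of_bool (P x)) = (\<lambda>x. of_bool (\<not> P x) :: nat)" by auto
  ultimately show ?thesis unfolding decidable_def by simp
qed

lemma decidable_conj [decidable_intros]: "decidable P \<Longrightarrow> decidable Q \<Longrightarrow> decidable (\<lambda>x. P x \<and> Q x)"
  unfolding decidable_def of_bool_conj by (intro computable_intros)

lemma decidable_disj [decidable_intros]: "decidable P \<Longrightarrow> decidable Q \<Longrightarrow> decidable (\<lambda>x. P x \<or> Q x)"
  using decidable_not[OF decidable_conj[OF decidable_not decidable_not, of P Q]] by simp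

lemma decidable_imp [decidable_intros]: "decidable P \<Longrightarrow> decidable Q \<Longrightarrow> decidable (\<lambda>x. P x \<longrightarrow> Q x)"
  unfolding imp_conv_disj by (intro decidable_disj decidable_not)

lemma decidable_less [decidable_intros]: "computable f \<Longrightarrow> computable g \<Longrightarrow> decidable (\<lambda>x. f x < g x)"
proof -
  assume "computable f" "computable g"
  then have "computable (\<lambda>x. 1 - (1 - (g x - f x)))" by (intro computable_intros)
  moreover have "(\<lambda>x. 1 - (1 - (g x - f x))) = (\<lambda>x. of_bool (f x < g x))" by auto
  ultimately show ?thesis unfolding decidable_def by simp
qed

lemma decidable_le [decidable_intros]: "computable f \<Longrightarrow> computable g \<Longrightarrow> decidable (\<lambda>x. f x \<le> g x)"
  using decidable_not[OF decidable_less, of g f] by (simp add: not_less)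

lemma decidable_eq [decidable_intros]: "computable f \<Longrightarrow> computable g \<Longrightarrow> decidable (\<lambda>x. f x = g x)"
  using decidable_conj[OF decidable_le decidable_le, of f g g f] by (simp add: eq_iff)

lemma decidable_const [decidable_intros]: "decidable (\<lambda>x. c)"
  unfolding decidable_def by (rule computable_const)

text \<open>A bounded sum counts the counterexamples, and the count is compared with 0.\<close>

lemma decidable_all [decidable_intros]:
  assumes "decidable (\<lambda>p. P (pfst p) (psnd p))" "computable b"
  shows "decidable (\<lambda>x. \<forall>i<b x. P i x)"
proof -
  have "decidable (\<lambda>x. (\<Sum>i<b x. of_bool (\<not> P i x)) = (0::nat))"
    using decidable_not[OF assms(1)] assms(2) by (intro decidable_eq computable_sum
        computable_const) (simp_all add: decidable_def)
  moreover have "(\<Sum>i<n. of_bool (\<not> P i x)) = (0::nat) \<longleftrightarrow> (\<forall>i<n. P i x)" for n x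
    by (simp del: sum_of_bool_eq) auto
  ultimately show ?thesis by simp
qed

lemma decidable_ex [decidable_intros]:
  assumes "decidable (\<lambda>p. P (pfst p) (psnd p))" "computable b"
  shows "decidable (\<lambda>x. \<exists>i<b x. P i x)"
  using decidable_not[OF decidable_all[OF decidable_not[OF assms(1)] assms(2)]] by simp

lemma computable_if [computable_intros]:
  assumes "decidable P" "computable f" "computable g"
  shows "computable (\<lambda>x. if P x then f x else g x)"
proof -
  have "computable (\<lambda>x. of_bool (P x) * f x + of_bool (\<not> P x) * g x)"
    using assms(1) decidable_not[OF assms(1)] assms(2,3) unfolding decidable_def by (intro
        computable_intros)
  moreover have "(\<lambda>x. of_bool (P x) * f x + of_bool (\<not> P x) * g x) =
    (\<lambda>x. if P x then f x else g x)" by auto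
  ultimately show ?thesis by simp
qed

lemma computable_half [computable_intros]: "computable f \<Longrightarrow> computable (\<lambda>x. f x div 2)"
proof -
  assume "computable f"
  \<comment> \<open>Halving is a recursion since \<open>Suc i div 2 = i - i div 2\<close>.\<close>
  have "n div 2 = rec_nat 0 (\<lambda>i r. i - r) n" for n :: nat
    by (induction n) auto
  moreover have "computable (\<lambda>x. rec_nat 0 (\<lambda>i r. i - r) (f x))"
    by (rule computable_rec) (intro computable_intros \<open>computable f\<close>)+
  ultimately show ?thesis by simp
qed

lemma decidable_even [decidable_intros]: "computable f \<Longrightarrow> decidable (\<lambda>x. even (f x))"
proof -
  assume "computable f"
  then have "decidable (\<lambda>x. f x = 2 * (f x div 2))" by (intro decidable_intros computable_intros)
  moreover have "n = 2 * (n div 2) \<longleftrightarrow> even n" for n :: nat by presburger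
  ultimately show ?thesis by simp
qed

lemma decidable_mem_set_decode [decidable_intros]:
  assumes "computable f" "computable g"
  shows "decidable (\<lambda>x. f x \<in> set_decode (g x))"
proof -
  have iter: "n div 2 ^ i = rec_nat n (\<lambda>i r. r div 2) i" for n i :: nat
  proof (induction i)
    case (Suc i)
    have "n div 2 ^ Suc i = n div 2 ^ i div 2" unfolding power_Suc2 by (rule div_mult2_eq)
    then show ?case by (simp add: Suc)
  qed simp
  have "computable (\<lambda>x. rec_nat (g x) (\<lambda>i r. r div 2) (f x))"
    by (rule computable_rec) (intro computable_intros assms)+
  then show ?thesis unfolding set_decode_def mem_Collect_eq iter by (intro decidable_intros)
qed

text \<open>\<open>fn c i\<close> is entry \<open>i\<close> of the list coded by \<open>c\<close>, and \<open>0\<close> beyond its end. Numbers thus also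
  serve as codes of functions on initial segments.\<close>

definition fn :: "nat \<Rightarrow> nat \<Rightarrow> nat" where
  "fn c i = pfst (rec_nat c (\<lambda>i r. psnd (r - 1)) i - 1)"

lemma fn_0 [simp]: "fn (list_encode (y # ys)) 0 = y"
  by (simp add: fn_def)

lemma fn_Suc [simp]: "fn (list_encode (y # ys)) (Suc i) = fn (list_encode ys) i"
proof -
  have "rec_nat (list_encode (y # ys)) (\<lambda>i r. psnd (r - 1)) (Suc i) =
    rec_nat (list_encode ys) (\<lambda>i r. psnd (r - 1)) i"
    by (induction i) auto
  then show ?thesis unfolding fn_def by simp
qed

lemma fn_list_encode: "i < length ys \<Longrightarrow> fn (list_encode ys) i = ys ! i"
proof (induction ys arbitrary: i)
  case (Cons y ys)
  then show ?case by (cases i) (simp_all del: list_encode.simps)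
qed simp

lemma computable_fn [computable_intros]:
  assumes "computable f" "computable g"
  shows "computable (\<lambda>x. fn (f x) (g x))"
proof -
  have "computable (\<lambda>x. rec_nat (f x) (\<lambda>i r. psnd (r - 1)) (g x))"
    by (rule computable_rec) (intro computable_intros assms)+
  then show ?thesis unfolding fn_def by (intro computable_intros)
qed

text \<open>Rankings come as functions on all numbers but are consulted at finitely many arguments,
  so the code of a finite list can replace them.\<close>

lemma fn_exists: "\<exists>c. \<forall>i<n. fn c i = f i"
  by (rule exI[of _ "list_encode (map f [0..<n])"]) (simp add: fn_list_encode)

section \<open>Semidecidable predicates and search\<close>

definition semidecidable :: "(nat \<Rightarrow> bool) \<Rightarrow> bool" where
  "semidecidable P \<longleftrightarrow> (\<exists>R. decidable R \<and> (\<forall>x. P x \<longleftrightarrow> (\<exists>n. R (pair n x))))"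

named_theorems semidecidable_intros

lemma semidecidableI: "decidable R \<Longrightarrow> (\<And>x. P x \<longleftrightarrow> (\<exists>n. R (pair n x))) \<Longrightarrow> semidecidable P"
  unfolding semidecidable_def by blast

lemma decidable_compose: "decidable P \<Longrightarrow> computable f \<Longrightarrow> decidable (\<lambda>x. P (f x))"
  unfolding decidable_def by (rule computable_compose1)

lemma semidecidable_of_decidable: "decidable P \<Longrightarrow> semidecidable P"
  by (rule semidecidableI[where R = "\<lambda>p. P (psnd p)"], erule decidable_compose) (simp_all add:
      computable_psnd)

lemma semidecidable_ex [semidecidable_intros]:
  assumes "semidecidable (\<lambda>p. P (pfst p) (psnd p))"
  shows "semidecidable (\<lambda>x. \<exists>i. P i x)"
proof -
  obtain R where R: "decidable R" "\<And>p. P (pfst p) (psnd p) \<longleftrightarrow> (\<exists>n. R (pair n p))"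
    using assms unfolding semidecidable_def by blast
  show ?thesis
  proof (rule semidecidableI)
    show "decidable (\<lambda>p. R (pair (pfst (pfst p)) (pair (psnd (pfst p)) (psnd p))))"
      by (intro decidable_compose[OF R(1)] computable_intros)
    show "(\<exists>i. P i x) \<longleftrightarrow> (\<exists>n. R (pair (pfst (pfst (pair n x))) (pair (psnd (pfst (pair n x))) (psnd
        (pair n x)))))" for x
      using R(2)[of "pair _ x"] by simp (metis pfst_pair psnd_pair)
  qed
qed

lemma semidecidable_conj [semidecidable_intros]:
  assumes "semidecidable P" "semidecidable Q"
  shows "semidecidable (\<lambda>x. P x \<and> Q x)"
proof -
  obtain R R' where R: "decidable R" "\<And>x. P x \<longleftrightarrow> (\<exists>n. R (pair n x))"
    and R': "decidable R'" "\<And>x. Q x \<longleftrightarrow> (\<exists>n. R' (pair n x))"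
    using assms unfolding semidecidable_def by blast
  show ?thesis
  proof (rule semidecidableI)
    show "decidable (\<lambda>p. R (pair (pfst (pfst p)) (psnd p)) \<and> R' (pair (psnd (pfst p)) (psnd p)))"
      by (intro decidable_intros decidable_compose[OF R(1)] decidable_compose[OF R'(1)]
          computable_intros)
    show "(P x \<and> Q x) \<longleftrightarrow> (\<exists>n. R (pair (pfst (pfst (pair n x))) (psnd (pair n x))) \<and>
       R' (pair (psnd (pfst (pair n x))) (psnd (pair n x))))" for x
      unfolding R(2) R'(2) by simp (metis pfst_pair psnd_pair)
  qed
qed

lemma semidecidable_disj [semidecidable_intros]:
  assumes "semidecidable P" "semidecidable Q"
  shows "semidecidable (\<lambda>x. P x \<or> Q x)"
proof -
  obtain R R' where R: "decidable R" "\<And>x. P x \<longleftrightarrow> (\<exists>n. R (pair n x))"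
    and R': "decidable R'" "\<And>x. Q x \<longleftrightarrow> (\<exists>n. R' (pair n x))"
    using assms unfolding semidecidable_def by blast
  show ?thesis
    by (rule semidecidableI[where R = "\<lambda>p. R p \<or> R' p"]) (use R R' in \<open>auto intro: decidable_intros\<close>)
qed

text \<open>The premise occurs negatively, which is why it has to be decidable.\<close>

lemma semidecidable_imp [semidecidable_intros]: "decidable P \<Longrightarrow> semidecidable Q \<Longrightarrow> semidecidable
    (\<lambda>x. P x \<longrightarrow> Q x)"
  unfolding imp_conv_disj by (intro semidecidable_disj semidecidable_of_decidable[OF decidable_not])

text \<open>Finitely many witnesses lie below one number, for instance the successor of their sum;
  that number is the witness for the whole quantifier and turns the inner search into a bounded
  one.\<close>

lemma semidecidable_all [semidecidable_intros]:
  assumes "semidecidable (\<lambda>p. P (pfst p) (psnd p))" "computable b"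
  shows "semidecidable (\<lambda>x. \<forall>i<b x. P i x)"
proof -
  obtain R where R: "decidable R" "\<And>p. P (pfst p) (psnd p) \<longleftrightarrow> (\<exists>n. R (pair n p))"
    using assms unfolding semidecidable_def by blast
  have P: "P i x \<longleftrightarrow> (\<exists>n. R (pair n (pair i x)))" for i x using R(2)[of "pair i x"] by simp
  show ?thesis
  proof (rule semidecidableI)
    show "decidable (\<lambda>p. \<forall>i<b (psnd p). \<exists>n<pfst p. R (pair n (pair i (psnd p))))"
      by (intro decidable_intros decidable_compose[OF R(1)] computable_intros
          computable_compose1[OF assms(2)])
    show "(\<forall>i<b x. P i x) \<longleftrightarrow> (\<exists>n. \<forall>i<b (psnd (pair n x)). \<exists>m<pfst (pair n x). R (pair m (pair i
        (psnd (pair n x)))))" for x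
    proof
      assume "\<forall>i<b x. P i x"
      then have "\<forall>i<b x. \<exists>n. R (pair n (pair i x))" unfolding P .
      then obtain g where g: "\<And>i. i < b x \<Longrightarrow> R (pair (g i) (pair i x))" by metis
      have "\<forall>i<b x. \<exists>m<Suc (\<Sum>i<b x. g i). R (pair m (pair i x))"
        using g member_le_sum[of _ "{..<b x}" g] by (metis finite_lessThan lessThan_iff
            less_Suc_eq_le zero_le)
      then show "\<exists>n. \<forall>i<b (psnd (pair n x)). \<exists>m<pfst (pair n x). R (pair m (pair i (psnd (pair n x))))"
        by auto
    qed (auto simp: P)
  qed
qed

text \<open>Post's theorem under a promise: the two searches exhaust and exclude each other only on
  codes of instances, and nothing is claimed about other numbers.\<close>

lemma decidable_by_search:
  assumes "semidecidable P" "semidecidable N"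
    and "\<And>x. x \<in> I \<Longrightarrow> P (code x) \<or> N (code x)"
    and "\<And>x. x \<in> I \<Longrightarrow> P (code x) \<Longrightarrow> x \<in> Y"
    and "\<And>x. x \<in> I \<Longrightarrow> N (code x) \<Longrightarrow> x \<notin> Y"
  shows "decidable_problem code I Y"
proof -
  obtain R R' where R: "decidable R" "\<And>x. P x \<longleftrightarrow> (\<exists>n. R (pair n x))"
    and R': "decidable R'" "\<And>x. N x \<longleftrightarrow> (\<exists>n. R' (pair n x))"
    using assms(1,2) unfolding semidecidable_def by blast
  have "decidable (\<lambda>p. \<not> (R p \<or> R' p))" using R(1) R'(1) by (intro decidable_intros)
  from computable2_compose1[OF this[unfolded decidable_def] computable2_pair]
  obtain r where r: "\<And>n x. eval r [n, x] (of_bool (\<not> (R (pair n x) \<or> R' (pair n x))))"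
    unfolding computable2_def by blast
  from computable2_compose1[OF R(1)[unfolded decidable_def] computable2_pair]
  obtain s where s: "\<And>n x. eval s [n, x] (of_bool (R (pair n x)))"
    unfolding computable2_def by blast
  \<comment> \<open>\<open>Mu r\<close> finds the least number that witnesses either predicate, and
    \<open>s\<close> then tells whether it witnesses \<open>P\<close>.\<close>
  have "eval (Comp s [Mu r, Proj 0]) [code x] (if x \<in> Y then 1 else 0)" if x: "x \<in> I" for x
  proof -
    let ?S = "\<lambda>n. R (pair n (code x)) \<or> R' (pair n (code x))"
    define n where "n = (LEAST n. ?S n)"
    from assms(3)[OF x] have "\<exists>n. ?S n" using R(2) R'(2) by blast
    then have n: "?S n" unfolding n_def by (rule LeastI_ex)
    have min: "\<not> ?S m" if "m < n" for m using that unfolding n_def by (rule not_less_Least)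
    have "eval (Mu r) [code x] n"
    proof (rule eval_Mu)
      show "eval r [n, code x] 0" using r[of n "code x"] n by simp
      show "\<exists>y. eval r [m, code x] (Suc y)" if "m < n" for m
        using r[of m "code x"] min[OF that] by auto
    qed
    moreover have "R (pair n (code x)) \<longleftrightarrow> x \<in> Y"
      using n assms(4,5)[OF x] R(2) R'(2) by blast
    ultimately show ?thesis
      using eval_Comp2[OF _ eval_Proj0 s[of n "code x"], of "Mu r" "[]"] by (simp add: of_bool_def)
  qed
  then show ?thesis unfolding decidable_problem_def by blast
qed

section \<open>Quantifiers over coded finite sets\<close>

lemma mem_set_decode_less: "i \<in> set_decode n \<Longrightarrow> i < n"
proof -
  assume "i \<in> set_decode n"
  then have "n div 2 ^ i \<noteq> 0" by (metis even_zero mem_Collect_eq set_decode_def)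
  then have "2 ^ i \<le> n" by (simp add: div_eq_0_iff)
  with less_exp[of i] show ?thesis by (rule less_le_trans)
qed

lemma decidable_ball_set_decode [decidable_intros]:
  "decidable (\<lambda>p. P (pfst p) (psnd p)) \<Longrightarrow> computable f \<Longrightarrow> decidable (\<lambda>x. \<forall>i\<in>set_decode (f x). P i x)"
proof -
  assume *: "decidable (\<lambda>p. P (pfst p) (psnd p))" "computable f"
  have "decidable (\<lambda>x. \<forall>i<f x. i \<in> set_decode (f x) \<longrightarrow> P i x)"
    by (intro decidable_intros computable_intros * computable_compose1[OF *(2)])
  moreover have "(\<forall>i<f x. i \<in> set_decode (f x) \<longrightarrow> P i x) \<longleftrightarrow> (\<forall>i\<in>set_decode (f x). P i x)" for x
    using mem_set_decode_less by blast
  ultimately show ?thesis by simp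
qed

lemma decidable_bex_set_decode [decidable_intros]:
  "decidable (\<lambda>p. P (pfst p) (psnd p)) \<Longrightarrow> computable f \<Longrightarrow> decidable (\<lambda>x. \<exists>i\<in>set_decode (f x). P i x)"
  using decidable_not[OF decidable_ball_set_decode[OF decidable_not]] by simp

lemma semidecidable_ball_set_decode [semidecidable_intros]:
  "semidecidable (\<lambda>p. P (pfst p) (psnd p)) \<Longrightarrow> computable f \<Longrightarrow> semidecidable (\<lambda>x. \<forall>i\<in>set_decode (f
      x). P i x)"
proof -
  assume *: "semidecidable (\<lambda>p. P (pfst p) (psnd p))" "computable f"
  have "semidecidable (\<lambda>x. \<forall>i<f x. i \<in> set_decode (f x) \<longrightarrow> P i x)"
    by (intro semidecidable_intros decidable_intros computable_intros * computable_compose1[OF *(2)])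
  moreover have "(\<forall>i<f x. i \<in> set_decode (f x) \<longrightarrow> P i x) \<longleftrightarrow> (\<forall>i\<in>set_decode (f x). P i x)" for x
    using mem_set_decode_less by blast
  ultimately show ?thesis by simp
qed

lemma semidecidable_bex_set_decode [semidecidable_intros]:
  "semidecidable (\<lambda>p. P (pfst p) (psnd p)) \<Longrightarrow> computable f \<Longrightarrow> semidecidable (\<lambda>x. \<exists>i\<in>set_decode (f
      x). P i x)"
  unfolding Bex_def
  by (intro semidecidable_intros semidecidable_of_decidable[OF decidable_mem_set_decode]
      computable_intros) (auto intro: computable_compose1 computable_psnd)

text \<open>A code is the sum of the powers of two given by the elements, so subsets have no larger
  codes and the quantifier over them is bounded.\<close>

lemma semidecidable_all_subsets [semidecidable_intros]:
  assumes "semidecidable (\<lambda>p. P (set_decode (pfst p)) (psnd p))" "computable f"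
  shows "semidecidable (\<lambda>x. \<forall>C\<subseteq>set_decode (f x). P C x)"
proof -
  have "semidecidable (\<lambda>x. \<forall>c<Suc (f x). (\<forall>i\<in>set_decode c. i \<in> set_decode (f x)) \<longrightarrow> P (set_decode c) x)"
    by (intro semidecidable_intros decidable_intros computable_intros assms computable_compose1[OF
        assms(2)])
  moreover have "(\<forall>c<Suc (f x). (\<forall>i\<in>set_decode c. i \<in> set_decode (f x)) \<longrightarrow> P (set_decode c) x) \<longleftrightarrow>
    (\<forall>C\<subseteq>set_decode (f x). P C x)" (is "?l \<longleftrightarrow> ?r") for x
  proof
    assume l: ?l
    show ?r
    proof (intro allI impI)
      fix C assume C: "C \<subseteq> set_decode (f x)"
      then have fin: "finite C" by (rule finite_subset) simp
      have "set_encode C \<le> set_encode (set_decode (f x))"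
        unfolding set_encode_def using C by (intro sum_mono2) auto
      then have "set_encode C < Suc (f x)" by simp
      moreover have "set_decode (set_encode C) = C" using fin by simp
      ultimately show "P C x" using l C by (metis subsetD)
    qed
  next
    assume ?r
    then show ?l by (simp add: subset_iff)
  qed
  ultimately show ?thesis by simp
qed

lemma decidable_set_decode_empty [decidable_intros]: "computable f \<Longrightarrow> decidable (\<lambda>x. set_decode (f
    x) = {})"
proof -
  assume "computable f"
  then have "decidable (\<lambda>x. f x = 0)" by (intro decidable_intros computable_intros)
  moreover have "set_decode n = {} \<longleftrightarrow> n = 0" for n
    by (metis set_decode_inverse set_decode_zero set_encode_empty)
  ultimately show ?thesis by simp
qed

section \<open>Dickson's lemma and Farkas' lemma\<close>

text \<open>Every tail attains its minimum, so the indices whose value bounds all later values from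
  below are unbounded; enumerating them gives the subsequence.\<close>

lemma nat_seq_nondecreasing_subseq:
  fixes g :: "nat \<Rightarrow> nat"
  shows "\<exists>r :: nat \<Rightarrow> nat. strict_mono r \<and> (\<forall>i j. i \<le> j \<longrightarrow> g (r i) \<le> g (r j))"
proof -
  define P where "P = {i. \<forall>k\<ge>i. g i \<le> g k}"
  have "\<exists>i\<ge>n. i \<in> P" for n
  proof -
    define m where "m = (LEAST m. \<exists>k\<ge>n. g k = m)"
    have "\<exists>m. \<exists>k\<ge>n. g k = m" by blast
    then have "\<exists>k\<ge>n. g k = m" unfolding m_def by (rule LeastI_ex)
    then obtain k where k: "k \<ge> n" "g k = m" by blast
    have "m \<le> g l" if "l \<ge> n" for l unfolding m_def by (rule Least_le) (use that in blast)
    then show ?thesis using k unfolding P_def by (intro exI[of _ k]) auto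
  qed
  then have inf: "infinite P" unfolding infinite_nat_iff_unbounded_le by blast
  have "g (enumerate P i) \<le> g (enumerate P j)" if "i \<le> j" for i j
    using enumerate_in_set[OF inf, of i] that strict_mono_enumerate[OF inf]
    unfolding P_def by (auto simp: strict_mono_less_eq)
  then show ?thesis using strict_mono_enumerate[OF inf] by blast
qed

lemma dickson_subseq:
  fixes f :: "nat \<Rightarrow> nat \<Rightarrow> nat" and s :: "nat \<Rightarrow> 'a"
  assumes "finite (range s)"
  shows "\<exists>r :: nat \<Rightarrow> nat. strict_mono r \<and> (\<forall>i j. s (r i) = s (r j)) \<and>
    (\<forall>l<d. \<forall>i j. i \<le> j \<longrightarrow> f (r i) l \<le> f (r j) l)"
proof (induction d)
  case 0
  obtain a where "infinite {i \<in> UNIV. s i = s a}"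
    using pigeonhole_infinite[OF infinite_UNIV_nat assms] by blast
  then have inf: "infinite {i. s i = s a}" by simp
  have "s (enumerate {i. s i = s a} i) = s a" for i
    using enumerate_in_set[OF inf, of i] by simp
  then show ?case using strict_mono_enumerate[OF inf]
    by (intro exI[of _ "enumerate {i. s i = s a}"]) simp
next
  case (Suc d)
  then obtain r :: "nat \<Rightarrow> nat" where r: "strict_mono r" "\<And>i j. s (r i) = s (r j)"
    "\<And>l i j. l < d \<Longrightarrow> i \<le> j \<Longrightarrow> f (r i) l \<le> f (r j) l" by blast
  obtain r' :: "nat \<Rightarrow> nat" where r': "strict_mono r'" "\<And>i j. i \<le> j \<Longrightarrow> f (r (r' i)) d \<le> f (r (r' j)) d"
    using nat_seq_nondecreasing_subseq[of "\<lambda>i. f (r i) d"] by blast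
  have "strict_mono (r \<circ> r')" using r(1) r'(1) by (rule strict_mono_o)
  moreover have "\<forall>l<Suc d. \<forall>i j. i \<le> j \<longrightarrow> f ((r \<circ> r') i) l \<le> f ((r \<circ> r') j) l"
    using r(3) r' by (auto simp: less_Suc_eq strict_mono_less_eq)
  ultimately show ?case using r(2) by (intro exI[of _ "r \<circ> r'"] conjI) (simp_all add: o_def)
qed

lemma dickson:
  fixes f :: "nat \<Rightarrow> nat \<Rightarrow> nat" and s :: "nat \<Rightarrow> 'a"
  assumes "finite (range s)"
  obtains i j where "i < j" "s i = s j" "\<forall>l<d. f i l \<le> f j l"
proof -
  obtain r :: "nat \<Rightarrow> nat" where "strict_mono r" "\<forall>i j. s (r i) = s (r j)"
    "\<forall>l<d. \<forall>i j. i \<le> j \<longrightarrow> f (r i) l \<le> f (r j) l"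
    using dickson_subseq[OF assms, where f = f and d = d] by blast
  then show ?thesis using that[of "r 0" "r 1"] by (auto simp: strict_mono_less)
qed

text \<open>If no finite subset were enough, adding an uncovered element again and again would give
  a sequence in which no entry dominates an earlier one with the same first component, against
  \<open>dickson\<close>.\<close>

lemma finite_basis:
  fixes A :: "('a \<times> (nat \<Rightarrow> nat)) set"
  assumes "finite (fst ` A)"
  shows "\<exists>B\<subseteq>A. finite B \<and> (\<forall>q v. (q, v) \<in> A \<longrightarrow> (\<exists>w. (q, w) \<in> B \<and> (\<forall>l<d. w l \<le> v l)))"
proof (rule ccontr)
  assume no: "\<not> ?thesis"
  define bad where "bad B x \<longleftrightarrow> x \<in> A \<and> (\<forall>w. (fst x, w) \<in> B \<longrightarrow> \<not> (\<forall>l<d. w l \<le> snd x l))" for B x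
  have ex: "\<exists>x. bad B x" if "B \<subseteq> A" "finite B" for B
    using no that unfolding bad_def by fastforce
  define g where "g B = (SOME x. bad B x)" for B
  define S where "S = rec_nat {} (\<lambda>_ B. insert (g B) B)"
  have S: "S 0 = {}" "\<And>n. S (Suc n) = insert (g (S n)) (S n)" by (simp_all add: S_def)
  have g: "bad B (g B)" if "B \<subseteq> A" "finite B" for B
    using ex[OF that] unfolding g_def by (rule someI_ex)
  have inv: "S n \<subseteq> A \<and> finite (S n)" for n
    by (induction n) (use g in \<open>auto simp: S bad_def\<close>)
  have mem: "g (S i) \<in> S j" if "i < j" for i j
    using that by (induction j) (auto simp: S less_Suc_eq)
  have gA: "g (S n) \<in> A" for n using g inv[of n] by (auto simp: bad_def)
  then have "range (\<lambda>n. fst (g (S n))) \<subseteq> fst ` A" by auto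
  then have "finite (range (\<lambda>n. fst (g (S n))))" using assms finite_subset by blast
  from dickson[OF this, where f = "\<lambda>n. snd (g (S n))" and d = d] obtain i j where
    "i < j" "fst (g (S i)) = fst (g (S j))" "\<forall>l<d. snd (g (S i)) l \<le> snd (g (S j)) l" .
  then show False using g[of "S j"] inv[of j] mem[of i j] unfolding bad_def
    by (metis prod.collapse)
qed

text \<open>This is Bartl's algebraic proof: if \<open>x0\<close> violates the conclusion without the constraint
  \<open>e\<close>, project along \<open>x0\<close> onto the hyperplane \<open>a e = 0\<close>.\<close>

lemma farkas:
  fixes a :: "'e \<Rightarrow> 'i \<Rightarrow> 'k::linordered_field"
  assumes "finite A" "finite I"
    and "\<And>x. (\<forall>e\<in>A. (\<Sum>i\<in>I. x i * a e i) \<le> 0) \<Longrightarrow> (\<Sum>i\<in>I. x i * b i) \<le> 0"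
  shows "\<exists>l. (\<forall>e\<in>A. l e \<ge> 0) \<and> (\<forall>i\<in>I. b i = (\<Sum>e\<in>A. l e * a e i))"
  using assms(1,3)
proof (induction A arbitrary: a b rule: finite_induct)
  case empty
  have "b i = 0" if "i \<in> I" for i
  proof -
    have "(\<Sum>k\<in>I. (if k = i then b i else 0) * b k) = (\<Sum>k\<in>I. if k = i then b i * b i else 0)"
      by (rule sum.cong) auto
    also have "\<dots> = b i * b i" using assms(2) that by simp
    finally have "b i * b i \<le> 0" using empty(1)[of "\<lambda>k. if k = i then b i else 0"] by simp
    with zero_le_square[of "b i"] have "b i * b i = 0" by (rule antisym[rotated])
    then show ?thesis by simp
  qed
  then show ?case by auto
next
  case (insert e A)
  define dot where "dot x c = (\<Sum>i\<in>I. x i * c i)" for x c :: "'i \<Rightarrow> 'k"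
  have dot_lin: "dot (\<lambda>i. x i + k * y i) c = dot x c + k * dot y c" for x y c k
    by (simp add: dot_def sum.distrib sum_distrib_left algebra_simps)
  have dot_lin': "dot x (\<lambda>i. c i - k * c' i) = dot x c - k * dot x c'" for x c c' k
    by (simp add: dot_def sum_subtractf sum_distrib_left algebra_simps)
  show ?case
  proof (cases "\<forall>x. (\<forall>e\<in>A. dot x (a e) \<le> 0) \<longrightarrow> dot x b \<le> 0")
    case True
    then obtain l where l: "\<forall>e\<in>A. l e \<ge> 0" "\<forall>i\<in>I. b i = (\<Sum>e\<in>A. l e * a e i)"
      using insert.IH[of a b] unfolding dot_def by blast
    have "(\<Sum>k\<in>A. (l(e := 0)) k * a k i) = (\<Sum>k\<in>A. l k * a k i)" for i
      using insert.hyps by (intro sum.cong) auto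
    with l insert.hyps show ?thesis by (intro exI[of _ "l(e := 0)"]) auto
  next
    case False
    then obtain x1 where x1: "\<forall>k\<in>A. dot x1 (a k) \<le> 0" "dot x1 b > 0" by force
    then have pos: "dot x1 (a e) > 0"
      using insert.prems[of x1] by (force simp: dot_def)
    define x0 where "x0 i = x1 i / dot x1 (a e)" for i
    have x0: "dot x0 c = dot x1 c / dot x1 (a e)" for c
      by (simp add: x0_def dot_def sum_divide_distrib)
    have x0e: "dot x0 (a e) = 1" using pos by (simp add: x0)
    have x0A: "\<forall>k\<in>A. dot x0 (a k) \<le> 0" and x0b: "dot x0 b > 0"
      using x1 pos by (auto simp: x0 divide_nonpos_pos)
    define a' where "a' k i = a k i - dot x0 (a k) * a e i" for k i
    define b' where "b' i = b i - dot x0 b * a e i" for i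
    have "dot x b' \<le> 0" if x: "\<forall>k\<in>A. dot x (a' k) \<le> 0" for x
    proof -
      \<comment> \<open>The projection of \<open>x\<close> along \<open>x0\<close>: it annihilates
        \<open>a e\<close> since \<open>dot x0 (a e) = 1\<close>, and \<open>a k\<close> takes on it
        the value of \<open>a' k\<close> at \<open>x\<close>.\<close>
      let ?x = "\<lambda>i. x i + (- dot x (a e)) * x0 i"
      have "\<forall>k\<in>insert e A. dot ?x (a k) \<le> 0"
        using x unfolding a'_def dot_lin dot_lin' by (simp add: x0e) (simp add: mult.commute)
      then have "dot ?x b \<le> 0" using insert.prems[of ?x] unfolding dot_def by blast
      then show ?thesis unfolding b'_def[abs_def] dot_lin' dot_lin by (simp add: mult.commute)
    qed
    then obtain l where l: "\<forall>k\<in>A. l k \<ge> 0" "\<forall>i\<in>I. b' i = (\<Sum>k\<in>A. l k * a' k i)"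
      using insert.IH[of a' b'] unfolding dot_def by blast
    \<comment> \<open>The multiplier of \<open>e\<close> collects the multiples of
      \<open>a e\<close> hidden in \<open>a'\<close> and \<open>b'\<close>; it is nonnegative since
      \<open>x0\<close> is positive on \<open>b\<close> and nonpositive on \<open>A\<close>.\<close>
    define l' where "l' = l(e := dot x0 b - (\<Sum>k\<in>A. l k * dot x0 (a k)))"
    have "(\<Sum>k\<in>A. l k * dot x0 (a k)) \<le> 0"
      using l(1) x0A by (intro sum_nonpos) (auto simp: mult_nonneg_nonpos)
    then have "\<forall>k\<in>insert e A. l' k \<ge> 0" using l(1) x0b by (auto simp: l'_def)
    moreover have "b i = (\<Sum>k\<in>insert e A. l' k * a k i)" if "i \<in> I" for i
    proof -
      have "(\<Sum>k\<in>A. l' k * a k i) = (\<Sum>k\<in>A. l k * a k i)"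
        using insert.hyps by (intro sum.cong) (auto simp: l'_def)
      moreover have "b i = dot x0 b * a e i + (\<Sum>k\<in>A. l k * a k i) -
        (\<Sum>k\<in>A. l k * dot x0 (a k)) * a e i"
        using l(2) that unfolding b'_def a'_def
        by (simp add: right_diff_distrib sum_subtractf) (simp add: sum_distrib_left algebra_simps)
      ultimately show ?thesis using insert.hyps by (simp add: l'_def algebra_simps)
    qed
    ultimately show ?thesis by blast
  qed
qed

lemma clear_denominators:
  fixes y :: "'i \<Rightarrow> rat"
  assumes "finite I" "\<And>i. i \<in> I \<Longrightarrow> y i \<ge> 0"
  obtains N :: nat and m :: "'i \<Rightarrow> nat" where "N > 0" "\<forall>i\<in>I. of_nat (m i) = of_nat N * y i"
proof -
  have "\<exists>N::nat. N > 0 \<and> (\<exists>m::'i \<Rightarrow> nat. \<forall>i\<in>I. of_nat (m i) = of_nat N * y i)"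
    using assms
  proof (induction I rule: finite_induct)
    case empty
    then show ?case by (intro exI[of _ 1]) simp
  next
    case (insert k I)
    then obtain N :: nat and m :: "'i \<Rightarrow> nat" where N: "N > 0"
      and m: "\<forall>i\<in>I. of_nat (m i) = of_nat N * y i" by auto
    obtain a b where q: "quotient_of (y k) = (a, b)" by fastforce
    then have b: "b > 0" "y k = of_int a / of_int b"
      by (simp_all add: quotient_of_denom_pos quotient_of_div)
    moreover have "y k \<ge> 0" using insert.prems by simp
    ultimately have a: "a \<ge> 0" by (simp add: zero_le_divide_iff)
    define m' where "m' i = (if i = k then N * nat a else nat b * m i)" for i
    have "of_nat (m' i) = of_nat (N * nat b) * y i" if "i \<in> insert k I" for i
      using that m a b by (auto simp: m'_def)
    moreover have "N * nat b > 0" using N b(1) by simp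
    ultimately show ?case by blast
  qed
  then show ?thesis using that by blast
qed

text \<open>The sign conditions on \<open>y\<close> enter as further rows, the negative unit
  vectors, and their multipliers become the slack between \<open>b\<close> and the
  combination.\<close>

lemma farkas_nonneg:
  fixes a :: "'e \<Rightarrow> 'i \<Rightarrow> 'k::linordered_field"
  assumes A: "finite A" and I: "finite I"
    and "\<And>y. (\<forall>i\<in>I. y i \<ge> 0) \<Longrightarrow> (\<forall>e\<in>A. (\<Sum>i\<in>I. y i * a e i) \<le> 0) \<Longrightarrow> (\<Sum>i\<in>I. y i * b i) \<le> 0"
  shows "\<exists>l. (\<forall>e\<in>A. l e \<ge> 0) \<and> (\<forall>i\<in>I. b i \<le> (\<Sum>e\<in>A. l e * a e i))"
proof -
  define c where "c = case_sum a (\<lambda>j i. if i = j then - 1 else (0::'k))"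
  have unit: "(\<Sum>i\<in>I. x i * c (Inr j) i) = - x j" if "j \<in> I" for x j
  proof -
    have "(\<Sum>i\<in>I. x i * c (Inr j) i) = (\<Sum>i\<in>I. if i = j then - x j else 0)"
      by (rule sum.cong) (auto simp: c_def)
    then show ?thesis using that I by simp
  qed
  have "\<exists>l. (\<forall>e\<in>A <+> I. l e \<ge> 0) \<and> (\<forall>i\<in>I. b i = (\<Sum>e\<in>A <+> I. l e * c e i))"
  proof (rule farkas)
    fix x assume x: "\<forall>e\<in>A <+> I. (\<Sum>i\<in>I. x i * c e i) \<le> 0"
    have "x j \<ge> 0" if "j \<in> I" for j
      using x[rule_format, of "Inr j"] unit[OF that, of x] that by (simp add: InrI)
    moreover have "(\<Sum>i\<in>I. x i * a e i) \<le> 0" if "e \<in> A" for e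
      using x[rule_format, of "Inl e"] that by (simp add: c_def InlI)
    ultimately show "(\<Sum>i\<in>I. x i * b i) \<le> 0" by (intro assms(3)) auto
  qed (use A I in auto)
  then obtain l where l: "\<forall>e\<in>A <+> I. l e \<ge> 0" "\<forall>i\<in>I. b i = (\<Sum>e\<in>A <+> I. l e * c e i)" by blast
  have "b i \<le> (\<Sum>e\<in>A. l (Inl e) * a e i)" if i: "i \<in> I" for i
  proof -
    have "(\<Sum>j\<in>I. l (Inr j) * c (Inr j) i) = (\<Sum>j\<in>I. if i = j then - l (Inr i) else 0)"
      by (rule sum.cong) (auto simp: c_def)
    also have "\<dots> = - l (Inr i)" using i I by simp
    finally have "b i = (\<Sum>e\<in>A. l (Inl e) * a e i) - l (Inr i)"
      using l(2) i A I by (simp add: sum.Plus) (simp add: c_def)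
    then show ?thesis using l(1) i by (simp add: InrI)
  qed
  then show ?thesis using l(1) by (intro exI[of _ "\<lambda>e. l (Inl e)"]) auto
qed

text \<open>If the first alternative fails, \<open>farkas_nonneg\<close> gives for each row
  \<open>e0\<close> a nonnegative combination above \<open>- a e0\<close>. Adding row
  \<open>e0\<close> itself and summing over all \<open>e0\<close> yields multipliers that are all at
  least 1. The argument runs over the rationals so that denominators can be cleared.\<close>

lemma tucker:
  fixes a :: "'e \<Rightarrow> 'i \<Rightarrow> int"
  assumes A: "finite A" and I: "finite I"
  shows "(\<exists>y::'i \<Rightarrow> nat. (\<forall>e\<in>A. (\<Sum>i\<in>I. int (y i) * a e i) \<le> 0) \<and>
      (\<exists>e\<in>A. (\<Sum>i\<in>I. int (y i) * a e i) < 0)) \<or>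
    (\<exists>l::'e \<Rightarrow> nat. (\<forall>e\<in>A. l e \<ge> 1) \<and> (\<forall>i\<in>I. (\<Sum>e\<in>A. int (l e) * a e i) \<ge> 0))"
proof (rule disjCI)
  assume *: "\<not> (\<exists>l::'e \<Rightarrow> nat. (\<forall>e\<in>A. l e \<ge> 1) \<and> (\<forall>i\<in>I. (\<Sum>e\<in>A. int (l e) * a e i) \<ge> 0))"
  let ?a = "\<lambda>e i. rat_of_int (a e i)"
  show "\<exists>y::'i \<Rightarrow> nat. (\<forall>e\<in>A. (\<Sum>i\<in>I. int (y i) * a e i) \<le> 0) \<and>
      (\<exists>e\<in>A. (\<Sum>i\<in>I. int (y i) * a e i) < 0)"
  proof (rule ccontr)
    assume no: "\<not> ?thesis"
    have ge: "(\<Sum>i\<in>I. y i * (- ?a e0 i)) \<le> 0"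
      if y: "\<forall>i\<in>I. y i \<ge> 0" "\<forall>e\<in>A. (\<Sum>i\<in>I. y i * ?a e i) \<le> 0" and e0: "e0 \<in> A" for y e0
    proof -
      obtain N m where N: "N > 0" and m: "\<And>i. i \<in> I \<Longrightarrow> of_nat (m i) = of_nat N * y i"
        using clear_denominators[OF I, of y] y(1) by metis
      have sum: "of_int (\<Sum>i\<in>I. int (m i) * a e i) = of_nat N * (\<Sum>i\<in>I. y i * ?a e i)" for e
        using m by (simp add: sum_distrib_left mult.assoc)
      have "\<forall>e\<in>A. (\<Sum>i\<in>I. int (m i) * a e i) \<le> 0"
      proof
        fix e assume "e \<in> A"
        then have "of_int (\<Sum>i\<in>I. int (m i) * a e i) \<le> (0::rat)"
          unfolding sum using y(2) by (simp add: mult_nonneg_nonpos)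
        then show "(\<Sum>i\<in>I. int (m i) * a e i) \<le> 0" by linarith
      qed
      then have "\<not> (\<Sum>i\<in>I. int (m i) * a e0 i) < 0" using no e0 by blast
      then have "(0::rat) \<le> of_int (\<Sum>i\<in>I. int (m i) * a e0 i)" by linarith
      then have "0 \<le> (\<Sum>i\<in>I. y i * ?a e0 i)"
        unfolding sum using N by (simp add: zero_le_mult_iff)
      then show ?thesis by (simp add: sum_negf)
    qed
    have "\<exists>l. (\<forall>e\<in>A. l e \<ge> 0) \<and> (\<forall>i\<in>I. - ?a e0 i \<le> (\<Sum>e\<in>A. l e * ?a e i))" if "e0 \<in> A" for e0
      by (rule farkas_nonneg[OF A I]) (rule ge[OF _ _ that])
    then obtain l where l: "\<And>e0 e. e0 \<in> A \<Longrightarrow> e \<in> A \<Longrightarrow> l e0 e \<ge> 0"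
      "\<And>e0 i. e0 \<in> A \<Longrightarrow> i \<in> I \<Longrightarrow> - ?a e0 i \<le> (\<Sum>e\<in>A. l e0 e * ?a e i)" by metis
    define L where "L e = 1 + (\<Sum>e0\<in>A. l e0 e)" for e
    have L1: "L e \<ge> 1" if "e \<in> A" for e using l(1) that by (simp add: L_def sum_nonneg)
    have L2: "(\<Sum>e\<in>A. L e * ?a e i) \<ge> 0" if "i \<in> I" for i
    proof -
      have "(\<Sum>e\<in>A. L e * ?a e i) = (\<Sum>e\<in>A. ?a e i) + (\<Sum>e\<in>A. \<Sum>e0\<in>A. l e0 e * ?a e i)"
        by (simp add: L_def distrib_right sum.distrib sum_distrib_right)
      also have "(\<Sum>e\<in>A. \<Sum>e0\<in>A. l e0 e * ?a e i) = (\<Sum>e0\<in>A. \<Sum>e\<in>A. l e0 e * ?a e i)"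
        by (rule sum.swap)
      finally have "(\<Sum>e\<in>A. L e * ?a e i) =
        (\<Sum>e\<in>A. ?a e i) + (\<Sum>e0\<in>A. \<Sum>e\<in>A. l e0 e * ?a e i)" .
      moreover have "(\<Sum>e0\<in>A. - ?a e0 i) \<le> (\<Sum>e0\<in>A. \<Sum>e\<in>A. l e0 e * ?a e i)"
        using l(2) that by (intro sum_mono) auto
      ultimately show ?thesis by (simp add: sum_negf)
    qed
    have L0: "L e \<ge> 0" if "e \<in> A" for e using L1[OF that] by simp
    obtain N m where N: "N > 0" and m: "\<And>e. e \<in> A \<Longrightarrow> of_nat (m e) = of_nat N * L e"
      using clear_denominators[OF A, of L, OF L0] by metis
    have "m e \<ge> 1" if "e \<in> A" for e
    proof -
      have "(0::rat) < of_nat (m e)" using N L1[OF that] unfolding m[OF that] by simp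
      then show ?thesis by simp
    qed
    moreover have "(\<Sum>e\<in>A. int (m e) * a e i) \<ge> 0" if "i \<in> I" for i
    proof -
      have "rat_of_int (\<Sum>e\<in>A. int (m e) * a e i) = of_nat N * (\<Sum>e\<in>A. L e * ?a e i)"
        using m by (simp add: sum_distrib_left mult.assoc)
      also have "\<dots> \<ge> 0" using L2[OF that] by simp
      finally show ?thesis by (simp only: of_int_0_le_iff)
    qed
    ultimately show False using * by blast
  qed
qed

section \<open>Cycles and energy games on finite graphs\<close>

fun path :: "('e \<Rightarrow> 'v) \<Rightarrow> ('e \<Rightarrow> 'v) \<Rightarrow> 'v \<Rightarrow> 'e list \<Rightarrow> 'v \<Rightarrow> bool" where
  "path s t u [] v \<longleftrightarrow> u = v"
| "path s t u (e # es) v \<longleftrightarrow> s e = u \<and> path s t (t e) es v"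

lemma path_append: "path s t u (es @ fs) v \<longleftrightarrow> (\<exists>w. path s t u es w \<and> path s t w fs v)"
  by (induction es arbitrary: u) auto

lemma path_degrees:
  "path s t u es v \<Longrightarrow>
    length (filter (\<lambda>e. t e = x) es) + of_bool (u = x) = length (filter (\<lambda>e. s e = x) es) +
        of_bool (v = x)"
  by (induction es arbitrary: u) force+

lemma sum_count_list:
  assumes "finite A" "set es \<subseteq> A"
  shows "(\<Sum>e\<in>A. int (count_list es e) * f e) = (\<Sum>e\<leftarrow>es. f e)"
  using assms(2)
proof (induction es)
  case (Cons e es)
  have "(\<Sum>k\<in>A. int (count_list (e # es) k) * f k) =
    (\<Sum>k\<in>A. int (count_list es k) * f k + (if e = k then f k else 0))"
    by (rule sum.cong) (auto simp: distrib_right)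
  then show ?case using Cons assms(1) by (simp add: sum.distrib)
qed simp

lemma length_filter_count_list:
  assumes "finite A" "set es \<subseteq> A"
  shows "length (filter P es) = (\<Sum>e | e \<in> A \<and> P e. count_list es e)"
  using assms(2)
proof (induction es)
  case (Cons e es)
  have "(\<Sum>k | k \<in> A \<and> P k. count_list (e # es) k) =
    (\<Sum>k | k \<in> A \<and> P k. count_list es k + (if e = k then 1 else 0))"
    by (rule sum.cong) auto
  then show ?case using Cons assms(1) by (simp add: sum.distrib)
qed simp

text \<open>A trail of maximal length is closed by balance, and exhausts all edges by connectivity.\<close>

lemma euler_circuit:
  fixes s t :: "'e \<Rightarrow> 'v" and l :: "'e \<Rightarrow> nat"
  assumes A: "finite A" "A \<noteq> {}" and l: "\<And>e. e \<in> A \<Longrightarrow> l e \<ge> 1"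
    and bal: "\<And>v. (\<Sum>e | e \<in> A \<and> s e = v. l e) = (\<Sum>e | e \<in> A \<and> t e = v. l e)"
    and con: "\<And>e e'. e \<in> A \<Longrightarrow> e' \<in> A \<Longrightarrow> (t e, s e') \<in> {(s e, t e) | e. e \<in> A}\<^sup>*"
  obtains u es where "path s t u es u" "es \<noteq> []" "set es \<subseteq> A" "\<And>e. e \<in> A \<Longrightarrow> count_list es e = l e"
proof -
  define P where "P es \<longleftrightarrow> set es \<subseteq> A \<and> (\<forall>e\<in>A. count_list es e \<le> l e) \<and> (\<exists>u v. path s t u es v)" for es
  have bound: "length es \<le> (\<Sum>e\<in>A. l e)" if "P es" for es
  proof -
    have "length es = (\<Sum>e\<in>A. count_list es e)"
      using length_filter_count_list[OF A(1), of es "\<lambda>_. True"] that by (simp add: P_def)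
    also have "\<dots> \<le> (\<Sum>e\<in>A. l e)" using that by (intro sum_mono) (simp add: P_def)
    finally show ?thesis .
  qed
  have "P []" by (simp add: P_def)
  then obtain es where es: "P es" and max: "\<And>es'. P es' \<Longrightarrow> length es' \<le> length es"
    using ex_has_greatest_nat[of P "[]" length "Suc (\<Sum>e\<in>A. l e)"] bound by (metis le_imp_less_Suc)
  then have sub: "set es \<subseteq> A" and le: "\<And>e. e \<in> A \<Longrightarrow> count_list es e \<le> l e"
    by (auto simp: P_def)
  obtain u v where uv: "path s t u es v" using es by (auto simp: P_def)
  \<comment> \<open>Stated for every list with the edge counts of \<open>es\<close>, so that it also
    applies to rotations of a closed trail.\<close>
  have ext: False if "set es' = set es" "\<And>e. count_list es' e = count_list es e" "length es' = length es"
    "path s t w es' (s e)" "e \<in> A" "count_list es e < l e" for es' w e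
  proof -
    have "path s t w (es' @ [e]) (t e)" using that(4) by (auto simp: path_append)
    then have "P (es' @ [e])" unfolding P_def
      using that sub le by (auto simp: Suc_le_eq)
    then show False using max[of "es' @ [e]"] that(3) by simp
  qed
  have "u = v"
  proof (rule ccontr)
    assume "u \<noteq> v"
    then have "(\<Sum>e | e \<in> A \<and> s e = v. count_list es e) < (\<Sum>e | e \<in> A \<and> t e = v. count_list es e)"
      using path_degrees[OF uv, of v] length_filter_count_list[OF A(1) sub] by simp
    also have "\<dots> \<le> (\<Sum>e | e \<in> A \<and> t e = v. l e)" using le by (intro sum_mono) auto
    also have "\<dots> = (\<Sum>e | e \<in> A \<and> s e = v. l e)" by (rule bal[symmetric])
    finally obtain e where "e \<in> A" "s e = v" "count_list es e < l e"
      by (metis (mono_tags, lifting) mem_Collect_eq not_le sum_mono)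
    then show False using ext[of es u e] uv by auto
  qed
  \<comment> \<open>A closed trail can be rotated so as to end at any vertex on it, and an edge
    leaving that vertex with copies left over would extend it.\<close>
  have full: "count_list es e = l e" if e: "e \<in> A" and es': "es = xs @ ys" "path s t u xs (s e)"
      for e xs ys
  proof (rule ccontr)
    assume "count_list es e \<noteq> l e"
    then have "count_list es e < l e" using le[OF e] by simp
    moreover obtain w where "path s t u xs w" "path s t w ys u"
      using uv \<open>u = v\<close> es'(1) by (auto simp: path_append)
    moreover have "w = s e"
      using \<open>path s t u xs w\<close> es'(2) by (induction xs arbitrary: u) auto
    ultimately show False using ext[of "ys @ xs" "s e" e] es' e by (auto simp: path_append)
  qed
  have ne: "es \<noteq> []"
  proof
    assume "es = []"
    obtain e where "e \<in> A" using A(2) by blast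
    then have "P [e]" using l[of e] by (auto simp: P_def)
    then show False using max[of "[e]"] \<open>es = []\<close> by simp
  qed
  define R where "R = {x. \<exists>xs ys. es = xs @ ys \<and> path s t u xs x}"
  have R: "t e \<in> R" if e: "e \<in> A" "s e \<in> R" for e
  proof -
    have "count_list es e = l e" using full e unfolding R_def by blast
    then have "e \<in> set es" using l[OF e(1)] by (metis count_notin not_one_le_zero)
    then obtain xs ys where xs: "es = xs @ e # ys" by (meson split_list)
    then have "path s t u (xs @ [e]) (t e)" using uv by (auto simp: path_append)
    moreover have "es = (xs @ [e]) @ ys" using xs by simp
    ultimately show ?thesis unfolding R_def by blast
  qed
  have Rs: "y \<in> R" if "(x, y) \<in> {(s e, t e) | e. e \<in> A}\<^sup>*" "x \<in> R" for x y
    using that by (induction rule: rtrancl_induct) (auto intro: R)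
  have "es = [] @ es \<and> path s t u [] u" by simp
  then have "u \<in> R" unfolding R_def by blast
  obtain f fs where f: "es = f # fs" using ne by (cases es) auto
  then have "f \<in> A" "s f \<in> R" using sub uv \<open>u \<in> R\<close> by auto
  then have "s e \<in> R" if "e \<in> A" for e using Rs[OF con[OF _ that]] R by blast
  then have "count_list es e = l e" if "e \<in> A" for e
    using full that unfolding R_def by blast
  then show ?thesis using that[of u es] uv \<open>u = v\<close> ne sub by blast
qed

definition nonneg_cycle ::
  "('e \<Rightarrow> 'v) \<Rightarrow> ('e \<Rightarrow> 'v) \<Rightarrow> ('e \<Rightarrow> nat \<Rightarrow> int) \<Rightarrow> nat \<Rightarrow> 'e set \<Rightarrow> bool" where
  "nonneg_cycle s t z d E \<longleftrightarrow> (\<exists>u es. es \<noteq> [] \<and> set es \<subseteq> E \<and> path s t u es u \<and>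
     (\<forall>j<d. (\<Sum>e\<leftarrow>es. z e j) \<ge> 0))"

lemma nonneg_cycle_mono: "nonneg_cycle s t z d E \<Longrightarrow> E \<subseteq> E' \<Longrightarrow> nonneg_cycle s t z d E'"
  unfolding nonneg_cycle_def by blast

text \<open>\<open>X\<close> is a set of positions, with their credits, from which the energy player never gets stuck; her
  opponent moves at the vertices satisfying \<open>own\<close>.\<close>

definition energy_closed ::
  "('v \<Rightarrow> bool) \<Rightarrow> ('e \<Rightarrow> 'v) \<Rightarrow> ('e \<Rightarrow> 'v) \<Rightarrow> ('e \<Rightarrow> nat \<Rightarrow> int) \<Rightarrow> nat \<Rightarrow> 'e set \<Rightarrow> ('v \<times> (nat \<Rightarrow> nat)) set \<Rightarrow> bool"
  where "energy_closed own s t z d E X \<longleftrightarrow> (\<forall>v n. (v, n) \<in> X \<longrightarrow>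
    (\<exists>e\<in>E. s e = v \<and> (\<exists>n'. (t e, n') \<in> X \<and> (\<forall>j<d. int (n' j) = int (n j) + z e j))) \<and>
    (own v \<longrightarrow> (\<forall>e\<in>E. s e = v \<longrightarrow> (\<exists>n'. (t e, n') \<in> X \<and> (\<forall>j<d. int (n' j) = int (n j) + z e j)))))"

lemma energy_closed_ex:
  "energy_closed own s t z d E X \<Longrightarrow> (v, n) \<in> X \<Longrightarrow>
    \<exists>e\<in>E. s e = v \<and> (\<exists>n'. (t e, n') \<in> X \<and> (\<forall>j<d. int (n' j) = int (n j) + z e j))"
  unfolding energy_closed_def by blast

lemma energy_closed_all:
  "energy_closed own s t z d E X \<Longrightarrow> (v, n) \<in> X \<Longrightarrow> own v \<Longrightarrow> e \<in> E \<Longrightarrow> s e = v \<Longrightarrow>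
    \<exists>n'. (t e, n') \<in> X \<and> (\<forall>j<d. int (n' j) = int (n j) + z e j)"
  unfolding energy_closed_def by blast

text \<open>By \<open>uniq\<close> the opponent has no choice, so the cycle can be repeated forever.
  The credit \<open>K\<close> pays for any loss within a round, and the nonnegative effect restores
  it at the end of the round.\<close>

lemma energy_closed_of_cycle:
  assumes uniq: "\<And>e e'. e \<in> E \<Longrightarrow> e' \<in> E \<Longrightarrow> own (s e) \<Longrightarrow> s e = s e' \<Longrightarrow> e = e'"
    and "nonneg_cycle s t z d E"
  shows "\<exists>X. X \<noteq> {} \<and> energy_closed own s t z d E X"
proof -
  obtain u es where es: "es \<noteq> []" "set es \<subseteq> E" "path s t u es u" "\<And>j. j < d \<Longrightarrow> (\<Sum>e\<leftarrow>es. z e j) \<ge> 0"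
    using assms(2) unfolding nonneg_cycle_def by blast
  define K where "K = (\<Sum>j<d. \<Sum>e\<leftarrow>es. \<bar>z e j\<bar>)"
  have K: "K + (\<Sum>e\<leftarrow>xs. z e j) \<ge> 0" if "es = xs @ ys" "j < d" for xs ys j
  proof -
    have abs: "(\<Sum>e\<leftarrow>zs. \<bar>z e j\<bar>) \<ge> 0" for zs j by (induction zs) auto
    have "- (\<Sum>e\<leftarrow>xs. z e j) \<le> (\<Sum>e\<leftarrow>xs. \<bar>z e j\<bar>)" by (induction xs) auto
    also have "\<dots> \<le> (\<Sum>e\<leftarrow>es. \<bar>z e j\<bar>)" using abs[where zs = ys and j = j] that by simp
    also have "\<dots> \<le> K" unfolding K_def using abs that(2) by (intro member_le_sum) auto
    finally show ?thesis by simp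
  qed
  define X where "X = {(v, n :: nat \<Rightarrow> nat). \<exists>xs e ys. es = xs @ e # ys \<and> s e = v \<and>
    (\<forall>j<d. int (n j) \<ge> K + (\<Sum>e\<leftarrow>xs. z e j))}"
  have step: "\<exists>n'. (t e, n') \<in> X \<and> (\<forall>j<d. int (n' j) = int (n j) + z e j)"
    if xs: "es = xs @ e # ys" "\<forall>j<d. int (n j) \<ge> K + (\<Sum>e\<leftarrow>xs. z e j)" for n xs e ys
  proof -
    define n' where "n' j = nat (int (n j) + z e j)" for j
    have ge: "int (n j) + z e j \<ge> K + (\<Sum>e\<leftarrow>xs @ [e]. z e j)" if "j < d" for j
      using xs(2) that by simp
    have n': "int (n' j) = int (n j) + z e j" if "j < d" for j
      using ge[OF that] K[of "xs @ [e]" ys j] xs(1) that by (simp add: n'_def)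
    have "(t e, n') \<in> X"
    proof (cases ys)
      case Nil
      then have "u = t e" using es(3) xs(1) by (auto simp: path_append)
      then obtain e' ys' where "es = [] @ e' # ys'" "s e' = t e" using es(1,3) by (cases es) auto
      moreover have "int (n' j) \<ge> K" if "j < d" for j
        using ge[OF that] n'[OF that] es(4)[OF that] xs(1) Nil by simp
      ultimately show ?thesis unfolding X_def by force
    next
      case (Cons e' ys')
      then have "s e' = t e" "es = (xs @ [e]) @ e' # ys'" using es(3) xs(1) by (auto simp: path_append)
      moreover have "\<forall>j<d. int (n' j) \<ge> K + (\<Sum>e\<leftarrow>xs @ [e]. z e j)" using ge n' by simp
      ultimately show ?thesis unfolding X_def by blast
    qed
    with n' show ?thesis by blast
  qed
  have "energy_closed own s t z d E X" unfolding energy_closed_def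
  proof (intro allI impI)
    fix v n assume "(v, n) \<in> X"
    then obtain xs e ys where xs: "es = xs @ e # ys" "s e = v"
      "\<forall>j<d. int (n j) \<ge> K + (\<Sum>e\<leftarrow>xs. z e j)" unfolding X_def by blast
    then have e: "e \<in> E" using es(2) by auto
    have "e' = e" if "own v" "e' \<in> E" "s e' = v" for e' using uniq[of e' e] that e xs(2) by simp
    with step[OF xs(1,3)] e xs(2)
    show "(\<exists>e\<in>E. s e = v \<and> (\<exists>n'. (t e, n') \<in> X \<and> (\<forall>j<d. int (n' j) = int (n j) + z e j))) \<and>
      (own v \<longrightarrow> (\<forall>e\<in>E. s e = v \<longrightarrow> (\<exists>n'. (t e, n') \<in> X \<and> (\<forall>j<d. int (n' j) = int (n j) + z e j))))"
      by blast
  qed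
  moreover have "X \<noteq> {}"
  proof -
    obtain e ys where e: "es = e # ys" using es(1) by (cases es) auto
    have "K \<ge> 0" unfolding K_def by (intro sum_nonneg sum_list_nonneg) auto
    then have "(s e, \<lambda>_. nat K) \<in> X" unfolding X_def using e by (auto intro!: exI[of _ "[]"])
    then show ?thesis by blast
  qed
  ultimately show ?thesis by blast
qed

text \<open>Memoryless strategies suffice against an energy player with unknown initial credit: if the
  energy player survives both without \<open>e1\<close> and without \<open>e2\<close>, then she survives with the sum of
  the two credits by playing the two subgames in turns.\<close>

lemma energy_merge:
  assumes X1: "energy_closed own s t z d (E - {e1}) X1" and X2: "energy_closed own s t z d (E - {e2}) X2"
    and e12: "e1 \<noteq> e2" "s e1 = p" "s e2 = p" and p: "(p, n1) \<in> X1" "(p, n2) \<in> X2"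
  shows "\<exists>X. X \<noteq> {} \<and> energy_closed own s t z d E X"
proof -
  \<comment> \<open>Each counter is split into a share per subgame. While one subgame is played, the
    other waits at \<open>p\<close> and keeps its share.\<close>
  define X where "X = {(v, \<lambda>j. x j + y j) | v x y. (v, x) \<in> X1 \<and> (p, y) \<in> X2} \<union>
    {(v, \<lambda>j. x j + y j) | v x y. (p, x) \<in> X1 \<and> (v, y) \<in> X2}"
  let ?ok = "\<lambda>X e n. \<exists>n'. (t e, n') \<in> X \<and> (\<forall>j<d. int (n' j) = int (n j) + z e j)"
  have ok1: "?ok X e (\<lambda>j. x j + y j)" if "?ok X1 e x" "(p, y) \<in> X2" for e x y
  proof -
    from that(1) obtain x' where x': "(t e, x') \<in> X1" "\<forall>j<d. int (x' j) = int (x j) + z e j" by blast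
    then have "(t e, \<lambda>j. x' j + y j) \<in> X" using that(2) unfolding X_def by blast
    with x'(2) show ?thesis by (intro exI[of _ "\<lambda>j. x' j + y j"]) simp
  qed
  have ok2: "?ok X e (\<lambda>j. x j + y j)" if "?ok X2 e y" "(p, x) \<in> X1" for e x y
  proof -
    from that(1) obtain y' where y': "(t e, y') \<in> X2" "\<forall>j<d. int (y' j) = int (y j) + z e j" by blast
    then have "(t e, \<lambda>j. x j + y' j) \<in> X" using that(2) unfolding X_def by blast
    with y'(2) show ?thesis by (intro exI[of _ "\<lambda>j. x j + y' j"]) simp
  qed
  have cond1: "(\<exists>e\<in>E. s e = v \<and> ?ok X e (\<lambda>j. x j + y j)) \<and>
      (own v \<longrightarrow> (\<forall>e\<in>E. s e = v \<longrightarrow> ?ok X e (\<lambda>j. x j + y j)))"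
    if v: "(v, x) \<in> X1" and p: "(p, y) \<in> X2" for v x y
  proof (intro conjI impI ballI)
    obtain e where "e \<in> E - {e1}" "s e = v" "?ok X1 e x"
      using energy_closed_ex[OF X1 v] by blast
    then show "\<exists>e\<in>E. s e = v \<and> ?ok X e (\<lambda>j. x j + y j)" using ok1[OF _ p] by blast
  next
    fix e assume e: "own v" "e \<in> E" "s e = v"
    show "?ok X e (\<lambda>j. x j + y j)"
    proof (cases "e = e1")
      case False
      then have "?ok X1 e x" using energy_closed_all[OF X1 v e(1) _ e(3)] e(2) by blast
      then show ?thesis using p by (rule ok1)
    next
      case True
      \<comment> \<open>The opponent takes the edge missing from the current subgame; the other
        subgame waits at the same vertex and contains this edge, so play switches to it.\<close>
      then have "?ok X2 e y" using energy_closed_all[OF X2 p, of e] e e12 by simp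
      moreover have "(p, x) \<in> X1" using v True e(3) e12(2) by simp
      ultimately show ?thesis by (rule ok2)
    qed
  qed
  have cond2: "(\<exists>e\<in>E. s e = v \<and> ?ok X e (\<lambda>j. x j + y j)) \<and>
      (own v \<longrightarrow> (\<forall>e\<in>E. s e = v \<longrightarrow> ?ok X e (\<lambda>j. x j + y j)))"
    if p: "(p, x) \<in> X1" and v: "(v, y) \<in> X2" for v x y
  proof (intro conjI impI ballI)
    obtain e where "e \<in> E - {e2}" "s e = v" "?ok X2 e y"
      using energy_closed_ex[OF X2 v] by blast
    then show "\<exists>e\<in>E. s e = v \<and> ?ok X e (\<lambda>j. x j + y j)" using ok2[OF _ p] by blast
  next
    fix e assume e: "own v" "e \<in> E" "s e = v"
    show "?ok X e (\<lambda>j. x j + y j)"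
    proof (cases "e = e2")
      case False
      then have "?ok X2 e y" using energy_closed_all[OF X2 v e(1) _ e(3)] e(2) by blast
      then show ?thesis using p by (rule ok2)
    next
      case True
      then have "?ok X1 e x" using energy_closed_all[OF X1 p, of e] e e12 by simp
      moreover have "(p, y) \<in> X2" using v True e(3) e12(3) by simp
      ultimately show ?thesis by (rule ok1)
    qed
  qed
  have "energy_closed own s t z d E X" unfolding energy_closed_def
  proof (intro allI impI)
    fix v n assume "(v, n) \<in> X"
    then consider x y where "n = (\<lambda>j. x j + y j)" "(v, x) \<in> X1" "(p, y) \<in> X2"
      | x y where "n = (\<lambda>j. x j + y j)" "(p, x) \<in> X1" "(v, y) \<in> X2"
      unfolding X_def by blast
    then show "(\<exists>e\<in>E. s e = v \<and> ?ok X e n) \<and> (own v \<longrightarrow> (\<forall>e\<in>E. s e = v \<longrightarrow> ?ok X e n))"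
    proof cases
      case 1
      show ?thesis unfolding 1(1) by (rule cond1[OF 1(2,3)])
    next
      case 2
      show ?thesis unfolding 2(1) by (rule cond2[OF 2(2,3)])
    qed
  qed
  moreover have "X \<noteq> {}" using p unfolding X_def by blast
  ultimately show ?thesis by blast
qed

text \<open>Edges are removed where the opponent has a choice until no choice is left, and then
  \<open>energy_closed_of_cycle\<close> applies. If removing \<open>e1\<close> and removing
  \<open>e2\<close> both let the energy player survive, \<open>energy_merge\<close> would contradict
  the assumption, so one of the two removals is safe.\<close>

lemma energy_memoryless:
  assumes "finite E" "\<nexists>X. X \<noteq> {} \<and> energy_closed own s t z d E X"
  shows "\<exists>E'\<subseteq>E. (\<forall>e\<in>E. \<exists>e'\<in>E'. s e' = s e) \<and> (\<forall>e\<in>E. \<not> own (s e) \<longrightarrow> e \<in> E') \<and>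
    \<not> nonneg_cycle s t z d E'"
  using assms
proof (induction E rule: finite_psubset_induct)
  case (psubset E)
  show ?case
  proof (cases "\<exists>e1\<in>E. \<exists>e2\<in>E. own (s e1) \<and> s e1 = s e2 \<and> e1 \<noteq> e2")
    case False
    then show ?thesis using energy_closed_of_cycle[of E own s t z d] psubset.prems
      by (intro exI[of _ E]) blast
  next
    case True
    then obtain e1 e2 where e: "e1 \<in> E" "e2 \<in> E" "own (s e1)" "s e1 = s e2" "e1 \<noteq> e2" by blast
    have IH: ?thesis if "\<nexists>X. X \<noteq> {} \<and> energy_closed own s t z d (E - {e}) X" "e \<in> E" "own (s e)"
      "e' \<in> E" "e \<noteq> e'" "s e' = s e" for e e'
    proof -
      from psubset.IH[OF _ that(1)] that(2) obtain E' where E': "E' \<subseteq> E - {e}"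
        "\<forall>e\<in>E - {e}. \<exists>e'\<in>E'. s e' = s e" "\<forall>e\<in>E - {e}. \<not> own (s e) \<longrightarrow> e \<in> E'"
        "\<not> nonneg_cycle s t z d E'" by blast
      have "\<exists>e'\<in>E'. s e' = s k" if "k \<in> E" for k
        using E'(2) that \<open>e' \<in> E\<close> \<open>e \<noteq> e'\<close> \<open>s e' = s e\<close> by (metis Diff_iff singletonD)
      moreover have "k \<in> E'" if "k \<in> E" "\<not> own (s k)" for k using E'(3) that \<open>own (s e)\<close> by blast
      ultimately show ?thesis using E'(1,4) by blast
    qed
    \<comment> \<open>A region that never visits the source of the removed edge is closed in the
      whole graph too; hence both regions meet the vertex at which they are to be merged.\<close>
    have up: "energy_closed own s t z d E X"
      if X: "energy_closed own s t z d (E - {e}) X" and "\<And>n. (s e, n) \<notin> X" for X e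
      using X that(2) unfolding energy_closed_def by (metis Diff_iff singletonD)
    show ?thesis
    proof (rule ccontr)
      assume no: "\<not> ?thesis"
      obtain X1 where X1: "X1 \<noteq> {}" "energy_closed own s t z d (E - {e1}) X1"
        using IH[of e1 e2] no e by metis
      obtain X2 where X2: "X2 \<noteq> {}" "energy_closed own s t z d (E - {e2}) X2"
        using IH[of e2 e1] no e by metis
      obtain n1 where n1: "(s e1, n1) \<in> X1" using up[OF X1(2)] X1(1) psubset.prems by blast
      obtain n2 where n2: "(s e2, n2) \<in> X2" using up[OF X2(2)] X2(1) psubset.prems by blast
      show False
        using energy_merge[OF X1(2) X2(2) e(5) refl] n1 n2 e(4) psubset.prems by metis
    qed
  qed
qed

text \<open>If some edge of \<open>C\<close> lies on no cycle, reachability gives \<open>p\<close> with \<open>y = 0\<close>. Otherwise restrict to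
  one strongly connected component: the alternative to a ranking in Farkas' lemma is a circulation
  with full support and nonnegative effect, which an Euler circuit turns into a cycle.\<close>

lemma no_nonneg_cycle_ranking:
  fixes s t :: "'e \<Rightarrow> 'v" and z :: "'e \<Rightarrow> nat \<Rightarrow> int"
  assumes C: "finite C" "C \<noteq> {}" and no: "\<not> nonneg_cycle s t z d C"
  shows "\<exists>(y :: 'v \<Rightarrow> nat \<Rightarrow> nat) (p :: 'v \<Rightarrow> nat).
    (\<forall>e\<in>C. (\<forall>j<d. y (s e) j = y (t e) j) \<and>
      (\<Sum>j<d. int (y (s e) j) * z e j) + int (p (t e)) \<le> int (p (s e))) \<and>
    (\<exists>e\<in>C. (\<Sum>j<d. int (y (s e) j) * z e j) + int (p (t e)) < int (p (s e)))"
proof -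
  define r where "r = {(s e, t e) | e. e \<in> C}"
  show ?thesis
  proof (cases "\<exists>e\<in>C. (t e, s e) \<notin> r\<^sup>*")
    case True
    then obtain e0 where e0: "e0 \<in> C" "(t e0, s e0) \<notin> r\<^sup>*" by blast
    \<comment> \<open>Edges never leave the set of vertices reachable from \<open>t e0\<close>, and
      \<open>e0\<close> enters it from outside.\<close>
    define p where "p v = (if (t e0, v) \<in> r\<^sup>* then 0 else 1 :: nat)" for v
    have "p (t e) \<le> p (s e)" if "e \<in> C" for e
    proof -
      have "(s e, t e) \<in> r" using that by (auto simp: r_def)
      then show ?thesis by (auto simp: p_def intro: rtrancl_into_rtrancl)
    qed
    moreover have "p (t e0) < p (s e0)" using e0 by (simp add: p_def)
    ultimately show ?thesis using e0(1) by (intro exI[of _ "\<lambda>_ _. 0"] exI[of _ p]) auto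
  next
    case False
    then have returns: "(t e, s e) \<in> r\<^sup>*" if "e \<in> C" for e using that by blast
    obtain e0 where e0: "e0 \<in> C" using C(2) by blast
    \<comment> \<open>Every edge lies on a cycle here, so \<open>R\<close> is a strongly connected
      component, and no edge enters or leaves it.\<close>
    define R where "R = {v. (s e0, v) \<in> r\<^sup>*}"
    have R: "s e \<in> R \<longleftrightarrow> t e \<in> R" if "e \<in> C" for e
    proof -
      have "(s e, t e) \<in> r" using that by (auto simp: r_def)
      then show ?thesis using returns[OF that] unfolding R_def
        by (auto intro: rtrancl_into_rtrancl rtrancl_trans)
    qed
    define C1 where "C1 = {e \<in> C. s e \<in> R}"
    have C1: "finite C1" "C1 \<noteq> {}" "C1 \<subseteq> C" using C(1) e0 by (auto simp: C1_def R_def)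
    define V where "V = s ` C1 \<union> t ` C1"
    have V: "finite V" using C1(1) by (simp add: V_def)
    define \<delta> where "\<delta> e v = of_bool (t e = v) - (of_bool (s e = v) :: int)" for e v
    \<comment> \<open>The coordinates are the effects on the counters and, for each vertex, the flow
      balance with both signs, so that two inequalities force an equation.\<close>
    define a where "a e = case_sum (z e) (case_sum (\<delta> e) (\<lambda>v. - \<delta> e v))" for e
    let ?I = "{..<d} <+> (V <+> V)"
    have sumI: "(\<Sum>i\<in>?I. f i) = (\<Sum>j<d. f (Inl j)) + ((\<Sum>v\<in>V. f (Inr (Inl v))) + (\<Sum>v\<in>V. f (Inr (Inr v))))"
      for f :: "_ \<Rightarrow> int" using V by (simp add: sum.Plus)
    from tucker[OF C1(1), of ?I a] V consider
      (rank) y where "\<forall>e\<in>C1. (\<Sum>i\<in>?I. int (y i) * a e i) \<le> 0" "\<exists>e\<in>C1. (\<Sum>i\<in>?I. int (y i) * a e i) < 0"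
    | (flow) l where "\<forall>e\<in>C1. l e \<ge> (1::nat)" "\<forall>i\<in>?I. (\<Sum>e\<in>C1. int (l e) * a e i) \<ge> 0"
      by auto
    then show ?thesis
    proof cases
      case rank
      define q where "q v = int (y (Inr (Inl v))) - int (y (Inr (Inr v)))" for v
      have q: "(\<Sum>v\<in>V. int (y (Inr (Inl v))) * \<delta> e v) + (\<Sum>v\<in>V. int (y (Inr (Inr v))) * (- \<delta> e v)) =
        q (t e) - q (s e)" if "e \<in> C1" for e
      proof -
        have "(\<Sum>v\<in>V. int (y (Inr (Inl v))) * \<delta> e v) + (\<Sum>v\<in>V. int (y (Inr (Inr v))) * (- \<delta> e v)) =
          (\<Sum>v\<in>V. (if t e = v then q v else 0) - (if s e = v then q v else 0))"
          unfolding sum.distrib[symmetric]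
          by (rule sum.cong) (auto simp: \<delta>_def q_def algebra_simps)
        then show ?thesis using V that by (simp add: sum_subtractf V_def)
      qed
      \<comment> \<open>The potential \<open>q\<close> is a difference of naturals; the shift by
        \<open>K\<close> makes it nonnegative and leaves its differences along edges
        unchanged.\<close>
      define K where "K = (\<Sum>v\<in>V. y (Inr (Inr v)))"
      define p where "p v = (if v \<in> R then nat (q v + int K) else 0)" for v
      have p: "int (p v) = q v + int K" if "v \<in> V" "v \<in> R" for v
      proof -
        have "y (Inr (Inr v)) \<le> K" unfolding K_def using that V by (intro member_le_sum) auto
        then show ?thesis using that by (simp add: p_def q_def)
      qed
      \<comment> \<open>Outside the component the weights and the potential vanish, so edges there
        meet the weak inequality with equality.\<close>
      define y' where "y' v j = (if v \<in> R then y (Inl j) else 0)" for v j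
      have in1: "(\<Sum>j<d. int (y' (s e) j) * z e j) + int (p (t e)) - int (p (s e)) =
        (\<Sum>i\<in>?I. int (y i) * a e i)" if "e \<in> C1" for e
      proof -
        have "s e \<in> R" "t e \<in> R" "s e \<in> V" "t e \<in> V" using that R by (auto simp: C1_def V_def)
        then show ?thesis unfolding sumI using q[OF that] by (simp add: y'_def p a_def)
      qed
      have out: "(\<Sum>j<d. int (y' (s e) j) * z e j) + int (p (t e)) - int (p (s e)) = 0"
        if "e \<in> C" "e \<notin> C1" for e
        using that R[of e] by (simp add: C1_def y'_def p_def)
      have "\<forall>j<d. y' (s e) j = y' (t e) j" if "e \<in> C" for e using R[OF that] by (simp add: y'_def)
      moreover have "(\<Sum>j<d. int (y' (s e) j) * z e j) + int (p (t e)) \<le> int (p (s e))" if "e \<in> C" for e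
        using in1[of e] out[OF that] rank(1) by (cases "e \<in> C1") auto
      moreover have "\<exists>e\<in>C. (\<Sum>j<d. int (y' (s e) j) * z e j) + int (p (t e)) < int (p (s e))"
        using in1 rank(2) C1(3) by force
      ultimately show ?thesis by blast
    next
      case flow
      have bal: "(\<Sum>e | e \<in> C1 \<and> s e = v. l e) = (\<Sum>e | e \<in> C1 \<and> t e = v. l e)" for v
      proof (cases "v \<in> V")
        case True
        have "(\<Sum>e\<in>C1. int (l e) * \<delta> e v) = 0"
          using flow(2)[rule_format, of "Inr (Inl v)"] flow(2)[rule_format, of "Inr (Inr v)"] True
          by (simp add: a_def sum_negf InrI InlI)
        moreover have "(\<Sum>e\<in>C1. int (l e) * \<delta> e v) =
          (\<Sum>e\<in>C1. if t e = v then int (l e) else 0) - (\<Sum>e\<in>C1. if s e = v then int (l e) else 0)"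
          unfolding sum_subtractf[symmetric] by (rule sum.cong) (auto simp: \<delta>_def)
        ultimately have "int (\<Sum>e | e \<in> C1 \<and> s e = v. l e) = int (\<Sum>e | e \<in> C1 \<and> t e = v. l e)"
          using C1(1) by (simp add: sum.inter_filter[symmetric])
        then show ?thesis by (simp only: of_nat_eq_iff)
      next
        case False
        then have "{e. e \<in> C1 \<and> s e = v} = {}" "{e. e \<in> C1 \<and> t e = v} = {}" by (auto simp: V_def)
        then show ?thesis by (simp only:)
      qed
      have con: "(t e, s e') \<in> {(s e, t e) | e. e \<in> C1}\<^sup>*" if e: "e \<in> C1" "e' \<in> C1" for e e'
      proof -
        have "(v, s e0) \<in> r\<^sup>*" if "(s e0, v) \<in> r\<^sup>*" for v
          using that
        proof (induction rule: rtrancl_induct)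
          case (step v w)
          then obtain k where "k \<in> C" "v = s k" "w = t k" by (auto simp: r_def)
          then show ?case using returns step.IH by (metis rtrancl_trans)
        qed simp
        moreover have "t e \<in> R" "s e' \<in> R" using e R by (auto simp: C1_def)
        ultimately have "(t e, s e') \<in> r\<^sup>*" unfolding R_def by (metis mem_Collect_eq rtrancl_trans)
        then show ?thesis
        proof (induction rule: rtrancl_induct)
          case (step v w)
          then obtain k where k: "k \<in> C" "v = s k" "w = t k" by (auto simp: r_def)
          have "v \<in> R" using \<open>t e \<in> R\<close> step(1) unfolding R_def by (auto intro: rtrancl_trans)
          then have "k \<in> C1" using k by (simp add: C1_def)
          then show ?case using step.IH k by (auto intro: rtrancl_into_rtrancl)
        qed simp
      qed
      obtain u es where es: "path s t u es u" "es \<noteq> []" "set es \<subseteq> C1"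
        "\<And>e. e \<in> C1 \<Longrightarrow> count_list es e = l e"
        using euler_circuit[OF C1(1,2) _ bal con] flow(1) by metis
      have "(\<Sum>e\<leftarrow>es. z e j) \<ge> 0" if "j < d" for j
      proof -
        have "0 \<le> (\<Sum>e\<in>C1. int (l e) * a e (Inl j))"
          using flow(2)[rule_format, of "Inl j"] that by (simp add: InlI)
        also have "\<dots> = (\<Sum>e\<in>C1. int (count_list es e) * z e j)"
          using es(4) by (intro sum.cong) (simp_all add: a_def)
        also have "\<dots> = (\<Sum>e\<leftarrow>es. z e j)" by (rule sum_count_list[OF C1(1) es(3)])
        finally show ?thesis .
      qed
      then have "nonneg_cycle s t z d C" unfolding nonneg_cycle_def using es C1(3) by blast
      with no show ?thesis by blast
    qed
  qed
qed

section \<open>Certificates for counter games\<close>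

locale vgame_data =
  fixes d :: nat and Q1 T :: "nat set" and src dst :: "nat \<Rightarrow> nat" and ps ng :: "nat \<Rightarrow> nat \<Rightarrow> nat"
    and qF :: nat
begin

text \<open>Effects are differences of the natural numbers \<open>ps t j\<close> and
  \<open>ng t j\<close>, and the subtraction is moved across the equation so that certificates are
  checked with natural number arithmetic only.\<close>

definition mv :: "nat \<Rightarrow> (nat \<Rightarrow> nat) \<Rightarrow> (nat \<Rightarrow> nat) \<Rightarrow> bool" where
  "mv t v v' \<longleftrightarrow> (\<forall>j<d. v' j + ng t j = v j + ps t j)"

text \<open>A node of a negative certificate codes a triple \<open>(q, v, k)\<close> such that the opponent can avoid
  more than \<open>k\<close> visits to \<open>qF\<close> from \<open>(q, v)\<close>.\<close>

definition no_move :: "nat set \<Rightarrow> nat \<Rightarrow> nat \<Rightarrow> bool" where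
  "no_move N n t \<longleftrightarrow> (\<exists>n'\<in>N. pfst n' = dst t \<and>
     (\<forall>j<d. fn (pfst (psnd n')) j + ng t j \<le> fn (pfst (psnd n)) j + ps t j) \<and>
     psnd (psnd n') + (if pfst n = qF then 1 else 0) \<le> psnd (psnd n))"

definition no_cert :: "bool \<Rightarrow> nat \<Rightarrow> (nat \<Rightarrow> nat) \<Rightarrow> nat set \<Rightarrow> bool" where
  "no_cert b q0 v0 N \<longleftrightarrow>
     (\<exists>n\<in>N. pfst n = q0 \<and> (\<forall>j<d. fn (pfst (psnd n)) j \<le> v0 j) \<and> (b \<longrightarrow> psnd (psnd n) = 0)) \<and>
     (\<forall>n\<in>N. (pfst n \<in> Q1 \<longrightarrow> (\<forall>t\<in>T. src t = pfst n \<longrightarrow> no_move N n t)) \<and>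
       (pfst n \<notin> Q1 \<longrightarrow> (\<exists>t\<in>T. src t = pfst n \<and> no_move N n t)))"

text \<open>A node of a positive certificate codes a pair \<open>(q, w)\<close>, where entries \<open>w j \<ge> \<beta>\<close> stand for
  \<open>\<omega>\<close>; an edge codes a triple of a node, a transition and a node.\<close>

definition covers :: "nat \<Rightarrow> nat \<Rightarrow> nat \<Rightarrow> nat \<Rightarrow> bool" where
  "covers \<beta> m t m' \<longleftrightarrow> pfst m' = dst t \<and>
     (\<forall>j<d. \<beta> \<le> fn (psnd m') j \<or> (fn (psnd m) j < \<beta> \<and> fn (psnd m) j + ps t j \<le> fn (psnd m') j + ng t j))"

definition enab :: "nat \<Rightarrow> nat \<Rightarrow> nat \<Rightarrow> bool" where
  "enab \<beta> m t \<longleftrightarrow> (\<forall>j<d. \<beta> \<le> fn (psnd m) j \<or> ng t j \<le> fn (psnd m) j + ps t j)"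

definition good_succ :: "nat \<Rightarrow> nat set \<Rightarrow> nat set \<Rightarrow> nat \<Rightarrow> nat \<Rightarrow> nat \<Rightarrow> bool" where
  "good_succ \<beta> M E m t m' \<longleftrightarrow> m' \<in> M \<and> covers \<beta> m t m' \<and> (pfst m \<noteq> qF \<longrightarrow> pair m (pair t m') \<in> E)"

text \<open>The weights \<open>y\<close> may depend on the node because \<open>C\<close> need not be connected. On a play along edges in
  \<open>C\<close>, the value \<open>(\<Sum>j<d. y j * v j) + p\<close> never increases, and it decreases at some edge of \<open>C\<close>.\<close>

definition ranking :: "nat set \<Rightarrow> nat \<Rightarrow> nat \<Rightarrow> bool" where
  "ranking C y p \<longleftrightarrow>
     (\<forall>e\<in>C. (\<forall>j<d. fn y (pair (pfst e) j) = fn y (pair (psnd (psnd e)) j)) \<and>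
       (\<Sum>j<d. fn y (pair (pfst e) j) * ps (pfst (psnd e)) j) + fn p (psnd (psnd e))
       \<le> (\<Sum>j<d. fn y (pair (pfst e) j) * ng (pfst (psnd e)) j) + fn p (pfst e)) \<and>
     (\<exists>e\<in>C. (\<Sum>j<d. fn y (pair (pfst e) j) * ps (pfst (psnd e)) j) + fn p (psnd (psnd e))
       < (\<Sum>j<d. fn y (pair (pfst e) j) * ng (pfst (psnd e)) j) + fn p (pfst e))"

definition yes_cert :: "bool \<Rightarrow> nat \<Rightarrow> (nat \<Rightarrow> nat) \<Rightarrow> nat \<Rightarrow> nat set \<Rightarrow> nat set \<Rightarrow> bool" where
  "yes_cert b q0 v0 \<beta> M E \<longleftrightarrow>
     (\<exists>m\<in>M. pfst m = q0 \<and> (\<forall>j<d. \<beta> \<le> fn (psnd m) j \<or> v0 j \<le> fn (psnd m) j)) \<and>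
     (\<forall>m\<in>M. (b \<longrightarrow> pfst m \<noteq> qF) \<longrightarrow>
       (pfst m \<in> Q1 \<longrightarrow> (\<exists>t\<in>T. src t = pfst m \<and> (\<exists>m'. good_succ \<beta> M E m t m'))) \<and>
       (pfst m \<notin> Q1 \<longrightarrow> (\<forall>t\<in>T. src t = pfst m \<longrightarrow> enab \<beta> m t \<longrightarrow> (\<exists>m'. good_succ \<beta> M E m t m')))) \<and>
     (\<forall>C\<subseteq>E. C \<noteq> {} \<longrightarrow> (\<exists>y p. ranking C y p))"

text \<open>\<open>few_visits q v k\<close>: from \<open>(q, v)\<close> the opponent can avoid a \<open>(k + 1)\<close>-st visit to \<open>qF\<close>.
  In \<open>Lose\<close> and in the certificates, \<open>b\<close> selects reachability over repeated reachability.\<close>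

coinductive few_visits :: "nat \<Rightarrow> (nat \<Rightarrow> nat) \<Rightarrow> nat \<Rightarrow> bool" where
  few_visits_player: "q \<in> Q1 \<Longrightarrow> q = qF \<longrightarrow> k > 0 \<Longrightarrow>
     \<forall>t\<in>T. src t = q \<longrightarrow> few_visits (dst t) v (k - of_bool (q = qF)) \<Longrightarrow> few_visits q v k"
| few_visits_opponent: "q \<notin> Q1 \<Longrightarrow> q = qF \<longrightarrow> k > 0 \<Longrightarrow> t \<in> T \<Longrightarrow> src t = q \<Longrightarrow> mv t v v' \<Longrightarrow>
     few_visits (dst t) v' (k - of_bool (q = qF)) \<Longrightarrow> few_visits q v k"

definition Lose :: "bool \<Rightarrow> nat \<Rightarrow> (nat \<Rightarrow> nat) \<Rightarrow> bool" where
  "Lose b q v \<longleftrightarrow> (\<exists>k. few_visits q v k \<and> (b \<longrightarrow> k = 0))"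

text \<open>A move of Player 1 may leave the invariant \<open>X\<close> for a position already known
  to satisfy \<open>few_visits\<close>; in \<open>yes_cert_complete\<close> these are the moves out
  of the winning nodes.\<close>

lemma few_visits_coinduct:
  assumes "X q v k"
    and "\<And>q v k. X q v k \<Longrightarrow> (q = qF \<longrightarrow> k > 0) \<and>
      (q \<in> Q1 \<longrightarrow> (\<forall>t\<in>T. src t = q \<longrightarrow>
        X (dst t) v (k - of_bool (q = qF)) \<or> few_visits (dst t) v (k - of_bool (q = qF)))) \<and>
      (q \<notin> Q1 \<longrightarrow> (\<exists>t\<in>T. src t = q \<and> (\<exists>w. mv t v w \<and> X (dst t) w (k - of_bool (q = qF)))))"
  shows "few_visits q v k"
proof (rule few_visits.coinduct[of X])
  show "(\<exists>q1 k1 v1. q = q1 \<and> v = v1 \<and> k = k1 \<and> q1 \<in> Q1 \<and> (q1 = qF \<longrightarrow> 0 < k1) \<and>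
      (\<forall>t\<in>T. src t = q1 \<longrightarrow> X (dst t) v1 (k1 - of_bool (q1 = qF)) \<or> few_visits (dst t) v1 (k1 -
          of_bool (q1 = qF)))) \<or>
    (\<exists>q1 k1 t v1 w1. q = q1 \<and> v = v1 \<and> k = k1 \<and> q1 \<notin> Q1 \<and> (q1 = qF \<longrightarrow> 0 < k1) \<and> t \<in> T \<and>
      src t = q1 \<and> mv t v1 w1 \<and> (X (dst t) w1 (k1 - of_bool (q1 = qF)) \<or> few_visits (dst t) w1 (k1
          - of_bool (q1 = qF))))"
    if "X q v k" for q v k
    using assms(2)[OF that] by blast
qed (rule assms(1))

text \<open>The opponent repeats the moves made with the smaller counters and carries the surplus
  along; the moves of Player 1 are the same for all counter values.\<close>

lemma few_visits_mono:
  assumes "few_visits q v k" "\<forall>j<d. v j \<le> v' j" "k \<le> k'"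
  shows "few_visits q v' k'"
proof -
  define X where "X q v' k' \<longleftrightarrow> (\<exists>v k. few_visits q v k \<and> (\<forall>j<d. v j \<le> v' j) \<and> k \<le> k')" for q v' k'
  have "X q v' k'" unfolding X_def using assms by blast
  then show ?thesis
  proof (rule few_visits_coinduct[where X = X])
    fix q v' k' assume "X q v' k'"
    then obtain v k where vk: "few_visits q v k" "\<forall>j<d. v j \<le> v' j" "k \<le> k'" unfolding X_def by blast
    let ?l = "k' - of_bool (q = qF)"
    have le: "k - of_bool (q = qF) \<le> ?l" using vk(3) by simp
    from vk(1) show "(q = qF \<longrightarrow> k' > 0) \<and>
      (q \<in> Q1 \<longrightarrow> (\<forall>t\<in>T. src t = q \<longrightarrow> X (dst t) v' ?l \<or> few_visits (dst t) v' ?l)) \<and>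
      (q \<notin> Q1 \<longrightarrow> (\<exists>t\<in>T. src t = q \<and> (\<exists>w. mv t v' w \<and> X (dst t) w ?l)))"
    proof cases
      case few_visits_player
      have "\<forall>t\<in>T. src t = q \<longrightarrow> X (dst t) v' ?l"
        using few_visits_player(3) vk(2) le unfolding X_def by blast
      moreover have "q = qF \<longrightarrow> k' > 0" using few_visits_player(2) vk(3) by (meson less_le_trans)
      ultimately show ?thesis using few_visits_player(1) by blast
    next
      case (few_visits_opponent t w)
      define w' where "w' j = v' j + ps t j - ng t j" for j
      have "w' j + ng t j = v' j + ps t j \<and> w j \<le> w' j" if "j < d" for j
      proof -
        have "v j \<le> v' j" "w j + ng t j = v j + ps t j"
          using vk(2) few_visits_opponent(5) that by (auto simp: mv_def)
        then show ?thesis unfolding w'_def by linarith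
      qed
      then have "mv t v' w'" "\<forall>j<d. w j \<le> w' j" by (auto simp: mv_def)
      then have "X (dst t) w' ?l" unfolding X_def using few_visits_opponent(6) le by blast
      moreover have "q = qF \<longrightarrow> k' > 0" using few_visits_opponent(2) vk(3) by (meson less_le_trans)
      ultimately show ?thesis using few_visits_opponent \<open>mv t v' w'\<close> by blast
    qed
  qed
qed

lemma Lose_mono: "Lose b q v \<Longrightarrow> \<forall>j<d. v j \<le> v' j \<Longrightarrow> Lose b q v'"
  unfolding Lose_def using few_visits_mono by blast

text \<open>Bounds on the visits can be added up, so finitely many lost positions share one.
  Together with the finite branching of Player 1 this keeps the bound of a lost position
  finite.\<close>

lemma Lose_uniform:
  assumes "finite S" "\<And>x. x \<in> S \<Longrightarrow> Lose b (f x) (g x)"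
  shows "\<exists>K. (b \<longrightarrow> K = 0) \<and> (\<forall>x\<in>S. few_visits (f x) (g x) K)"
  using assms
proof (induction S rule: finite_induct)
  case (insert x S)
  then obtain K where K: "b \<longrightarrow> K = 0" "\<forall>x\<in>S. few_visits (f x) (g x) K" by blast
  obtain k where k: "few_visits (f x) (g x) k" "b \<longrightarrow> k = 0" using insert.prems unfolding Lose_def by blast
  have "\<forall>y\<in>insert x S. few_visits (f y) (g y) (K + k)" using K(2) k(1) by (auto intro: few_visits_mono)
  then show ?case using K(1) k(2) by (intro exI[of _ "K + k"]) auto
qed auto

lemma Lose_step_opponent:
  assumes "t \<in> T" "src t = q" "q \<notin> Q1" "mv t v v'" "Lose b (dst t) v'" "b \<longrightarrow> q \<noteq> qF"
  shows "Lose b q v"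
proof -
  obtain k where k: "few_visits (dst t) v' k" "b \<longrightarrow> k = 0" using assms(5) unfolding Lose_def by blast
  \<comment> \<open>A visit at \<open>q\<close> itself is added to the bound; for reachability
    \<open>q\<close> is not the target and the bound remains 0.\<close>
  have "few_visits q v (k + of_bool (q = qF))" by (rule few_visits_opponent) (use assms k in auto)
  then show ?thesis using k(2) assms(6) unfolding Lose_def
    by (intro exI[of _ "k + of_bool (q = qF)"]) auto
qed

lemma Lose_step_player:
  assumes "finite T" "q \<in> Q1" "\<And>t. t \<in> T \<Longrightarrow> src t = q \<Longrightarrow> Lose b (dst t) v" "b \<longrightarrow> q \<noteq> qF"
  shows "Lose b q v"
proof -
  have "finite {t \<in> T. src t = q}" using assms(1) by simp
  from Lose_uniform[OF this, of b dst "\<lambda>_. v"] assms(3) obtain K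
    where K: "b \<longrightarrow> K = 0" "\<forall>t\<in>T. src t = q \<longrightarrow> few_visits (dst t) v K" by auto
  have "few_visits q v (K + of_bool (q = qF))" by (rule few_visits_player) (use assms K in auto)
  then show ?thesis using K(1) assms(4) unfolding Lose_def
    by (intro exI[of _ "K + of_bool (q = qF)"]) auto
qed

text \<open>\<open>dickson\<close> gives two visits to one node, the second with counters at least
  as large, so \<open>\<Phi>\<close> has not decreased. The edges used in between form a set
  \<open>C\<close>, and ranking it makes \<open>\<Phi>\<close> drop strictly, since all of them,
  including one with a strict drop, are traversed.\<close>

lemma ranking_no_infinite_path:
  assumes fin: "finite M" and M: "\<And>i. m i \<in> M" and E: "\<And>i. pair (m i) (pair (t i) (m (Suc i))) \<in> E"
    and step: "\<And>i. mv (t i) (v i) (v (Suc i))"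
    and rank: "\<And>C. C \<subseteq> E \<Longrightarrow> C \<noteq> {} \<Longrightarrow> \<exists>y p. ranking C y p"
  shows False
proof -
  have "finite (range m)" using M fin by (meson finite_subset image_subsetI)
  from dickson[OF this, where f = v and d = d]
  obtain i k where ik: "i < k" "m i = m k" "\<forall>j<d. v i j \<le> v k j" .
  define e where "e l = pair (m l) (pair (t l) (m (Suc l)))" for l
  have "e ` {i..<k} \<subseteq> E" "e ` {i..<k} \<noteq> {}" using E ik(1) by (auto simp: e_def)
  from rank[OF this] obtain y p where yp: "ranking (e ` {i..<k}) y p" by blast
  define Y where "Y j = fn y (pair (m i) j)" for j
  have Y: "fn y (pair (m l) j) = Y j" if "i \<le> l" "l \<le> k" "j < d" for l j
    using that(1,2)
  proof (induction rule: dec_induct)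
    case (step l)
    then have "e l \<in> e ` {i..<k}" by simp
    then have "fn y (pair (m l) j) = fn y (pair (m (Suc l)) j)"
      using yp[unfolded ranking_def, THEN conjunct1, rule_format, of "e l"] that(3) by (simp add: e_def)
    with step show ?case by simp
  qed (simp add: Y_def)
  define \<Phi> where "\<Phi> l = (\<Sum>j<d. Y j * v l j) + fn p (m l)" for l
  have bal: "(\<Sum>j<d. Y j * v (Suc l) j) + (\<Sum>j<d. Y j * ng (t l) j) =
      (\<Sum>j<d. Y j * v l j) + (\<Sum>j<d. Y j * ps (t l) j)" for l
    unfolding sum.distrib[symmetric] distrib_left[symmetric]
    using step[of l] by (intro sum.cong) (auto simp: mv_def)
  have sumY: "(\<Sum>j<d. fn y (pair (m l) j) * f j) = (\<Sum>j<d. Y j * f j)" if "i \<le> l" "l < k" for l f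
    using Y that by (intro sum.cong) auto
  have le: "\<Phi> (Suc l) \<le> \<Phi> l" if "i \<le> l" "l < k" for l
  proof -
    have "e l \<in> e ` {i..<k}" using that by simp
    then have "(\<Sum>j<d. fn y (pair (m l) j) * ps (t l) j) + fn p (m (Suc l))
       \<le> (\<Sum>j<d. fn y (pair (m l) j) * ng (t l) j) + fn p (m l)"
      using yp[unfolded ranking_def, THEN conjunct1, rule_format, of "e l", THEN conjunct2] by
          (simp add: e_def)
    then show ?thesis using bal[of l] unfolding sumY[OF that] \<Phi>_def by linarith
  qed
  obtain l0 where l0: "i \<le> l0" "l0 < k" "(\<Sum>j<d. fn y (pair (m l0) j) * ps (t l0) j) + fn p (m (Suc l0))
       < (\<Sum>j<d. fn y (pair (m l0) j) * ng (t l0) j) + fn p (m l0)"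
    using yp unfolding ranking_def by (auto simp: e_def)
  have lt: "\<Phi> (Suc l0) < \<Phi> l0"
    using l0(3) bal[of l0] unfolding sumY[OF l0(1,2)] \<Phi>_def by linarith
  have antimono: "\<Phi> l' \<le> \<Phi> l" if "l \<le> l'" "i \<le> l" "l' \<le> k" for l l'
    using that by (induction rule: dec_induct) (use le order_trans in \<open>auto simp: Suc_le_eq\<close>)
  have "\<Phi> k < \<Phi> i" using antimono[of "Suc l0" k] antimono[of i l0] lt l0 by simp
  moreover have "\<Phi> i \<le> \<Phi> k" unfolding \<Phi>_def ik(2) using ik(3) by (auto intro!: sum_mono)
  ultimately show False by simp
qed

end

section \<open>Existence of certificates\<close>

locale vgame = vgame_data +
  fixes Q :: "nat set"
  assumes finite_Q: "finite Q" and finite_T: "finite T" and dst_Q: "\<And>t. t \<in> T \<Longrightarrow> dst t \<in> Q"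
    and zero: "\<And>t j. t \<in> T \<Longrightarrow> src t \<in> Q1 \<Longrightarrow> j < d \<Longrightarrow> ps t j = ng t j"
begin

lemma no_cert_complete:
  assumes "Lose b q0 v0" "q0 \<in> Q"
  shows "\<exists>N. finite N \<and> no_cert b q0 v0 N"
proof -
  \<comment> \<open>The bound \<open>k\<close> is stored as coordinate \<open>d\<close>, so that
    \<open>finite_basis\<close> treats it as one more counter.\<close>
  define A where "A = {(q, v(d := k)) | q v k. q \<in> Q \<and> few_visits q v k}"
  have "fst ` A \<subseteq> Q" by (auto simp: A_def)
  then have "finite (fst ` A)" using finite_Q finite_subset by blast
  from finite_basis[OF this, of "Suc d"] obtain B where B: "B \<subseteq> A" "finite B"
    "\<forall>q v. (q, v) \<in> A \<longrightarrow> (\<exists>w. (q, w) \<in> B \<and> (\<forall>l<Suc d. w l \<le> v l))" by blast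
  define c where "c = (\<lambda>(q, w). pair q (pair (list_encode (map w [0..<d])) (w d)))"
  have c: "pfst (c (q, w)) = q" "\<And>j. j < d \<Longrightarrow> fn (pfst (psnd (c (q, w)))) j = w j"
    "psnd (psnd (c (q, w))) = w d" for q w by (simp_all add: c_def fn_list_encode)
  have BU: "few_visits q w (w d)" if "(q, w) \<in> B" for q w
  proof -
    from that B(1) obtain v k where "w = v(d := k)" "few_visits q v k" by (auto simp: A_def)
    then show ?thesis using few_visits_mono[of q v k w "w d"] by simp
  qed
  have cover: "\<exists>w. (q, w) \<in> B \<and> (\<forall>j<d. w j \<le> v j) \<and> w d \<le> k" if "few_visits q v k" "q \<in> Q" for q v k
  proof -
    have "(q, v(d := k)) \<in> A" using that by (auto simp: A_def)
    then obtain w where w: "(q, w) \<in> B" "\<forall>l<Suc d. w l \<le> (v(d := k)) l" using B(3) by blast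
    then have "w d \<le> k" "\<forall>j<d. w j \<le> v j" by (auto simp: less_Suc_eq)
    with w(1) show ?thesis by blast
  qed
  \<comment> \<open>A successor of a basis element need not be in the basis, but it lies above an
    element that is; this is why \<open>no_move\<close> asks for inequalities.\<close>
  have move: "no_move (c ` B) (c (q, w)) t"
    if t: "t \<in> T" "mv t w v'" "few_visits (dst t) v' (w d - of_bool (q = qF))" "q = qF \<longrightarrow> w d > 0"
        for q w t v'
  proof -
    obtain w' where w': "(dst t, w') \<in> B" "\<forall>j<d. w' j \<le> v' j" "w' d \<le> w d - of_bool (q = qF)"
      using cover[OF t(3) dst_Q[OF t(1)]] by blast
    have "\<forall>j<d. w' j + ng t j \<le> w j + ps t j"
    proof (intro allI impI)
      fix j assume "j < d"
      then have "w' j \<le> v' j" "v' j + ng t j = w j + ps t j" using w'(2) t(2) by (auto simp: mv_def)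
      then show "w' j + ng t j \<le> w j + ps t j" by linarith
    qed
    moreover have "w' d + (if q = qF then 1 else 0) \<le> w d" using w'(3) t(4) by auto
    ultimately have "pfst (c (dst t, w')) = dst t \<and>
       (\<forall>j<d. fn (pfst (psnd (c (dst t, w')))) j + ng t j \<le> fn (pfst (psnd (c (q, w)))) j + ps t j) \<and>
       psnd (psnd (c (dst t, w'))) + (if pfst (c (q, w)) = qF then 1 else 0) \<le> psnd (psnd (c (q, w)))"
      using c by simp
    then show ?thesis unfolding no_move_def using w'(1) by blast
  qed
  have "(pfst n \<in> Q1 \<longrightarrow> (\<forall>t\<in>T. src t = pfst n \<longrightarrow> no_move (c ` B) n t)) \<and>
       (pfst n \<notin> Q1 \<longrightarrow> (\<exists>t\<in>T. src t = pfst n \<and> no_move (c ` B) n t))" if n: "n \<in> c ` B" for n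
  proof -
    obtain q w where q: "n = c (q, w)" "(q, w) \<in> B" using n by auto
    from BU[OF q(2)] show ?thesis
    proof cases
      case few_visits_player
      have "no_move (c ` B) n t" if "t \<in> T" "src t = q" for t
        unfolding q(1) using few_visits_player that zero[of t] by (intro move[of t w w]) (auto
            simp: mv_def)
      then show ?thesis using q(1) c(1) few_visits_player(1) by simp
    next
      case (few_visits_opponent t v')
      then have "no_move (c ` B) n t" unfolding q(1) by (intro move[of t w v']) auto
      then show ?thesis using q(1) c(1) few_visits_opponent by auto
    qed
  qed
  moreover have "\<exists>n\<in>c ` B. pfst n = q0 \<and> (\<forall>j<d. fn (pfst (psnd n)) j \<le> v0 j) \<and> (b \<longrightarrow> psnd (psnd n) = 0)"
  proof -
    obtain k where k: "few_visits q0 v0 k" "b \<longrightarrow> k = 0" using assms(1) unfolding Lose_def by blast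
    obtain w where w: "(q0, w) \<in> B" "\<forall>j<d. w j \<le> v0 j" "w d \<le> k" using cover[OF k(1) assms(2)] by blast
    then show ?thesis using k(2) c by (intro bexI[of _ "c (q0, w)"]) auto
  qed
  ultimately show ?thesis unfolding no_cert_def using B(2) by (intro exI[of _ "c ` B"]) blast
qed

text \<open>The losing set is upward closed, hence has a finite basis; \<open>\<beta>\<close> bounds its entries.\<close>

lemma Lose_truncate:
  "\<exists>\<beta>. \<forall>q\<in>Q. \<forall>v. Lose b q v \<longrightarrow> Lose b q (\<lambda>j. min \<beta> (v j))"
proof -
  define A where "A = {(q, v). q \<in> Q \<and> Lose b q v}"
  have "fst ` A \<subseteq> Q" by (auto simp: A_def)
  then have "finite (fst ` A)" using finite_Q finite_subset by blast
  from finite_basis[OF this, of d] obtain B where B: "B \<subseteq> A" "finite B"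
    "\<forall>q v. (q, v) \<in> A \<longrightarrow> (\<exists>w. (q, w) \<in> B \<and> (\<forall>l<d. w l \<le> v l))" by blast
  define \<beta> where "\<beta> = (\<Sum>(q, w)\<in>B. \<Sum>l<d. w l)"
  have \<beta>: "w l \<le> \<beta>" if "(q, w) \<in> B" "l < d" for q w l
  proof -
    have "w l \<le> (\<Sum>l<d. w l)" using that(2) by (intro member_le_sum) auto
    also have "\<dots> = (\<lambda>(q, w). \<Sum>l<d. w l) (q, w)" by simp
    also have "\<dots> \<le> \<beta>" unfolding \<beta>_def using that(1) B(2) by (intro member_le_sum) auto
    finally show ?thesis .
  qed
  have "Lose b q (\<lambda>j. min \<beta> (v j))" if qv: "q \<in> Q" "Lose b q v" for q v
  proof -
    have "(q, v) \<in> A" using qv by (simp add: A_def)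
    then obtain w where w: "(q, w) \<in> B" "\<forall>l<d. w l \<le> v l" using B(3) by blast
    then have "Lose b q w" using B(1) by (auto simp: A_def)
    then show ?thesis by (rule Lose_mono) (use w \<beta> in auto)
  qed
  then show ?thesis by blast
qed

end

text \<open>On a closed path the inclusions form a circle, so a set that only grows along the edges
  is constant there; this is applied to the set of \<open>\<omega>\<close>-entries.\<close>

lemma path_mono:
  assumes "path s t u es v" "\<And>e. e \<in> set es \<Longrightarrow> f (s e) \<subseteq> f (t e)"
  shows "f u \<subseteq> f v \<and> (\<forall>e\<in>set es. f u \<subseteq> f (s e) \<and> f (t e) \<subseteq> f v)"
  using assms
proof (induction es arbitrary: u)
  case (Cons e es)
  have "f (t e) \<subseteq> f v \<and> (\<forall>k\<in>set es. f (t e) \<subseteq> f (s k) \<and> f (t k) \<subseteq> f v)"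
    by (rule Cons.IH) (use Cons.prems in auto)
  moreover have "s e = u" "f (s e) \<subseteq> f (t e)" using Cons.prems by auto
  ultimately show ?case by auto
qed simp

context vgame
begin

lemma yes_cert_complete:
  assumes win: "\<not> Lose b q0 v0" "q0 \<in> Q"
  shows "\<exists>\<beta> M E. finite M \<and> finite E \<and> yes_cert b q0 v0 \<beta> M E"
proof -
  obtain \<beta> where \<beta>: "\<And>q v. q \<in> Q \<Longrightarrow> Lose b q v \<Longrightarrow> Lose b q (\<lambda>j. min \<beta> (v j))"
    using Lose_truncate[of b] by blast
  define enc where "enc q w = pair q (list_encode (map w [0..<d]))" for q and w :: "nat \<Rightarrow> nat"
  have enc: "pfst (enc q w) = q" "\<And>j. j < d \<Longrightarrow> fn (psnd (enc q w)) j = w j" for q w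
    by (simp_all add: enc_def fn_list_encode)
  have Lose_cong: "Lose b q v \<longleftrightarrow> Lose b q v'" if "\<And>j. j < d \<Longrightarrow> v j = v' j" for q v v'
    using Lose_mono[of b q v v'] Lose_mono[of b q v' v] that by auto
  define M where "M = {enc q w | q w. q \<in> Q \<and> (\<forall>j<d. w j \<le> \<beta>) \<and> \<not> Lose b q w}"
  have Mfin: "finite M"
  proof -
    have "M \<subseteq> (\<lambda>(q, ws). pair q (list_encode ws)) ` (Q \<times> {ws. set ws \<subseteq> {..\<beta>} \<and> length ws = d})"
    proof
      fix m assume "m \<in> M"
      then obtain q w where qw: "m = enc q w" "q \<in> Q" "\<forall>j<d. w j \<le> \<beta>" unfolding M_def by blast
      show "m \<in> (\<lambda>(q, ws). pair q (list_encode ws)) ` (Q \<times> {ws. set ws \<subseteq> {..\<beta>} \<and> length ws = d})"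
        by (rule image_eqI[of _ _ "(q, map w [0..<d])"]) (use qw in \<open>auto simp: enc_def\<close>)
    qed
    moreover have "finite (Q \<times> {ws. set ws \<subseteq> {..\<beta>} \<and> length ws = d})"
      using finite_Q finite_lists_length_eq[of "{..\<beta>}" d] by simp
    ultimately show ?thesis using finite_surj by blast
  qed
  have M_I: "enc q w \<in> M" if "q \<in> Q" "\<forall>j<d. w j \<le> \<beta>" "\<not> Lose b q w" for q w
    using that unfolding M_def by blast
  have M_D: "pfst m \<in> Q \<and> (\<forall>j<d. fn (psnd m) j \<le> \<beta>) \<and> \<not> Lose b (pfst m) (fn (psnd m))" if m: "m \<in>
      M" for m
  proof -
    obtain q w where q: "m = enc q w" "q \<in> Q" "\<forall>j<d. w j \<le> \<beta>" "\<not> Lose b q w"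
      using m unfolding M_def by blast
    moreover have "Lose b q (fn (psnd m)) \<longleftrightarrow> Lose b q w" using q(1) enc(2) by (intro Lose_cong) simp
    ultimately show ?thesis using enc by simp
  qed
  \<comment> \<open>An entry \<open>\<beta>\<close> is absorbing. For a transition that is not
    enabled the truncated subtraction gives a meaningless value, which \<open>enab\<close> keeps out
    of the graph.\<close>
  define tr where "tr t w j = (if \<beta> \<le> w j then \<beta> else min \<beta> (w j + ps t j - ng t j))" for t j and
      w :: "nat \<Rightarrow> nat"
  define \<delta> where "\<delta> m t = enc (dst t) (tr t (fn (psnd m)))" for m t
  have \<delta>: "pfst (\<delta> m t) = dst t" "\<And>j. j < d \<Longrightarrow> fn (psnd (\<delta> m t)) j = tr t (fn (psnd m)) j" for m t
    by (simp_all add: \<delta>_def enc)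
  have cov: "covers \<beta> m t (\<delta> m t)" if "enab \<beta> m t" for m t
    unfolding covers_def
  proof (intro conjI allI impI)
    fix j assume j: "j < d"
    then have "\<beta> \<le> fn (psnd m) j \<or> ng t j \<le> fn (psnd m) j + ps t j" using that by (simp add: enab_def)
    then show "\<beta> \<le> fn (psnd (\<delta> m t)) j \<or>
      (fn (psnd m) j < \<beta> \<and> fn (psnd m) j + ps t j \<le> fn (psnd (\<delta> m t)) j + ng t j)"
      unfolding \<delta>(2)[OF j] tr_def by (auto simp: min_def)
  qed (rule \<delta>)
  have zero_tr: "fn (psnd (\<delta> m t)) j = fn (psnd m) j"
    if "m \<in> M" "t \<in> T" "src t = pfst m" "pfst m \<in> Q1" "j < d" for m t j
    using zero[of t j] that M_D[OF that(1)] unfolding \<delta>(2)[OF that(5)] tr_def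
    by (auto simp: min_def)
  have zero_enab: "enab \<beta> m t" if "t \<in> T" "src t = pfst m" "pfst m \<in> Q1" for m t
    using zero[of t] that unfolding enab_def by auto
  have opp: "\<delta> m t \<in> M" if m: "m \<in> M" "b \<longrightarrow> pfst m \<noteq> qF" "pfst m \<notin> Q1" "t \<in> T" "src t = pfst m"
      "enab \<beta> m t" for m t
    unfolding \<delta>_def
  proof (rule M_I)
    show "dst t \<in> Q" using dst_Q m(4) by blast
    show "\<forall>j<d. tr t (fn (psnd m)) j \<le> \<beta>" by (simp add: tr_def)
    show "\<not> Lose b (dst t) (tr t (fn (psnd m)))"
    proof
      assume L: "Lose b (dst t) (tr t (fn (psnd m)))"
      \<comment> \<open>A representative of the node: its \<open>\<omega>\<close>-entries get
        \<open>\<beta> + ng t j\<close>, which pays for \<open>t\<close> and leaves at least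
        \<open>\<beta>\<close>.\<close>
      define v where "v j = (if \<beta> \<le> fn (psnd m) j then \<beta> + ng t j else fn (psnd m) j)" for j
      define v' where "v' j = v j + ps t j - ng t j" for j
      have "v' j + ng t j = v j + ps t j \<and> tr t (fn (psnd m)) j \<le> v' j" if "j < d" for j
        using m(6) that unfolding v'_def v_def tr_def enab_def by (auto simp: min_def)
      then have "mv t v v'" "Lose b (dst t) v'" using Lose_mono[OF L, of v'] by (auto simp: mv_def)
      then have "Lose b (pfst m) v" using Lose_step_opponent m by blast
      then have "Lose b (pfst m) (\<lambda>j. min \<beta> (v j))" using \<beta> M_D[OF m(1)] by blast
      moreover have "Lose b (pfst m) (\<lambda>j. min \<beta> (v j)) \<longleftrightarrow> Lose b (pfst m) (fn (psnd m))"
        using M_D[OF m(1)] by (intro Lose_cong) (auto simp: v_def min_def intro: le_antisym)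
      ultimately show False using M_D[OF m(1)] by blast
    qed
  qed
  have player_lose: "Lose b (dst t) (fn (psnd m))"
    if "m \<in> M" "pfst m \<in> Q1" "t \<in> T" "src t = pfst m" "\<delta> m t \<notin> M" for m t
  proof (rule ccontr)
    assume "\<not> Lose b (dst t) (fn (psnd m))"
    moreover have "Lose b (dst t) (tr t (fn (psnd m))) \<longleftrightarrow> Lose b (dst t) (fn (psnd m))"
      using zero_tr[OF that(1,3,4,2)] \<delta>(2) by (intro Lose_cong) auto
    ultimately have "\<delta> m t \<in> M" unfolding \<delta>_def using dst_Q that(3) by (intro M_I) (auto simp: tr_def)
    then show False using that by blast
  qed
  have player: "\<exists>t\<in>T. src t = pfst m \<and> \<delta> m t \<in> M" if "m \<in> M" "b \<longrightarrow> pfst m \<noteq> qF" "pfst m \<in> Q1" for m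
    using Lose_step_player[OF finite_T that(3) _ that(2), of "fn (psnd m)"] player_lose[OF that(1,3)]
      M_D[OF that(1)] by blast
  define tri where "tri m t = pair m (pair t (\<delta> m t))" for m t
  define E1 where "E1 = {tri m t | m t. m \<in> M \<and> pfst m \<noteq> qF \<and> t \<in> T \<and> src t = pfst m \<and> enab \<beta> m t
      \<and> \<delta> m t \<in> M}"
  define J where "J m = {j. j < d \<and> \<beta> \<le> fn (psnd m) j}" for m
  define E0 where "E0 = {e \<in> E1. J (pfst e) = J (psnd (psnd e))}"
  define z where "z e j = int (ps (pfst (psnd e)) j) - int (ng (pfst (psnd e)) j)" for e j
  \<comment> \<open>The energy player is the opponent of Player 1, who tries to go on without
    visiting the target; hence \<open>own\<close> marks the nodes of Player 1.\<close>
  define own where "own m \<longleftrightarrow> pfst m \<in> Q1" for m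
  let ?s = pfst and ?t = "\<lambda>e. psnd (psnd e)"
  have E1fin: "finite E1"
  proof -
    have "E1 \<subseteq> (\<lambda>(m, t). tri m t) ` (M \<times> T)" unfolding E1_def by auto
    then show ?thesis using Mfin finite_T by (meson finite_SigmaI finite_imageI finite_subset)
  qed
  have E1_J: "J (?s e) \<subseteq> J (?t e)" if e: "e \<in> E1" for e
  proof -
    obtain m t where "e = tri m t" using e unfolding E1_def by blast
    then show ?thesis using \<delta>(2) by (auto simp: J_def tri_def tr_def)
  qed
  have player_E0: "tri m t \<in> E0" if "m \<in> M" "pfst m \<noteq> qF" "pfst m \<in> Q1" "t \<in> T" "src t = pfst m"
      "\<delta> m t \<in> M" for m t
  proof -
    have "J m = J (\<delta> m t)" using zero_tr[OF that(1,4,5,3)] by (auto simp: J_def)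
    moreover have "tri m t \<in> E1" unfolding E1_def using that zero_enab by blast
    ultimately show ?thesis by (simp add: E0_def tri_def)
  qed
  \<comment> \<open>Along the edges in \<open>E0\<close> the set of \<open>\<omega>\<close>-entries is constant, so the finite entries of a node
    are the actual counter values and only the \<open>\<omega>\<close>-entries need credit.\<close>
  have no_energy: "\<nexists>X. X \<noteq> {} \<and> energy_closed own ?s ?t z d E0 X"
  proof
    assume "\<exists>X. X \<noteq> {} \<and> energy_closed own ?s ?t z d E0 X"
    then obtain X where X: "X \<noteq> {}" "energy_closed own ?s ?t z d E0 X" by blast
    have XM: "m \<in> M \<and> pfst m \<noteq> qF" if "(m, n) \<in> X" for m n
      using energy_closed_ex[OF X(2) that] by (auto simp: E0_def E1_def tri_def)
    \<comment> \<open>Player 1 may also move to nodes outside \<open>M\<close>. All these moves lose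
      and there are finitely many, so one bound \<open>K\<close> covers the rest of the play after
      any of them.\<close>
    define S where "S = {(m, t). m \<in> M \<and> pfst m \<in> Q1 \<and> t \<in> T \<and> src t = pfst m \<and> \<delta> m t \<notin> M}"
    have "S \<subseteq> M \<times> T" by (auto simp: S_def)
    then have "finite S" using Mfin finite_T by (meson finite_SigmaI finite_subset)
    from Lose_uniform[OF this, of b "\<lambda>(m, t). dst t" "\<lambda>(m, t). fn (psnd m)"] player_lose
    obtain K where K: "b \<longrightarrow> K = 0" "\<And>m t. (m, t) \<in> S \<Longrightarrow> few_visits (dst t) (fn (psnd m)) K"
      by (auto simp: S_def)
    define cr where "cr m n j = (if \<beta> \<le> fn (psnd m) j then \<beta> + n j else fn (psnd m) j)"
      for m j and n :: "nat \<Rightarrow> nat"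
    \<comment> \<open>The bound stays at \<open>K\<close> because the nodes of \<open>X\<close> are
      not at the target; visits can only occur after Player 1 has left \<open>M\<close>.\<close>
    define Y where "Y q v k \<longleftrightarrow> k = K \<and> (\<exists>m n. (m, n) \<in> X \<and> q = pfst m \<and> (\<forall>j<d. v j = cr m n j))" for q v k
    have YU: "few_visits q v k" if "Y q v k" for q v k
      using that
    proof (rule few_visits_coinduct[where X = Y])
      fix q v k assume "Y q v k"
      then obtain m n where mn: "k = K" "(m, n) \<in> X" "q = pfst m" "\<forall>j<d. v j = cr m n j"
        unfolding Y_def by blast
      have m: "m \<in> M" "pfst m \<noteq> qF" using XM[OF mn(2)] by auto
      have mMAX: "fn (psnd m) j \<le> v j" if "j < d" for j
        using that mn(4) M_D[OF m(1)] by (auto simp: cr_def intro: trans_le_add1)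
      have "Y (dst t) v k \<or> few_visits (dst t) v k" if t: "q \<in> Q1" "t \<in> T" "src t = q" for t
      proof (cases "\<delta> m t \<in> M")
        case True
        have "tri m t \<in> E0" using player_E0[OF m _ t(2) _ True] t mn(3) by simp
        from energy_closed_all[OF X(2) mn(2) _ this] obtain n'
          where n': "(\<delta> m t, n') \<in> X" "\<forall>j<d. int (n' j) = int (n j) + z (tri m t) j"
          using t mn(3) by (auto simp: own_def tri_def)
        have "v j = cr (\<delta> m t) n' j" if "j < d" for j
          using n'(2) mn(4) zero_tr[OF m(1) t(2), of j] zero[OF t(2), of j] that t mn(3)
          by (auto simp: cr_def z_def tri_def)
        then show ?thesis unfolding Y_def using n'(1) mn(1) \<delta>(1) by metis
      next
        case False
        then have "few_visits (dst t) (fn (psnd m)) K" using K(2) m t mn(3) by (auto simp: S_def)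
        then have "few_visits (dst t) v k" by (rule few_visits_mono) (use mMAX mn(1) in auto)
        then show ?thesis ..
      qed
      moreover have "\<exists>t\<in>T. src t = q \<and> (\<exists>w. mv t v w \<and> Y (dst t) w k)"
      proof -
        obtain e n' where e: "e \<in> E0" "?s e = m" "(?t e, n') \<in> X" "\<forall>j<d. int (n' j) = int (n j) + z e j"
          using energy_closed_ex[OF X(2) mn(2)] by blast
        obtain t where t: "e = tri m t" "t \<in> T" "src t = pfst m" "enab \<beta> m t" "J m = J (\<delta> m t)"
          using e(1,2) unfolding E0_def E1_def by (auto simp: tri_def)
        have "cr (\<delta> m t) n' j + ng t j = v j + ps t j" if j: "j < d" for j
        proof (cases "j \<in> J m")
          case True
          then have "\<beta> \<le> fn (psnd m) j" "\<beta> \<le> fn (psnd (\<delta> m t)) j" using t(5) by (auto simp: J_def)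
          moreover have "int (n' j) = int (n j) + int (ps t j) - int (ng t j)"
            using e(4) j by (simp add: z_def t(1) tri_def)
          ultimately show ?thesis using mn(4) j by (simp add: cr_def)
        next
          case False
          then have lt: "\<not> \<beta> \<le> fn (psnd m) j" "\<not> \<beta> \<le> fn (psnd (\<delta> m t)) j"
            using t(5) j by (auto simp: J_def)
          then show ?thesis using t(4) mn(4) j unfolding cr_def \<delta>(2)[OF j] tr_def enab_def
            by (auto simp: min_def split: if_splits)
        qed
        then have "mv t v (cr (\<delta> m t) n')" by (simp add: mv_def)
        moreover have "(\<delta> m t, n') \<in> X" using e(3) by (simp add: t(1) tri_def)
        then have "Y (dst t) (cr (\<delta> m t) n') k" unfolding Y_def using mn(1) \<delta>(1) by metis
        ultimately show ?thesis using t(2,3) unfolding mn(3) by blast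
      qed
      ultimately show "(q = qF \<longrightarrow> k > 0) \<and>
        (q \<in> Q1 \<longrightarrow> (\<forall>t\<in>T. src t = q \<longrightarrow>
          Y (dst t) v (k - of_bool (q = qF)) \<or> few_visits (dst t) v (k - of_bool (q = qF)))) \<and>
        (q \<notin> Q1 \<longrightarrow> (\<exists>t\<in>T. src t = q \<and> (\<exists>w. mv t v w \<and> Y (dst t) w (k - of_bool (q = qF)))))"
        using m(2) mn(3) by simp
    qed
    obtain m n where mn: "(m, n) \<in> X" using X(1) by auto
    have "Y (pfst m) (cr m n) K" unfolding Y_def using mn by blast
    from YU[OF this] have "Lose b (pfst m) (cr m n)" unfolding Lose_def using K(1) by blast
    \<comment> \<open>Truncation removes the credit and returns the entries of the node, which is
      winning by membership in \<open>M\<close>.\<close>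
    then have "Lose b (pfst m) (\<lambda>j. min \<beta> (cr m n j))" using \<beta> M_D XM[OF mn] by blast
    moreover have "Lose b (pfst m) (\<lambda>j. min \<beta> (cr m n j)) \<longleftrightarrow> Lose b (pfst m) (fn (psnd m))"
      using M_D XM[OF mn] by (intro Lose_cong) (auto simp: cr_def min_def intro: le_antisym)
    ultimately show False using M_D XM[OF mn] by blast
  qed
  have "finite E0" using E1fin by (simp add: E0_def)
  from energy_memoryless[OF this no_energy] obtain E' where E': "E' \<subseteq> E0"
    "\<And>e. e \<in> E0 \<Longrightarrow> \<exists>e'\<in>E'. pfst e' = pfst e" "\<And>e. e \<in> E0 \<Longrightarrow> \<not> own (pfst e) \<Longrightarrow> e \<in> E'"
    "\<not> nonneg_cycle ?s ?t z d E'" by blast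
  \<comment> \<open>Only opponent moves can enlarge the set of \<open>\<omega>\<close>-entries. The
    energy game left these edges out, but a certificate must answer every enabled opponent
    move.\<close>
  define E where "E = E' \<union> {e \<in> E1. \<not> own (pfst e)}"
  have EE1: "E \<subseteq> E1" using E'(1) unfolding E_def E0_def by blast
  have Efin: "finite E" using E1fin EE1 finite_subset by blast
  \<comment> \<open>\<open>\<omega>\<close>-entries are never lost, so every cycle runs within \<open>E0\<close>.\<close>
  have no_cycle: "\<not> nonneg_cycle ?s ?t z d E"
  proof
    assume "nonneg_cycle ?s ?t z d E"
    then obtain u es where es: "es \<noteq> []" "set es \<subseteq> E" "path ?s ?t u es u" "\<forall>j<d. (\<Sum>e\<leftarrow>es. z e j) \<ge> 0"
      unfolding nonneg_cycle_def by blast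
    have "J (?s e) = J (?t e)" if "e \<in> set es" for e
      using path_mono[OF es(3), of J] E1_J es(2) EE1 that by blast
    then have "set es \<subseteq> E'" using es(2) EE1 E'(3) unfolding E_def E0_def by blast
    then show False using E'(4) es unfolding nonneg_cycle_def by blast
  qed
  have "\<exists>y p. ranking C y p" if C: "C \<subseteq> E" "C \<noteq> {}" for C
  proof -
    have Cfin: "finite C" using C(1) Efin finite_subset by blast
    have "\<not> nonneg_cycle ?s ?t z d C" using no_cycle nonneg_cycle_mono C(1) by blast
    from no_nonneg_cycle_ranking[OF Cfin C(2) this] obtain y :: "nat \<Rightarrow> nat \<Rightarrow> nat" and p :: "nat \<Rightarrow>
        nat" where
      yp: "\<forall>e\<in>C. (\<forall>j<d. y (?s e) j = y (?t e) j) \<and>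
        (\<Sum>j<d. int (y (?s e) j) * z e j) + int (p (?t e)) \<le> int (p (?s e))"
        "\<exists>e\<in>C. (\<Sum>j<d. int (y (?s e) j) * z e j) + int (p (?t e)) < int (p (?s e))" by blast
    define V where "V = ?s ` C \<union> ?t ` C"
    have Vfin: "finite V" using Cfin by (simp add: V_def)
    \<comment> \<open>A bound above every argument at which the two functions are consulted: the
      nodes for \<open>p\<close>, the pairs of node and counter for \<open>y\<close>.\<close>
    define B where "B = Suc ((\<Sum>v\<in>V. v) + (\<Sum>(v, j)\<in>V \<times> {..<d}. pair v j))"
    have B1: "v < B" if "v \<in> V" for v
      using member_le_sum[of v V "\<lambda>v. v"] Vfin that by (simp add: B_def)
    have B2: "pair v j < B" if "v \<in> V" "j < d" for v j
      using member_le_sum[of "(v, j)" "V \<times> {..<d}" "\<lambda>(v, j). pair v j"] Vfin that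
      by (simp add: B_def)
    obtain cp where cp: "\<forall>i<B. fn cp i = p i" using fn_exists[of B p] by blast
    obtain cy where cy: "\<forall>i<B. fn cy i = y (pfst i) (psnd i)"
      using fn_exists[of B "\<lambda>i. y (pfst i) (psnd i)"] by blast
    have fcy: "fn cy (pair v j) = y v j" if "v \<in> V" "j < d" for v j using cy B2[OF that] by simp
    have fcp: "fn cp v = p v" if "v \<in> V" for v using cp B1[OF that] by simp
    have V: "?s e \<in> V" "?t e \<in> V" if "e \<in> C" for e using that by (auto simp: V_def)
    have sums: "(\<Sum>j<d. fn cy (pair (?s e) j) * f j) = (\<Sum>j<d. y (?s e) j * f j)" if "e \<in> C" for e f
      using fcy V[OF that] by (intro sum.cong) auto
    have split: "(\<Sum>j<d. int (y (?s e) j) * z e j) =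
      int (\<Sum>j<d. y (?s e) j * ps (pfst (psnd e)) j) - int (\<Sum>j<d. y (?s e) j * ng (pfst (psnd e))
          j)" for e
      by (simp add: z_def right_diff_distrib sum_subtractf)
    have "ranking C cy cp" unfolding ranking_def
    proof (intro conjI ballI)
      fix e assume e: "e \<in> C"
      have "\<forall>j<d. y (?s e) j = y (?t e) j" using yp(1) e by blast
      then show "\<forall>j<d. fn cy (pair (?s e) j) = fn cy (pair (?t e) j)" using fcy V[OF e] by simp
      show "(\<Sum>j<d. fn cy (pair (?s e) j) * ps (pfst (psnd e)) j) + fn cp (?t e)
       \<le> (\<Sum>j<d. fn cy (pair (?s e) j) * ng (pfst (psnd e)) j) + fn cp (?s e)"
        using yp(1)[rule_format, OF e] unfolding sums[OF e] split fcp[OF V(1)[OF e]] fcp[OF V(2)[OF e]]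
        by linarith
    next
      obtain e where e: "e \<in> C" "(\<Sum>j<d. int (y (?s e) j) * z e j) + int (p (?t e)) < int (p (?s e))"
        using yp(2) by blast
      then have "(\<Sum>j<d. fn cy (pair (?s e) j) * ps (pfst (psnd e)) j) + fn cp (?t e)
       < (\<Sum>j<d. fn cy (pair (?s e) j) * ng (pfst (psnd e)) j) + fn cp (?s e)"
        unfolding sums[OF e(1)] split fcp[OF V(1)[OF e(1)]] fcp[OF V(2)[OF e(1)]] by linarith
      then show "\<exists>e\<in>C. (\<Sum>j<d. fn cy (pair (?s e) j) * ps (pfst (psnd e)) j) + fn cp (?t e)
       < (\<Sum>j<d. fn cy (pair (?s e) j) * ng (pfst (psnd e)) j) + fn cp (?s e)" using e(1) by blast
    qed
    then show ?thesis by blast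
  qed
  moreover have "\<exists>t\<in>T. src t = pfst m \<and> (\<exists>m'. good_succ \<beta> M E m t m')"
    if m: "m \<in> M" "b \<longrightarrow> pfst m \<noteq> qF" "pfst m \<in> Q1" for m
  proof -
    obtain t where t: "t \<in> T" "src t = pfst m" "\<delta> m t \<in> M" using player[OF m] by blast
    show ?thesis
    proof (cases "pfst m = qF")
      case True
      then show ?thesis using t cov[OF zero_enab[OF t(1,2) m(3)]] unfolding good_succ_def by blast
    next
      case False
      then have "tri m t \<in> E0" using player_E0 m t by blast
      then obtain e where e: "e \<in> E'" "pfst e = m" using E'(2) by (force simp: tri_def)
      then obtain t' where t': "e = tri m t'" "t' \<in> T" "src t' = pfst m" "\<delta> m t' \<in> M"
        using E'(1) unfolding E0_def E1_def by (auto simp: tri_def)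
      have "good_succ \<beta> M E m t' (\<delta> m t')"
        using cov[OF zero_enab[OF t'(2,3) m(3)]] t'(4) e(1)
        unfolding good_succ_def E_def t'(1) tri_def by blast
      with t' show ?thesis by blast
    qed
  qed
  moreover have "\<exists>m'. good_succ \<beta> M E m t m'"
    if m: "m \<in> M" "b \<longrightarrow> pfst m \<noteq> qF" "pfst m \<notin> Q1" "t \<in> T" "src t = pfst m" "enab \<beta> m t" for m t
  proof -
    have "\<delta> m t \<in> M" by (rule opp[OF m])
    moreover have "tri m t \<in> E" if "pfst m \<noteq> qF"
    proof -
      have "tri m t \<in> E1" unfolding E1_def using m that calculation by blast
      then show ?thesis using m(3) by (simp add: E_def own_def tri_def)
    qed
    ultimately show ?thesis using cov[OF m(6)] unfolding good_succ_def tri_def by blast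
  qed
  moreover have "\<exists>m\<in>M. pfst m = q0 \<and> (\<forall>j<d. \<beta> \<le> fn (psnd m) j \<or> v0 j \<le> fn (psnd m) j)"
  proof -
    have "\<not> Lose b q0 (\<lambda>j. min \<beta> (v0 j))" using win(1) Lose_mono[of b q0 "\<lambda>j. min \<beta> (v0 j)" v0] by auto
    then have "enc q0 (\<lambda>j. min \<beta> (v0 j)) \<in> M" using win(2) by (intro M_I) auto
    then show ?thesis by (intro bexI[of _ "enc q0 (\<lambda>j. min \<beta> (v0 j))"]) (auto simp: enc)
  qed
  ultimately have "yes_cert b q0 v0 \<beta> M E" unfolding yes_cert_def by blast
  with Mfin Efin show ?thesis by blast
qed

end

section \<open>Decidability for P-VASS-MDPs\<close>

text \<open>\<open>int_encode\<close> sends a natural number \<open>n\<close> to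
  \<open>2 * n\<close> and \<open>- 1 - n\<close> to \<open>2 * n + 1\<close>, whence the parity
  test and the \<open>Suc\<close> in the negative part.\<close>

definition ipos :: "nat \<Rightarrow> nat" where "ipos c = (if even c then c div 2 else 0)"
definition ineg :: "nat \<Rightarrow> nat" where "ineg c = (if even c then 0 else Suc (c div 2))"

lemma ipos_ineg: "int (ipos (int_encode i)) - int (ineg (int_encode i)) = i"
  by (auto simp: ipos_def ineg_def int_encode_def sum_encode_def)

definition t_src :: "nat \<Rightarrow> nat" where "t_src t = fn t 0"
definition t_dst :: "nat \<Rightarrow> nat" where "t_dst t = fn t 2"
definition t_ps :: "nat \<Rightarrow> nat \<Rightarrow> nat" where "t_ps t j = ipos (fn (fn t 1) j)"
definition t_ng :: "nat \<Rightarrow> nat \<Rightarrow> nat" where "t_ng t j = ineg (fn (fn t 1) j)"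

text \<open>Only \<open>vgame_data\<close>, which has no assumptions, is instantiated here, so the
  predicate makes sense for every number, whether or not it codes an instance.\<close>

definition yes_code :: "bool \<Rightarrow> nat \<Rightarrow> bool" where
  "yes_code b x \<longleftrightarrow> (\<exists>\<beta> mc ec. vgame_data.yes_cert (fn (fn x 0) 0) (set_decode (fn (fn x 0) 2))
     (set_decode (fn (fn x 0) 4)) t_src t_dst t_ps t_ng (fn x 3) b (fn x 1) (fn (fn x 2)) \<beta>
     (set_decode mc) (set_decode ec))"

definition no_code :: "bool \<Rightarrow> nat \<Rightarrow> bool" where
  "no_code b x \<longleftrightarrow> (\<exists>nc. vgame_data.no_cert (fn (fn x 0) 0) (set_decode (fn (fn x 0) 2))
     (set_decode (fn (fn x 0) 4)) t_src t_dst t_ps t_ng (fn x 3) b (fn x 1) (fn (fn x 2))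
         (set_decode nc))"

lemma semidecidable_no_code: "semidecidable (no_code b)"
proof -
  have "semidecidable (\<lambda>x. no_code b x)"
    unfolding no_code_def vgame_data.no_cert_def vgame_data.no_move_def t_src_def t_dst_def
      t_ps_def t_ng_def ipos_def ineg_def
    by (rule semidecidable_ex, rule semidecidable_of_decidable) (intro decidable_intros
        computable_intros)
  then show ?thesis .
qed

lemma semidecidable_yes_code: "semidecidable (yes_code b)"
proof -
  have "semidecidable (\<lambda>x. yes_code b x)"
    unfolding yes_code_def vgame_data.yes_cert_def vgame_data.covers_def vgame_data.enab_def
      vgame_data.good_succ_def vgame_data.ranking_def t_src_def t_dst_def t_ps_def t_ng_def
      ipos_def ineg_def
    by (intro semidecidable_ex semidecidable_conj semidecidable_bex_set_decode
        semidecidable_ball_set_decode semidecidable_imp semidecidable_all_subsets;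
        (rule semidecidable_of_decidable)?; intro decidable_intros computable_intros)
  then show ?thesis .
qed

locale pvass_instance =
  fixes S :: "nat vass" and q0 :: nat and v0 :: "nat list" and qF :: nat
  assumes inst: "(S, (q0, v0), qF) \<in> deadlock_free_P_instances"
begin

abbreviation "TC \<equiv> transition_code S ` transitions S"
abbreviation "M \<equiv> induced_mdp S"

lemma wf: "vass_mdp S" and P: "P_vass_mdp S" and live: "deadlock_free S"
  and q0: "q0 \<in> states S" and v0: "length v0 = vdim S"
  using inst by (auto simp: deadlock_free_P_instances_def P_vass_mdp_def induced_mdp_def vectors_def)

lemma transitionD:
  assumes "(q, z, q') \<in> transitions S"
  shows "q \<in> states S" "q' \<in> states S" "length z = vdim S"
  using assms wf unfolding vass_mdp_def by auto

lemma code_simps: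
  "t_src (transition_code S (q, z, q')) = q" "t_dst (transition_code S (q, z, q')) = q'"
  "j < length z \<Longrightarrow> t_ps (transition_code S (q, z, q')) j = ipos (int_encode (z ! j))"
  "j < length z \<Longrightarrow> t_ng (transition_code S (q, z, q')) j = ineg (int_encode (z ! j))"
  by (simp_all add: t_src_def t_dst_def t_ps_def t_ng_def fn_list_encode del: list_encode.simps)

sublocale vgame "vdim S" "states1 S" TC t_src t_dst t_ps t_ng qF "states S"
proof
  show "finite (states S)" "finite TC" using vass_mdp_finite[OF wf] by auto
  show "t_dst t \<in> states S" if "t \<in> TC" for t
    using that transitionD(2) by (auto simp: code_simps simp del: transition_code.simps)
  show "t_ps t j = t_ng t j" if t: "t \<in> TC" "t_src t \<in> states1 S" "j < vdim S" for t j
  proof -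
    obtain q z q' where tr: "t = transition_code S (q, z, q')" "(q, z, q') \<in> transitions S"
      using t(1) by (metis imageE prod_cases3)
    then have "q \<in> states1 S" using t(2) by (simp add: code_simps del: transition_code.simps)
    then have "z = replicate (vdim S) 0" using P tr(2) unfolding P_vass_mdp_def by auto
    then show ?thesis unfolding tr(1) using t(3)
      by (simp add: code_simps ipos_def ineg_def int_encode_def sum_encode_def del:
          transition_code.simps)
  qed
qed

section \<open>Steps of the induced MDP as moves of the game\<close>

lemma mv_iff:
  assumes "length z = vdim S"
  shows "mv (transition_code S (q, z, q')) v v' \<longleftrightarrow> (\<forall>j<vdim S. int (v' j) = int (v j) + z ! j)"
proof -
  have "v' j + t_ng (transition_code S (q, z, q')) j = v j + t_ps (transition_code S (q, z, q')) j \<longleftrightarrow>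
    int (v' j) = int (v j) + z ! j" if "j < vdim S" for j
    using that assms ipos_ineg[of "z ! j"] by (simp add: code_simps del: transition_code.simps) linarith
  then show ?thesis unfolding mv_def by blast
qed

lemma stepD:
  assumes "step M c c'"
  shows "c \<in> confs M" "c' \<in> confs M"
    "\<exists>t\<in>TC. t_src t = fst c \<and> t_dst t = fst c' \<and> mv t (nth (snd c)) (nth (snd c'))"
proof -
  obtain q v where c: "c = (q, v)" by fastforce
  obtain p z p' where t: "(p, z, p') \<in> transitions S" "enabled (p, z, p') c" "c' = fire (p, z, p') c"
    and cM: "c \<in> states S \<times> vectors (vdim S)"
    using assms by (auto simp: induced_mdp_def)
  have len: "length v = vdim S" "length z = vdim S" using cM c transitionD(3)[OF t(1)] by (auto
      simp: vectors_def)
  have en: "q = p" "\<And>j. j < vdim S \<Longrightarrow> int (v ! j) + z ! j \<ge> 0"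
    using t(2) c len by (auto simp: list_all2_conv_all_nth)
  have c': "c' = (p', map2 (\<lambda>a x. nat (int a + x)) v z)" using t(3) c by simp
  show "c \<in> confs M" using cM by (simp add: induced_mdp_def)
  show "c' \<in> confs M" using c' len transitionD(2)[OF t(1)] by (simp add: induced_mdp_def vectors_def)
  have "mv (transition_code S (p, z, p')) (nth v) (nth (snd c'))"
    unfolding mv_iff[OF len(2)] using en(2) len by (simp add: c')
  then show "\<exists>t\<in>TC. t_src t = fst c \<and> t_dst t = fst c' \<and> mv t (nth (snd c)) (nth (snd c'))"
    using t(1) c c' en(1) by (intro bexI[of _ "transition_code S (p, z, p')"])
      (auto simp: code_simps simp del: transition_code.simps)
qed

lemma stepI:
  assumes "t \<in> TC" "c \<in> confs M" "t_src t = fst c" "mv t (nth (snd c)) w"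
  shows "step M c (t_dst t, map w [0..<vdim S])"
proof -
  obtain q v where c: "c = (q, v)" by fastforce
  obtain p z p' where t: "t = transition_code S (p, z, p')" "(p, z, p') \<in> transitions S"
    using assms(1) by (metis imageE prod_cases3)
  have len: "length z = vdim S" "length v = vdim S"
    using transitionD(3)[OF t(2)] assms(2) c by (auto simp: induced_mdp_def vectors_def)
  have w: "\<And>j. j < vdim S \<Longrightarrow> int (w j) = int (v ! j) + z ! j"
    using assms(4) c unfolding t(1) mv_iff[OF len(1)] by simp
  have p: "p = q" using assms(3) c by (simp add: t(1) code_simps del: transition_code.simps)
  have "enabled (p, z, p') c"
    using w len p c by (auto simp: list_all2_conv_all_nth) (metis of_nat_0_le_iff)
  moreover have "(t_dst t, map w [0..<vdim S]) = fire (p, z, p') c"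
    using w len by (auto simp: c t(1) code_simps simp del: transition_code.simps intro!: nth_equalityI)
      (metis nat_int)
  ultimately show ?thesis using t(2) assms(2) by (auto simp: induced_mdp_def)
qed

section \<open>Soundness of the certificates\<close>

lemma no_deadlock: "\<not> deadlock M c"
  using live unfolding deadlock_free_def by blast

lemma confs1_iff: "c \<in> confs M \<Longrightarrow> c \<in> confs1 M \<longleftrightarrow> fst c \<in> states1 S"
  by (cases c) (auto simp: induced_mdp_def)

text \<open>Player 1 follows nodes of the certificate along the play. If the play failed, its nodes
  would from some point on form an infinite path in \<open>E\<close>, which
  \<open>ranking_no_infinite_path\<close> excludes.\<close>

lemma yes_cert_sound:
  assumes cert: "yes_cert b q0 (nth v0) \<beta> Mx E" and fin: "finite Mx"
  shows "\<exists>\<sigma>. strategy M \<sigma> \<and> (\<forall>\<pi>\<in>Outcome M (q0, v0) \<sigma>. \<exists>\<rho>. \<pi> = Inf \<rho> \<and>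
    ((\<exists>i. b \<and> fst (\<rho> i) = qF) \<or> infinite {i. fst (\<rho> i) = qF}))"
proof -
  define R where "R m c c' m' \<longleftrightarrow> step M c c' \<and> (\<exists>t\<in>TC. mv t (nth (snd c)) (nth (snd c')) \<and>
    t_dst t = fst c' \<and> good_succ \<beta> Mx E m t m')" for m m' and c c' :: "nat config"
  define inv where "inv m c \<longleftrightarrow> m \<in> Mx \<and> pfst m = fst c \<and> c \<in> confs M \<and>
    (\<forall>j<vdim S. \<beta> \<le> fn (psnd m) j \<or> snd c ! j \<le> fn (psnd m) j)" for m and c :: "nat config"
  obtain m0 where m0: "m0 \<in> Mx" "pfst m0 = q0" "\<forall>j<vdim S. \<beta> \<le> fn (psnd m0) j \<or> v0 ! j \<le> fn (psnd m0) j"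
    using cert unfolding yes_cert_def by blast
  have succs: "pfst m \<in> states1 S \<Longrightarrow> \<exists>t\<in>TC. t_src t = pfst m \<and> (\<exists>m'. good_succ \<beta> Mx E m t m')"
    "\<And>t. pfst m \<notin> states1 S \<Longrightarrow> t \<in> TC \<Longrightarrow> t_src t = pfst m \<Longrightarrow> enab \<beta> m t \<Longrightarrow> \<exists>m'. good_succ \<beta> Mx E m t m'"
    if "m \<in> Mx" "b \<longrightarrow> pfst m \<noteq> qF" for m
    using cert that unfolding yes_cert_def by blast+
  have inv0: "inv m0 (q0, v0)"
    using m0 q0 v0 by (simp add: inv_def induced_mdp_def vectors_def)
  have inv_step: "inv m' c'" if m: "inv m c" "R m c c' m'" for m c c' m'
  proof -
    obtain t where t: "mv t (nth (snd c)) (nth (snd c'))" "t_dst t = fst c'" "good_succ \<beta> Mx E m t m'"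
      using m(2) unfolding R_def by blast
    have "\<beta> \<le> fn (psnd m') j \<or> snd c' ! j \<le> fn (psnd m') j" if j: "j < vdim S" for j
    proof -
      have "\<beta> \<le> fn (psnd m) j \<or> snd c ! j \<le> fn (psnd m) j" using m(1) j by (simp add: inv_def)
      moreover have "snd c' ! j + t_ng t j = snd c ! j + t_ps t j" using t(1) j by (simp add: mv_def)
      moreover have "\<beta> \<le> fn (psnd m') j \<or> (fn (psnd m) j < \<beta> \<and>
          fn (psnd m) j + t_ps t j \<le> fn (psnd m') j + t_ng t j)"
        using t(3) j by (simp add: good_succ_def covers_def)
      ultimately show ?thesis by linarith
    qed
    moreover have "c' \<in> confs M" using m(2) stepD(2) unfolding R_def by blast
    ultimately show ?thesis using t(2,3) by (simp add: inv_def good_succ_def covers_def)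
  qed
  have player: "\<exists>c' m'. R m c c' m'" if m: "inv m c" "b \<longrightarrow> fst c \<noteq> qF" "fst c \<in> states1 S" for m c
  proof -
    obtain t m' where t: "t \<in> TC" "t_src t = pfst m" "good_succ \<beta> Mx E m t m'"
      using succs(1)[of m] m unfolding inv_def by auto
    have mvt: "mv t (nth (snd c)) (nth (snd c))"
      using zero[OF t(1)] t(2) m unfolding mv_def inv_def by auto
    have "step M c (t_dst t, map (nth (snd c)) [0..<vdim S])"
      by (rule stepI[OF t(1)]) (use m t mvt in \<open>auto simp: inv_def\<close>)
    moreover have "mv t (nth (snd c)) (nth (map (nth (snd c)) [0..<vdim S]))"
      using mvt by (simp add: mv_def)
    ultimately show ?thesis unfolding R_def using t by (metis fst_conv snd_conv)
  qed
  have opp: "\<exists>m'. R m c c' m'" if m: "inv m c" "b \<longrightarrow> fst c \<noteq> qF" "fst c \<notin> states1 S" "step M c c'"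
      for m c c'
  proof -
    obtain t where t: "t \<in> TC" "t_src t = fst c" "t_dst t = fst c'" "mv t (nth (snd c)) (nth (snd c'))"
      using stepD(3)[OF m(4)] by blast
    have "enab \<beta> m t" unfolding enab_def
    proof (intro allI impI)
      fix j assume j: "j < vdim S"
      have "\<beta> \<le> fn (psnd m) j \<or> snd c ! j \<le> fn (psnd m) j" using m(1) j by (simp add: inv_def)
      moreover have "snd c' ! j + t_ng t j = snd c ! j + t_ps t j" using t(4) j by (simp add: mv_def)
      ultimately show "\<beta> \<le> fn (psnd m) j \<or> t_ng t j \<le> fn (psnd m) j + t_ps t j" by linarith
    qed
    then obtain m' where "good_succ \<beta> Mx E m t m'"
      using succs(2)[of m t] m t(1,2) unfolding inv_def by auto
    then show ?thesis unfolding R_def using t m(4) by blast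
  qed
  \<comment> \<open>The node depends on the prefix of the play only (\<open>\<mu>_cong\<close>), so
    a strategy that sees the history and the analysis of the whole play compute the same
    one.\<close>
  define \<mu> where "\<mu> \<rho> = rec_nat m0 (\<lambda>i m. SOME m'. R m (\<rho> i) (\<rho> (Suc i)) m')" for \<rho> :: "nat \<Rightarrow> nat config"
  have \<mu>: "\<mu> \<rho> 0 = m0" "\<mu> \<rho> (Suc i) = (SOME m'. R (\<mu> \<rho> i) (\<rho> i) (\<rho> (Suc i)) m')" for \<rho> i
    by (simp_all add: \<mu>_def)
  have \<mu>_cong: "\<mu> \<rho> n = \<mu> \<rho>' n" if "\<And>i. i \<le> n \<Longrightarrow> \<rho> i = \<rho>' i" for \<rho> \<rho>' n
    using that by (induction n) (simp_all add: \<mu>)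
  \<comment> \<open>The arbitrary step in the second branch makes \<open>\<sigma>\<close> a strategy
    on histories that the certificate need not cover, such as those past the target of a
    reachability game.\<close>
  define \<sigma> where "\<sigma> cs = (let m = \<mu> (nth cs) (length cs - 1) in
    if \<exists>c' m'. R m (last cs) c' m' then SOME c'. \<exists>m'. R m (last cs) c' m' else SOME c'. step M
        (last cs) c')" for cs
  have \<sigma>_R: "\<exists>m'. R (\<mu> (nth cs) (length cs - 1)) (last cs) (\<sigma> cs) m'"
    if "\<exists>c' m'. R (\<mu> (nth cs) (length cs - 1)) (last cs) c' m'" for cs
    using someI_ex[OF that] that by (simp add: \<sigma>_def)
  have "strategy M \<sigma>" unfolding strategy_def
  proof (intro allI impI)
    fix cs assume cs: "finite_play M cs \<and> last cs \<in> confs1 M \<and> \<not> deadlock M (last cs)"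
    show "step M (last cs) (\<sigma> cs)"
    proof (cases "\<exists>c' m'. R (\<mu> (nth cs) (length cs - 1)) (last cs) c' m'")
      case True
      from \<sigma>_R[OF this] show ?thesis unfolding R_def by blast
    next
      case False
      have "last cs \<in> confs M" using cs by (auto simp: finite_play_def)
      then have "\<exists>c'. step M (last cs) c'" using cs by (auto simp: deadlock_def)
      then have "step M (last cs) (SOME c'. step M (last cs) c')" by (rule someI_ex)
      then show ?thesis unfolding \<sigma>_def Let_def if_not_P[OF False] .
    qed
  qed
  moreover have "\<exists>\<rho>. \<pi> = Inf \<rho> \<and> ((\<exists>i. b \<and> fst (\<rho> i) = qF) \<or> infinite {i. fst (\<rho> i) = qF})"
    if \<pi>: "\<pi> \<in> Outcome M (q0, v0) \<sigma>" for \<pi>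
  proof (cases \<pi>)
    case (Fin cs)
    then show ?thesis using \<pi> no_deadlock by (simp add: Outcome_def)
  next
    case (Inf \<rho>)
    have \<rho>: "\<And>i. step M (\<rho> i) (\<rho> (Suc i))" "\<rho> 0 = (q0, v0)" "\<And>i. \<rho> i \<in> confs M"
      "\<And>i. \<rho> i \<in> confs1 M \<Longrightarrow> \<rho> (Suc i) = \<sigma> (map \<rho> [0..<Suc i])"
      using \<pi> Inf by (auto simp: Outcome_def)
    have "\<not> ((\<forall>i. b \<longrightarrow> fst (\<rho> i) \<noteq> qF) \<and> finite {i. fst (\<rho> i) = qF})"
    proof
      assume *: "(\<forall>i. b \<longrightarrow> fst (\<rho> i) \<noteq> qF) \<and> finite {i. fst (\<rho> i) = qF}"
      obtain i0 where i0: "\<And>i. i \<ge> i0 \<Longrightarrow> fst (\<rho> i) \<noteq> qF"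
        using * finite_nat_set_iff_bounded[of "{i. fst (\<rho> i) = qF}"] by (auto simp: not_le[symmetric])
      have R_next: "R (\<mu> \<rho> i) (\<rho> i) (\<rho> (Suc i)) (\<mu> \<rho> (Suc i))" if iv: "inv (\<mu> \<rho> i) (\<rho> i)" for i
      proof -
        have "\<exists>m'. R (\<mu> \<rho> i) (\<rho> i) (\<rho> (Suc i)) m'"
        proof (cases "fst (\<rho> i) \<in> states1 S")
          case True
          let ?cs = "map \<rho> [0..<Suc i]"
          have "\<mu> (nth ?cs) i = \<mu> \<rho> i" by (rule \<mu>_cong) (simp del: upt_Suc)
          moreover have "last ?cs = \<rho> i" "length ?cs - 1 = i" by simp_all
          moreover have "\<exists>c' m'. R (\<mu> \<rho> i) (\<rho> i) c' m'" using player[OF iv _ True] * by blast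
          ultimately have "\<exists>m'. R (\<mu> \<rho> i) (\<rho> i) (\<sigma> ?cs) m'" using \<sigma>_R[of ?cs] by simp
          then show ?thesis using \<rho>(4)[of i] confs1_iff[OF \<rho>(3)[of i]] True by simp
        next
          case False
          then show ?thesis using opp[OF iv _ False \<rho>(1)] * by blast
        qed
        then show ?thesis unfolding \<mu>(2) by (rule someI_ex)
      qed
      have iv: "inv (\<mu> \<rho> i) (\<rho> i)" for i
      proof (induction i)
        case 0
        show ?case using inv0 by (simp add: \<mu> \<rho>)
      next
        case (Suc i)
        from inv_step[OF Suc R_next[OF Suc]] show ?case .
      qed
      have "\<forall>i. \<exists>t. mv t (nth (snd (\<rho> i))) (nth (snd (\<rho> (Suc i)))) \<and> good_succ \<beta> Mx E (\<mu> \<rho> i) t (\<mu>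
          \<rho> (Suc i))"
        using R_next[OF iv] unfolding R_def by blast
      then obtain t where t: "\<And>i. mv (t i) (nth (snd (\<rho> i))) (nth (snd (\<rho> (Suc i))))"
        "\<And>i. good_succ \<beta> Mx E (\<mu> \<rho> i) (t i) (\<mu> \<rho> (Suc i))" by metis
      show False
      proof (rule ranking_no_infinite_path[OF fin, of "\<lambda>i. \<mu> \<rho> (i0 + i)" "\<lambda>i. t (i0 + i)" E
            "\<lambda>i. nth (snd (\<rho> (i0 + i)))"])
        show "\<mu> \<rho> (i0 + i) \<in> Mx" for i using iv unfolding inv_def by blast
        have "pfst (\<mu> \<rho> (i0 + i)) \<noteq> qF" for i using iv[of "i0 + i"] i0[of "i0 + i"] by (simp add:
            inv_def)
        then show "pair (\<mu> \<rho> (i0 + i)) (pair (t (i0 + i)) (\<mu> \<rho> (i0 + Suc i))) \<in> E" for i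
          using t(2)[of "i0 + i"] by (simp add: good_succ_def)
        show "mv (t (i0 + i)) (nth (snd (\<rho> (i0 + i)))) (nth (snd (\<rho> (i0 + Suc i))))" for i
          using t(1)[of "i0 + i"] by simp
        show "\<exists>y p. ranking C y p" if "C \<subseteq> E" "C \<noteq> {}" for C
          using cert that unfolding yes_cert_def by blast
      qed
    qed
    then show ?thesis using Inf by blast
  qed
  ultimately show ?thesis by blast
qed

text \<open>A play against \<open>\<sigma>\<close> is built together with an allowance of visits:
  each visit to the target uses up one, and the certificate guarantees that the allowance is
  positive whenever a visit occurs.\<close>

lemma no_cert_sound:
  assumes cert: "no_cert b q0 (nth v0) N" and \<sigma>: "strategy M \<sigma>"
  shows "\<exists>\<rho>. Inf \<rho> \<in> Outcome M (q0, v0) \<sigma> \<and> finite {i. fst (\<rho> i) = qF} \<and> (b \<longrightarrow> (\<forall>i. fst (\<rho> i) \<noteq> qF))"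
proof -
  define inv where "inv c k \<longleftrightarrow> c \<in> confs M \<and> (\<exists>n\<in>N. pfst n = fst c \<and>
    (\<forall>j<vdim S. fn (pfst (psnd n)) j \<le> snd c ! j) \<and> psnd (psnd n) \<le> k)" for c k
  obtain n0 where n0: "n0 \<in> N" "pfst n0 = q0" "\<forall>j<vdim S. fn (pfst (psnd n0)) j \<le> v0 ! j"
    "b \<longrightarrow> psnd (psnd n0) = 0" using cert unfolding no_cert_def by blast
  have cert_player: "no_move N n t"
    if "n \<in> N" "pfst n \<in> states1 S" "t \<in> TC" "t_src t = pfst n" for n t
    using cert that unfolding no_cert_def by blast
  have cert_opponent: "\<exists>t\<in>TC. t_src t = pfst n \<and> no_move N n t"
    if "n \<in> N" "pfst n \<notin> states1 S" for n
    using cert that unfolding no_cert_def by blast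
  define k0 where "k0 = psnd (psnd n0)"
  have inv0: "inv (q0, v0) k0"
    using n0 q0 v0 by (auto simp: inv_def k0_def induced_mdp_def vectors_def)
  have move: "inv c' (k - of_bool (fst c = qF)) \<and> (fst c = qF \<longrightarrow> k > 0)"
    if n: "n \<in> N" "pfst n = fst c" "\<forall>j<vdim S. fn (pfst (psnd n)) j \<le> snd c ! j" "psnd (psnd n) \<le> k"
      "no_move N n t" and t: "mv t (nth (snd c)) (nth (snd c'))" "t_dst t = fst c'" and c': "c' \<in>
          confs M"
    for n c k t c'
  proof -
    obtain n' where n': "n' \<in> N" "pfst n' = t_dst t"
      "\<forall>j<vdim S. fn (pfst (psnd n')) j + t_ng t j \<le> fn (pfst (psnd n)) j + t_ps t j"
      "psnd (psnd n') + (if pfst n = qF then 1 else 0) \<le> psnd (psnd n)"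
      using n(5) unfolding no_move_def by blast
    have "fn (pfst (psnd n')) j \<le> snd c' ! j" if j: "j < vdim S" for j
    proof -
      have "fn (pfst (psnd n)) j \<le> snd c ! j" using n(3) j by blast
      moreover have "snd c' ! j + t_ng t j = snd c ! j + t_ps t j" using t(1) j by (simp add: mv_def)
      moreover have "fn (pfst (psnd n')) j + t_ng t j \<le> fn (pfst (psnd n)) j + t_ps t j" using
          n'(3) j by blast
      ultimately show ?thesis by linarith
    qed
    moreover have "psnd (psnd n') \<le> k - of_bool (fst c = qF)" "fst c = qF \<longrightarrow> k > 0"
      using n'(4) n(2,4) by auto
    ultimately show ?thesis unfolding inv_def using n'(1,2) t(2) c' by auto
  qed
  have next_conf: "\<exists>c'. step M c c' \<and> (c \<in> confs1 M \<longrightarrow> c' = \<sigma> hs) \<and>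
      inv c' (k - of_bool (fst c = qF)) \<and> (fst c = qF \<longrightarrow> k > 0)"
    if hs: "finite_play M hs" "c = last hs" "inv c k" for hs c k
  proof -
    obtain n where n: "n \<in> N" "pfst n = fst c" "\<forall>j<vdim S. fn (pfst (psnd n)) j \<le> snd c ! j"
      "psnd (psnd n) \<le> k" and c: "c \<in> confs M" using hs(3) unfolding inv_def by blast
    show ?thesis
    proof (cases "fst c \<in> states1 S")
      case True
      then have st: "step M c (\<sigma> hs)"
        using \<sigma> hs(1,2) no_deadlock confs1_iff[OF c] unfolding strategy_def by blast
      then obtain t where t: "t \<in> TC" "t_src t = fst c" "t_dst t = fst (\<sigma> hs)"
        "mv t (nth (snd c)) (nth (snd (\<sigma> hs)))" using stepD(3) by blast
      then have "no_move N n t" using cert_player[OF n(1)] n(2) True by simp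
      from move[OF n this t(4,3) stepD(2)[OF st]] st show ?thesis by blast
    next
      case False
      then obtain t where t: "t \<in> TC" "t_src t = pfst n" "no_move N n t"
        using cert_opponent[OF n(1)] n(2) by auto
      define w where "w j = snd c ! j + t_ps t j - t_ng t j" for j
      have w: "mv t (nth (snd c)) w" unfolding mv_def
      proof (intro allI impI)
        fix j assume j: "j < vdim S"
        obtain n' where "fn (pfst (psnd n')) j + t_ng t j \<le> fn (pfst (psnd n)) j + t_ps t j"
          using t(3) j unfolding no_move_def by blast
        moreover have "fn (pfst (psnd n)) j \<le> snd c ! j" using n(3) j by blast
        ultimately show "w j + t_ng t j = snd c ! j + t_ps t j" unfolding w_def by linarith
      qed
      let ?c' = "(t_dst t, map w [0..<vdim S])"
      have st: "step M c ?c'" by (rule stepI[OF t(1) c _ w]) (use t(2) n(2) in simp)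
      have "mv t (nth (snd c)) (nth (snd ?c'))" using w by (simp add: mv_def)
      then have "inv ?c' (k - of_bool (fst c = qF)) \<and> (fst c = qF \<longrightarrow> k > 0)"
        by (rule move[OF n t(3) _ _ stepD(2)[OF st]]) simp
      moreover have "c \<notin> confs1 M" using False confs1_iff[OF c] by simp
      ultimately show ?thesis using st by blast
    qed
  qed
  \<comment> \<open>The whole history is built, not just the current configuration, because
    \<open>\<sigma>\<close> may depend on it.\<close>
  define P where "P n s \<longleftrightarrow> finite_play M (fst s) \<and> length (fst s) = Suc n \<and> hd (fst s) = (q0, v0) \<and>
    inv (last (fst s)) (snd s) \<and> (n = 0 \<longrightarrow> snd s = k0)" for n and s :: "nat config list \<times> nat"
  define Qs where "Qs n s s' \<longleftrightarrow> fst s' = fst s @ [last (fst s')] \<and> step M (last (fst s)) (last (fst s')) \<and>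
    (last (fst s) \<in> confs1 M \<longrightarrow> last (fst s') = \<sigma> (fst s)) \<and>
    snd s' + of_bool (fst (last (fst s)) = qF) = snd s" for n :: nat and s s' :: "nat config list \<times> nat"
  have "\<exists>f. \<forall>n. P n (f n) \<and> Qs n (f n) (f (Suc n))"
  proof (rule dependent_nat_choice)
    have "P 0 ([(q0, v0)], k0)"
      using inv0 by (simp add: P_def finite_play_def inv_def)
    then show "\<exists>s. P 0 s" by blast
  next
    fix s n assume s: "P n s"
    obtain hs k where hk: "s = (hs, k)" by fastforce
    have hs: "finite_play M hs" "length hs = Suc n" "hd hs = (q0, v0)" "inv (last hs) k"
      using s by (auto simp: P_def hk)
    have ne: "hs \<noteq> []" using hs(2) by auto
    from next_conf[OF hs(1) refl hs(4)] obtain c' where c': "step M (last hs) c'"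
      "last hs \<in> confs1 M \<longrightarrow> c' = \<sigma> hs" "inv c' (k - of_bool (fst (last hs) = qF))"
      "fst (last hs) = qF \<longrightarrow> k > 0" by blast
    have "finite_play M (hs @ [c'])" unfolding finite_play_def
    proof (intro conjI allI impI)
      show "set (hs @ [c']) \<subseteq> confs M" using hs(1) c'(3) by (auto simp: finite_play_def inv_def)
      fix i assume i: "Suc i < length (hs @ [c'])"
      show "step M ((hs @ [c']) ! i) ((hs @ [c']) ! Suc i)"
      proof (cases "Suc i < length hs")
        case True
        then show ?thesis using hs(1) by (simp add: finite_play_def nth_append)
      next
        case False
        then have "i = length hs - 1" "Suc i = length hs" using i by auto
        then show ?thesis using c'(1) ne by (simp add: nth_append last_conv_nth)
      qed
    qed simp
    then have "P (Suc n) (hs @ [c'], k - of_bool (fst (last hs) = qF))"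
      using hs c'(3) ne by (simp add: P_def)
    moreover have "Qs n s (hs @ [c'], k - of_bool (fst (last hs) = qF))"
      using c' by (auto simp: Qs_def hk)
    ultimately show "\<exists>s'. P (Suc n) s' \<and> Qs n s s'" by blast
  qed
  then obtain f where f: "\<And>n. P n (f n)" "\<And>n. Qs n (f n) (f (Suc n))" by blast
  define \<rho> where "\<rho> i = last (fst (f i))" for i
  have hist: "fst (f i) = map \<rho> [0..<Suc i]" for i
  proof (induction i)
    case 0
    have "length (fst (f 0)) = 1" using f(1)[of 0] by (simp add: P_def)
    then show ?case by (cases "fst (f 0)") (auto simp: \<rho>_def)
  next
    case (Suc i)
    have "fst (f (Suc i)) = fst (f i) @ [\<rho> (Suc i)]" using f(2)[of i] by (simp add: Qs_def \<rho>_def)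
    then show ?case by (simp add: Suc)
  qed
  have \<rho>0: "\<rho> 0 = (q0, v0)" using f(1)[of 0] hist[of 0] by (simp add: P_def)
  have st: "step M (\<rho> i) (\<rho> (Suc i))" for i using f(2)[of i] by (simp add: Qs_def \<rho>_def)
  have "Inf \<rho> \<in> Outcome M (q0, v0) \<sigma>"
  proof -
    have "\<rho> (Suc i) = \<sigma> (map \<rho> [0..<Suc i])" if "\<rho> i \<in> confs1 M" for i
      using f(2)[of i] that unfolding Qs_def hist[of i, symmetric] by (simp add: \<rho>_def)
    then show ?thesis unfolding Outcome_def using st stepD(1)[OF st] \<rho>0 by (simp del: upt_Suc)
  qed
  \<comment> \<open>Allowance left plus visits made is invariant, which bounds the visits by
    \<open>k0\<close>; for reachability \<open>k0 = 0\<close>.\<close>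
  moreover have count: "snd (f n) + card {i. i < n \<and> fst (\<rho> i) = qF} = k0" for n
  proof (induction n)
    case 0
    show ?case using f(1)[of 0] by (simp add: P_def)
  next
    case (Suc n)
    have "{i. i < Suc n \<and> fst (\<rho> i) = qF} = {i. i < n \<and> fst (\<rho> i) = qF} \<union> (if fst (\<rho> n) = qF then
        {n} else {})"
      by (auto simp: less_Suc_eq)
    then have "card {i. i < Suc n \<and> fst (\<rho> i) = qF} = card {i. i < n \<and> fst (\<rho> i) = qF} + of_bool
        (fst (\<rho> n) = qF)"
      by auto
    moreover have "snd (f (Suc n)) + of_bool (fst (\<rho> n) = qF) = snd (f n)"
      using f(2)[of n] by (simp add: Qs_def \<rho>_def)
    ultimately show ?case using Suc by simp
  qed
  moreover have "finite {i. fst (\<rho> i) = qF}"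
  proof (rule ccontr)
    assume "infinite {i. fst (\<rho> i) = qF}"
    then obtain B where B: "B \<subseteq> {i. fst (\<rho> i) = qF}" "finite B" "card B = Suc k0"
      using infinite_arbitrarily_large by blast
    then obtain n where "\<forall>i\<in>B. i < n" using finite_nat_set_iff_bounded by blast
    then have "B \<subseteq> {i. i < n \<and> fst (\<rho> i) = qF}" using B(1) by auto
    then have "card B \<le> card {i. i < n \<and> fst (\<rho> i) = qF}" by (intro card_mono) auto
    then show False using count[of n] B(3) by simp
  qed
  moreover have "fst (\<rho> i) \<noteq> qF" if b for i
  proof
    assume "fst (\<rho> i) = qF"
    moreover have "card {j. j < Suc i \<and> fst (\<rho> j) = qF} = 0"
      using count[of "Suc i"] n0(4) that by (simp add: k0_def)
    ultimately show False by simp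
  qed
  ultimately show ?thesis by blast
qed

section \<open>From certificates to the two decision problems\<close>

lemma sure_reach_of_cert:
  assumes "yes_cert True q0 (nth v0) \<beta> Mx E" "finite Mx"
  shows "sure_reach S (q0, v0) qF"
proof -
  obtain \<sigma> where \<sigma>: "strategy M \<sigma>" "\<forall>\<pi>\<in>Outcome M (q0, v0) \<sigma>. \<exists>\<rho>. \<pi> = Inf \<rho> \<and>
    ((\<exists>i. True \<and> fst (\<rho> i) = qF) \<or> infinite {i. fst (\<rho> i) = qF})"
    using yes_cert_sound[OF assms] by blast
  have "visits qF \<pi>" if \<pi>: "\<pi> \<in> Outcome M (q0, v0) \<sigma>" for \<pi>
  proof -
    obtain \<rho> where \<rho>: "\<pi> = Inf \<rho>" "(\<exists>i. True \<and> fst (\<rho> i) = qF) \<or> infinite {i. fst (\<rho> i) = qF}"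
      using \<sigma>(2)[rule_format, OF \<pi>] by blast
    then have "\<exists>i. fst (\<rho> i) = qF" using infinite_imp_nonempty by blast
    then show ?thesis by (simp add: \<rho>(1))
  qed
  with \<sigma>(1) show ?thesis unfolding sure_reach_def by blast
qed

lemma sure_repeated_reach_of_cert:
  assumes "yes_cert False q0 (nth v0) \<beta> Mx E" "finite Mx"
  shows "sure_repeated_reach S (q0, v0) qF"
proof -
  obtain \<sigma> where \<sigma>: "strategy M \<sigma>" "\<forall>\<pi>\<in>Outcome M (q0, v0) \<sigma>. \<exists>\<rho>. \<pi> = Inf \<rho> \<and>
    ((\<exists>i. False \<and> fst (\<rho> i) = qF) \<or> infinite {i. fst (\<rho> i) = qF})"
    using yes_cert_sound[OF assms] by blast
  have "visits_inf qF \<pi>" if \<pi>: "\<pi> \<in> Outcome M (q0, v0) \<sigma>" for \<pi>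
    using \<sigma>(2)[rule_format, OF \<pi>] by auto
  with \<sigma>(1) show ?thesis unfolding sure_repeated_reach_def by blast
qed

lemma not_sure_reach_of_cert:
  assumes "no_cert True q0 (nth v0) N"
  shows "\<not> sure_reach S (q0, v0) qF"
proof
  assume "sure_reach S (q0, v0) qF"
  then obtain \<sigma> where \<sigma>: "strategy M \<sigma>" "Outcome M (q0, v0) \<sigma> \<subseteq> {\<pi>. visits qF \<pi>}"
    unfolding sure_reach_def by blast
  obtain \<rho> where "Inf \<rho> \<in> Outcome M (q0, v0) \<sigma>" "\<forall>i. fst (\<rho> i) \<noteq> qF"
    using no_cert_sound[OF assms \<sigma>(1)] by blast
  with \<sigma>(2) show False by (auto dest: subsetD)
qed

lemma not_sure_repeated_reach_of_cert:
  assumes "no_cert False q0 (nth v0) N"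
  shows "\<not> sure_repeated_reach S (q0, v0) qF"
proof
  assume "sure_repeated_reach S (q0, v0) qF"
  then obtain \<sigma> where \<sigma>: "strategy M \<sigma>" "Outcome M (q0, v0) \<sigma> \<subseteq> {\<pi>. visits_inf qF \<pi>}"
    unfolding sure_repeated_reach_def by blast
  obtain \<rho> where "Inf \<rho> \<in> Outcome M (q0, v0) \<sigma>" "finite {i. fst (\<rho> i) = qF}"
    using no_cert_sound[OF assms \<sigma>(1)] by blast
  with \<sigma>(2) show False by (auto dest: subsetD)
qed

abbreviation "input \<equiv> instance_code (S, (q0, v0), qF)"

lemma accessors:
  "fn (fn input 0) 0 = vdim S" "set_decode (fn (fn input 0) 2) = states1 S" "set_decode (fn (fn
      input 0) 4) = TC"
  "fn input 1 = q0" "fn input 3 = qF" "fn input 2 = list_encode v0"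
  using vass_mdp_finite[OF wf]
  by (simp_all add: fn_list_encode vass_code_def del: list_encode.simps)

text \<open>The two functions are known to agree below the dimension, and certificates look no
  further.\<close>

lemma v0_cong: "yes_cert b q0 (fn (list_encode v0)) = yes_cert b q0 (nth v0)"
  "no_cert b q0 (fn (list_encode v0)) = no_cert b q0 (nth v0)"
  using v0 by (auto simp: yes_cert_def no_cert_def fn_list_encode fun_eq_iff)

lemma yes_code_iff: "yes_code b input \<longleftrightarrow> (\<exists>\<beta> mc ec. yes_cert b q0 (nth v0) \<beta> (set_decode mc)
    (set_decode ec))"
  unfolding yes_code_def accessors v0_cong ..

lemma no_code_iff: "no_code b input \<longleftrightarrow> (\<exists>nc. no_cert b q0 (nth v0) (set_decode nc))"
  unfolding no_code_def accessors v0_cong ..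

lemma yes_or_no: "yes_code b input \<or> no_code b input"
proof (cases "Lose b q0 (nth v0)")
  case True
  obtain N where "finite N" "no_cert b q0 (nth v0) N" using no_cert_complete[OF True q0] by blast
  then have "no_cert b q0 (nth v0) (set_decode (set_encode N))" by simp
  then show ?thesis unfolding no_code_iff by blast
next
  case False
  obtain \<beta> Mx E where "finite Mx" "finite E" "yes_cert b q0 (nth v0) \<beta> Mx E"
    using yes_cert_complete[OF False q0] by blast
  then have "yes_cert b q0 (nth v0) \<beta> (set_decode (set_encode Mx)) (set_decode (set_encode E))" by simp
  then show ?thesis unfolding yes_code_iff by blast
qed

end

theorem theorem4:
  "decidable_problem instance_code deadlock_free_P_instances
     {(S, c0, qF). sure_reach S c0 qF} \<and>
   decidable_problem instance_code deadlock_free_P_instances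
     {(S, c0, qF). sure_repeated_reach S c0 qF}"
proof
  have inst: "\<exists>S q0 v0 qF. i = (S, (q0, v0), qF) \<and> pvass_instance S q0 v0 qF"
    if "i \<in> deadlock_free_P_instances" for i
    using that by (cases i) (auto simp: pvass_instance_def)
  have total: "yes_code b (instance_code i) \<or> no_code b (instance_code i)"
    if "i \<in> deadlock_free_P_instances" for b i
    using inst[OF that] pvass_instance.yes_or_no by blast
  show "decidable_problem instance_code deadlock_free_P_instances {(S, c0, qF). sure_reach S c0 qF}"
  proof (rule decidable_by_search[OF semidecidable_yes_code[of True] semidecidable_no_code[of
      True] total])
    fix i assume "i \<in> deadlock_free_P_instances"
    from inst[OF this] obtain S q0 v0 qF where i: "i = (S, (q0, v0), qF)" "pvass_instance S q0 v0
        qF" by blast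
    interpret pvass_instance S q0 v0 qF by (rule i(2))
    show "i \<in> {(S, c0, qF). sure_reach S c0 qF}" if "yes_code True (instance_code i)"
      using that sure_reach_of_cert finite_set_decode unfolding i(1) yes_code_iff by auto
    show "i \<notin> {(S, c0, qF). sure_reach S c0 qF}" if "no_code True (instance_code i)"
      using that not_sure_reach_of_cert unfolding i(1) no_code_iff by auto
  qed
  show "decidable_problem instance_code deadlock_free_P_instances {(S, c0, qF).
      sure_repeated_reach S c0 qF}"
  proof (rule decidable_by_search[OF semidecidable_yes_code[of False] semidecidable_no_code[of
      False] total])
    fix i assume "i \<in> deadlock_free_P_instances"
    from inst[OF this] obtain S q0 v0 qF where i: "i = (S, (q0, v0), qF)" "pvass_instance S q0 v0
        qF" by blast
    interpret pvass_instance S q0 v0 qF by (rule i(2))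
    show "i \<in> {(S, c0, qF). sure_repeated_reach S c0 qF}" if "yes_code False (instance_code i)"
      using that sure_repeated_reach_of_cert finite_set_decode unfolding i(1) yes_code_iff by auto
    show "i \<notin> {(S, c0, qF). sure_repeated_reach S c0 qF}" if "no_code False (instance_code i)"
      using that not_sure_repeated_reach_of_cert unfolding i(1) no_code_iff by auto
  qed
qed

end
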